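(* Let $k\ge 2$ be fixed and let $\omega$ be the matrix multiplication exponent. Consider the $\mathrm{PDA}\cap\mathrm{NFA}^{k-1}$ non-emptiness problem over a fixed input alphabet $\Sigma$ (chosen in advance, not part of the input), and let $n$ be the maximum number of states among all the given machines. (1) If the $3(k-1)$-Clique hypothesis is true, then for every $\epsilon>0$ the problem cannot be solved in time $O(n^{\omega(k-1)-\epsilon})$. (2) If the combinatorial $3(k-1)$-Clique hypothesis is true, then for every $\epsilon>0$ the problem cannot be solved by a combinatorial algorithm in time $O(n^{3(k-1)-\epsilon})$. Both lower bounds already hold when the given PDA is a DPDA.
   Context: A PDA is a tuple $P=(Q,\Sigma,\Gamma,\delta,q_0,F)$ with finite state set $Q$, input alphabet $\Sigma$, stack alphabet $\Gamma$, finite transition relation $\delta\subseteq Q\times(\Sigma\cup\{\varepsilon\})\times\Gamma\times Q\times\Gamma^*$, initial state $q_0$, final states $F$. A configuration is a pair $(p,\gamma)$ with $p\in Q$, $\gamma\in\Gamma^*$ (top of stack on the right). A transition $(p,a,\alpha,q,\beta)$ allows a step $(p,\gamma\alpha)\to(q,\gamma\beta)$ reading $a$. $\Gamma$ contains an end-of-stack symbol $Z_0$ such that in every transition $(p,a,\alpha,q,\beta)$, $\beta$ contains $Z_0$ iff $\alpha=Z_0$ and $\beta=Z_0\gamma$ with $\gamma\in(\Gamma\setminus\{Z_0\})^*$. A word $w$ is accepted if, starting from $(q_0,Z_0)$, some sequence of steps reading $w$ (with $\varepsilon$-transitions allowed in between) ends in a state of $F$ with empty stack (i.e. only the marker $Z_0$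 remains). $\mathcal L(P)$ is the set of accepted words. A PDA is deterministic (a DPDA) if $\delta$ is a partial function of (state, letter or $\varepsilon$, top symbol) and, for each state $q$, either $\delta(q,a,\alpha)$ is defined for all $a\in\Sigma,\alpha\in\Gamma$ and $\delta(q,\varepsilon,\alpha)$ for no $\alpha$, or $\delta(q,\varepsilon,\alpha)$ is defined for all $\alpha$ and $\delta(q,a,\alpha)$ for no $a\in\Sigma,\alpha$. An NFA is a PDA with no $\varepsilon$-transitions and no stack operations. $\mathrm{PDA}\cap\mathrm{NFA}^{k-1}$ non-emptiness ($k$ fixed, stack alphabet $\Gamma$ fixed): the input is a PDA $P$ and $k-1$ NFAs $A_1,\dots,A_{k-1}$ over a common input alphabet $\Sigma$; decide whether $\mathcal L(P)\cap\mathcal L(A_1)\cap\dots\cap\mathcal L(A_{k-1})\neq\emptyset$. Here $\Sigma$ is also fixed in advance (constant size). The exponent $\omega$ is the infimum of all $c$ such that two $n\times n$ matrices can be multiplied in time $O(n^c)$. The $r$-Clique hypothesis ($r\ge3$): for each $\epsilon>0$ no algorithm decides whether an $n$-vertex graph has a clique of size $r$ in time $O(n^{\omega r/3-\epsilon})$. The combinatorial $r$-Clique hypothesis: for each $\epsilon>0$ no combinatorial algorithm decides this in time $O(n^{r-\epsilon})$. "Combinatorial algorithm" is an informal notion: an algorithm that does not use fast matrix multiplication techniques. *)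

theory Defs
  imports Complex_Main "HOL-Library.Landau_Symbols" "HOL-Library.Extended_Nat"
begin

section \<open>Pushdown automata\<close>

text \<open>The letter \<open>None\<close> of a transition stands for the empty word. Stacks are lists whose
  \<^emph>\<open>last\<close> element is the top.\<close>

type_synonym ('q, 'a, 'g) transition = "'q \<times> 'a option \<times> 'g \<times> 'q \<times> 'g list"

record ('q, 'a, 'g) automaton =
  states :: "'q set"
  alphabet :: "'a set"
  stack_alphabet :: "'g set"
  bottom :: 'g
  transitions :: "('q, 'a, 'g) transition set"
  initial :: 'q
  final :: "'q set"

definition pda :: "('q, 'a, 'g) automaton \<Rightarrow> bool" where
  "pda P \<longleftrightarrow>
     finite (states P) \<and> finite (alphabet P) \<and> finite (stack_alphabet P) \<and>
     finite (transitions P) \<and>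
     transitions P \<subseteq> states P \<times> ({None} \<union> Some ` alphabet P) \<times> stack_alphabet P
                      \<times> states P \<times> lists (stack_alphabet P) \<and>
     initial P \<in> states P \<and> final P \<subseteq> states P \<and> bottom P \<in> stack_alphabet P \<and>
     (\<forall>(p, a, \<alpha>, q, \<beta>) \<in> transitions P.
        bottom P \<in> set \<beta> \<longleftrightarrow>
          \<alpha> = bottom P \<and> (\<exists>\<gamma>. \<beta> = bottom P # \<gamma> \<and> bottom P \<notin> set \<gamma>))"

inductive run :: "('q, 'a, 'g) automaton \<Rightarrow> 'q \<times> 'g list \<Rightarrow> 'a list \<Rightarrow> 'q \<times> 'g list \<Rightarrow> bool"
  for P where
  run_refl: "run P c [] c"
| run_eps: "(p, None, \<alpha>, q, \<beta>) \<in> transitions P \<Longrightarrow> run P (q, \<gamma> @ \<beta>) w c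
     \<Longrightarrow> run P (p, \<gamma> @ [\<alpha>]) w c"
| run_letter: "(p, Some a, \<alpha>, q, \<beta>) \<in> transitions P \<Longrightarrow> run P (q, \<gamma> @ \<beta>) w c
     \<Longrightarrow> run P (p, \<gamma> @ [\<alpha>]) (a # w) c"

definition lang :: "('q, 'a, 'g) automaton \<Rightarrow> 'a list set" where
  "lang P = {w. \<exists>f \<in> final P. run P (initial P, [bottom P]) w (f, [bottom P])}"

definition dpda :: "('q, 'a, 'g) automaton \<Rightarrow> bool" where
  "dpda P \<longleftrightarrow> pda P \<and>
     (\<forall>p a \<alpha> q \<beta> q' \<beta>'. (p, a, \<alpha>, q, \<beta>) \<in> transitions P \<longrightarrow> (p, a, \<alpha>, q', \<beta>') \<in> transitions P
        \<longrightarrow> q = q' \<and> \<beta> = \<beta>') \<and>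
     (let defined = (\<lambda>p a \<alpha>. \<exists>q \<beta>. (p, a, \<alpha>, q, \<beta>) \<in> transitions P) in
      \<forall>p \<in> states P.
        (\<forall>a \<in> alphabet P. \<forall>\<alpha> \<in> stack_alphabet P. defined p (Some a) \<alpha>) \<and>
        (\<forall>\<alpha> \<in> stack_alphabet P. \<not> defined p None \<alpha>)
      \<or>
        (\<forall>\<alpha> \<in> stack_alphabet P. defined p None \<alpha>) \<and>
        (\<forall>a \<in> alphabet P. \<forall>\<alpha> \<in> stack_alphabet P. \<not> defined p (Some a) \<alpha>))"

definition nfa :: "('q, 'a, 'g) automaton \<Rightarrow> bool" where
  "nfa A \<longleftrightarrow> pda A \<and> (\<forall>(p, a, \<alpha>, q, \<beta>) \<in> transitions A. a \<noteq> None \<and> \<beta> = [\<alpha>])"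

definition push_bounded :: "enat \<Rightarrow> ('q, 'a, 'g) automaton \<Rightarrow> bool" where
  "push_bounded b P \<longleftrightarrow> (\<forall>(p, a, \<alpha>, q, \<beta>) \<in> transitions P. enat (length \<beta>) \<le> b)"


section \<open>Machine model\<close>

text \<open>
  Time is measured on a unit-cost RAM with logarithmic word length. Programs are written in
  structured form (a goto program with a fixed number of instructions is a single loop around a
  case distinction on a program counter, at the price of a constant factor). There are registers
  and an array of memory cells, both holding natural numbers.

  \<^term>\<open>W\<close> is the word bound: a computation that produces a number \<open>\<ge> W\<close> is stuck, so programs
  have to keep all their numbers (and hence addresses) below \<open>W\<close>.
\<close>

datatype binop = Add | Sub | Mul | Div | Mod | And | Or | Xor

fun binop_val :: "binop \<Rightarrow> nat \<Rightarrow> nat \<Rightarrow> nat" where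
  "binop_val Add x y = x + y"
| "binop_val Sub x y = x - y"
| "binop_val Mul x y = x * y"
| "binop_val Div x y = x div y"
| "binop_val Mod x y = x mod y"
| "binop_val And x y = Bit_Operations.and x y"
| "binop_val Or x y = Bit_Operations.or x y"
| "binop_val Xor x y = Bit_Operations.xor x y"

datatype program =
    Const nat nat
  | Op binop nat nat nat
  | Load nat nat
  | Store nat nat
  | Seq program program
  | If nat program program
  | While nat program

type_synonym ram_state = "(nat \<Rightarrow> nat) \<times> (nat \<Rightarrow> nat)"

text \<open>\<open>exec W A \<sigma> t \<sigma>'\<close>: started in \<open>\<sigma>\<close>, the program \<open>A\<close> halts in \<open>\<sigma>'\<close> after \<open>t\<close> steps.\<close>

inductive exec :: "nat \<Rightarrow> program \<Rightarrow> ram_state \<Rightarrow> nat \<Rightarrow> ram_state \<Rightarrow> bool" for W where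
  exec_Const: "v < W \<Longrightarrow> exec W (Const d v) (r, m) 1 (r(d := v), m)"
| exec_Op: "binop_val f (r a) (r b) < W
     \<Longrightarrow> exec W (Op f d a b) (r, m) 1 (r(d := binop_val f (r a) (r b)), m)"
| exec_Load: "exec W (Load d a) (r, m) 1 (r(d := m (r a)), m)"
| exec_Store: "exec W (Store a d) (r, m) 1 (r, m(r a := r d))"
| exec_Seq: "exec W A \<sigma> t \<sigma>' \<Longrightarrow> exec W B \<sigma>' t' \<sigma>'' \<Longrightarrow> exec W (Seq A B) \<sigma> (t + t') \<sigma>''"
| exec_IfTrue: "r a \<noteq> 0 \<Longrightarrow> exec W A (r, m) t \<sigma> \<Longrightarrow> exec W (If a A B) (r, m) (1 + t) \<sigma>"
| exec_IfFalse: "r a = 0 \<Longrightarrow> exec W B (r, m) t \<sigma> \<Longrightarrow> exec W (If a A B) (r, m) (1 + t) \<sigma>"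
| exec_WhileFalse: "r a = 0 \<Longrightarrow> exec W (While a A) (r, m) 1 (r, m)"
| exec_WhileTrue: "r a \<noteq> 0 \<Longrightarrow> exec W A (r, m) t \<sigma> \<Longrightarrow> exec W (While a A) \<sigma> t' \<sigma>'
     \<Longrightarrow> exec W (While a A) (r, m) (1 + t + t') \<sigma>'"

definition initial_state :: "nat list \<Rightarrow> ram_state" where
  "initial_state xs = ((\<lambda>_. 0), (\<lambda>i. if i < length xs then xs ! i else 0))"

text \<open>Words of \<open>c * log\<close> bits, for a constant \<open>c\<close> that belongs to the algorithm. The entries of
  the input count as well as its length, so that every word of the input fits.\<close>

definition word_bound :: "nat \<Rightarrow> nat list \<Rightarrow> nat" where
  "word_bound c xs = (length xs + Max (insert 0 (set xs)) + 2) ^ c"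

text \<open>A decision problem is given by its instances: the input words, the size parameter in which
  the running time is measured, and the correct answer. The answer is returned in register 0.\<close>

type_synonym problem = "(nat list \<times> nat \<times> bool) set"

definition decides_in_time :: "program \<Rightarrow> problem \<Rightarrow> (nat \<Rightarrow> real) \<Rightarrow> bool" where
  "decides_in_time A X T \<longleftrightarrow>
     (\<exists>c. \<forall>(xs, n, ans) \<in> X. \<exists>t r m.
        exec (word_bound c xs) A (initial_state xs) t (r, m) \<and> r 0 = of_bool ans \<and> real t \<le> T n)"

definition solvable_in_power :: "program set \<Rightarrow> problem \<Rightarrow> real \<Rightarrow> bool" where
  "solvable_in_power C X e \<longleftrightarrow>
     (\<exists>A \<in> C. \<exists>T \<in> O(\<lambda>n. real n powr e). decides_in_time A X T)"


section \<open>The matrix multiplication exponent\<close>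

text \<open>
  Time for matrix multiplication is the number of arithmetic operations: straight-line programs
  over the rationals. Position \<open>i\<close> of the value list is the \<open>i\<close>-th input entry or intermediate
  result.
\<close>

datatype arith = Plus nat nat | Minus nat nat | Times nat nat | Scalar rat

definition arg_val :: "rat list \<Rightarrow> nat \<Rightarrow> rat" where
  "arg_val vs i = (if i < length vs then vs ! i else 0)"

fun arith_val :: "rat list \<Rightarrow> arith \<Rightarrow> rat" where
  "arith_val vs (Plus i j) = arg_val vs i + arg_val vs j"
| "arith_val vs (Minus i j) = arg_val vs i - arg_val vs j"
| "arith_val vs (Times i j) = arg_val vs i * arg_val vs j"
| "arith_val vs (Scalar x) = x"

definition slp_vals :: "arith list \<Rightarrow> rat list \<Rightarrow> rat list" where
  "slp_vals ops vs = foldl (\<lambda>us f. us @ [arith_val us f]) vs ops"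

definition matrix_entries :: "nat \<Rightarrow> (nat \<Rightarrow> nat \<Rightarrow> 'a) \<Rightarrow> 'a list" where
  "matrix_entries n A = map (\<lambda>i. A (i div n) (i mod n)) [0..<n * n]"

definition multiplies_matrices :: "nat \<Rightarrow> arith list \<Rightarrow> bool" where
  "multiplies_matrices n ops \<longleftrightarrow>
     (\<exists>out. \<forall>A B. \<forall>i<n. \<forall>j<n.
        arg_val (slp_vals ops (matrix_entries n A @ matrix_entries n B)) (out i j)
          = (\<Sum>l<n. A i l * B l j))"

definition mm_exponent :: real where
  "mm_exponent = Inf {c. \<exists>T \<in> O(\<lambda>n. real n powr c).
     \<forall>n. \<exists>ops. multiplies_matrices n ops \<and> real (length ops) \<le> T n}"


section \<open>Clique\<close>

definition simple_graph :: "nat \<Rightarrow> (nat \<times> nat) set \<Rightarrow> bool" where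
  "simple_graph n E \<longleftrightarrow> E \<subseteq> {..<n} \<times> {..<n} \<and> sym E \<and> irrefl E"

definition has_clique :: "nat \<Rightarrow> nat \<Rightarrow> (nat \<times> nat) set \<Rightarrow> bool" where
  "has_clique r n E \<longleftrightarrow>
     (\<exists>S \<subseteq> {..<n}. card S = r \<and> (\<forall>u \<in> S. \<forall>v \<in> S. u \<noteq> v \<longrightarrow> (u, v) \<in> E))"

definition graph_code :: "nat \<Rightarrow> (nat \<times> nat) set \<Rightarrow> nat list" where
  "graph_code n E = n # matrix_entries n (\<lambda>u v. of_bool ((u, v) \<in> E))"

definition clique_problem :: "nat \<Rightarrow> problem" where
  "clique_problem r = {(graph_code n E, n, has_clique r n E) | n E. simple_graph n E}"

definition clique_hypothesis :: "nat \<Rightarrow> bool" where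
  "clique_hypothesis r \<longleftrightarrow>
     (\<forall>\<epsilon>>0. \<not> solvable_in_power UNIV (clique_problem r) (mm_exponent * real r / 3 - \<epsilon>))"


section \<open>Combinatorial algorithms\<close>

definition combinatorial_clique_hypothesis :: "program set \<Rightarrow> nat \<Rightarrow> bool" where
  "combinatorial_clique_hypothesis C r \<longleftrightarrow>
     (\<forall>\<epsilon>>0. \<not> solvable_in_power C (clique_problem r) (real r - \<epsilon>))"

text \<open>
  ``Combinatorial'' is an informal notion, so it is an arbitrary class \<open>C\<close> of programs here. The
  only thing asked of \<open>C\<close> is that combinatorial algorithms remain combinatorial when the input
  graph is first rewritten by an elementary reduction. Such a reduction runs in quasi-linear time,
  and every word it writes depends on a bounded number of words of its input only; in particular
  no matrix product is evaluated by it. Since a reduction ends in an initial state for the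
  rewritten input, running the algorithm on its result is plain sequential composition.
\<close>

definition graph_codes :: "nat list set" where
  "graph_codes = {graph_code n E | n E. simple_graph n E}"

definition elementary_reduction :: "program \<Rightarrow> bool" where
  "elementary_reduction R \<longleftrightarrow>
     (\<exists>(f :: nat list \<Rightarrow> nat list) c d (K :: real) q.
        (\<forall>xs \<in> graph_codes. \<exists>t.
           exec (word_bound c xs) R (initial_state xs) t (initial_state (f xs)) \<and>
           real t \<le> K * real (length xs) * (1 + log 2 (real (length xs))) ^ d) \<and>
        (\<forall>xs \<in> graph_codes. \<forall>ys \<in> graph_codes.
           length xs = length ys \<longrightarrow> length (f xs) = length (f ys)) \<and>
        (\<forall>N j. \<exists>J. finite J \<and> card J \<le> q \<and>
           (\<forall>xs \<in> graph_codes. \<forall>ys \<in> graph_codes.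
              length xs = N \<and> length ys = N \<and> j < length (f xs) \<and>
              (\<forall>i \<in> J. i < N \<longrightarrow> xs ! i = ys ! i) \<longrightarrow> f xs ! j = f ys ! j)))"

definition combinatorial_class :: "program set \<Rightarrow> bool" where
  "combinatorial_class C \<longleftrightarrow> (\<forall>R A. elementary_reduction R \<longrightarrow> A \<in> C \<longrightarrow> Seq R A \<in> C)"


section \<open>Non-emptiness of intersection\<close>

text \<open>Machines are presented to a program with states, letters and stack symbols numbered from 0,
  the end-of-stack symbol being 0. Sets are listed without repetitions, in any order.\<close>

type_synonym machine = "(nat, nat, nat) automaton"

definition numbered :: "nat \<Rightarrow> nat \<Rightarrow> machine \<Rightarrow> bool" where
  "numbered s g M \<longleftrightarrow> states M = {..<card (states M)} \<and> alphabet M = {..<s} \<and>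
     stack_alphabet M = {..<g} \<and> bottom M = 0"

fun transition_code :: "(nat, nat, nat) transition \<Rightarrow> nat list" where
  "transition_code (p, a, \<alpha>, q, \<beta>) =
     [p, case a of None \<Rightarrow> 0 | Some x \<Rightarrow> Suc x, \<alpha>, q, length \<beta>] @ \<beta>"

definition codes_machine :: "nat list \<Rightarrow> machine \<Rightarrow> bool" where
  "codes_machine xs M \<longleftrightarrow> (\<exists>fs ts.
     distinct fs \<and> set fs = final M \<and> distinct ts \<and> set ts = transitions M \<and>
     xs = [card (states M), initial M, length fs] @ fs @ [length ts] @ concat (map transition_code ts))"

text \<open>
  The size parameter is the number of states. It bounds the input length polynomially only if
  the words pushed by the PDA have bounded length; therefore there is a bound \<open>b\<close> on this
  length, where \<open>b = \<infinity>\<close> admits all machines.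
\<close>

definition nonemptiness_problem ::
    "(machine \<Rightarrow> bool) \<Rightarrow> enat \<Rightarrow> nat \<Rightarrow> nat \<Rightarrow> nat \<Rightarrow> problem" where
  "nonemptiness_problem K b s g k =
     {(concat css,
       Max ((\<lambda>M. card (states M)) ` set (P # As)),
       lang P \<inter> (\<Inter>A \<in> set As. lang A) \<noteq> {}) | P As css.
        K P \<and> push_bounded b P \<and> length As = k - 1 \<and> (\<forall>A \<in> set As. nfa A) \<and>
        (\<forall>M \<in> set (P # As). numbered s g M) \<and> list_all2 codes_machine css (P # As)}"

end

theory Submission
  imports Defs
begin

text \<open>
  Let \<open>m = k - 1\<close>. A clique of size \<open>3m\<close> is a triple of \<open>m\<close>-tuples \<open>p\<close>, \<open>q\<close>, \<open>r\<close> of vertices. The \<open>m\<close> finite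
  automata hold one tuple at a time, one vertex each, and need \<open>O(n)\<close> states because only the number
  of the current block of the word, out of a constant number, is stored besides the vertex. The
  pushdown automaton copies tuples to and from its stack in unary. To replace a tuple \<open>p\<close> by a tuple
  \<open>q\<close> all of whose entries are adjacent to all entries of \<open>p\<close>, all automata move from their vertex
  to a neighbour, the counter of the pushdown automaton checks that they have reached the same vertex, which
  is pushed, and the values \<open>p\<close> are restored from the stack; this is done for each entry of \<open>q\<close>.
  Going from \<open>p\<close> to \<open>q\<close> to \<open>r\<close> and back to \<open>p\<close>, of which a copy lies at the bottom of the stack, and
  checking each tuple itself in the same way, finds the clique.

  The instance has length \<open>O(n\<^sup>2)\<close> and is written in this time by a program in which each output word
  copies at most one entry of the adjacency matrix. This reduction covers exponents \<open>\<ge> 2\<close>. Smaller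
  exponents are impossible unconditionally, since the \<open>n\<^sup>2\<close> transitions of an automaton have to be read.
\<close>


section \<open>Generating programs\<close>

text \<open>The obstacle is memory: with \<open>O(n)\<close> states an automaton cannot hold an old
  and a new vertex at once, so every look at an edge destroys the vertex it starts from. This
  dictates the detour over the stack: save, jump, compare, restore. An automaton can be compared
  with a number only by counting itself down, so even saving a vertex erases it and has to write it
  back.

  The sizes fit because vertices enter the states only linearly: \<open>n\<close> vertices become
  \<open>O(n)\<close> states, and the exponents \<open>omega * (3 * m) / 3 = omega * m\<close> and
  \<open>3 * m\<close> of the clique hypotheses carry over unchanged. The graph is stored in the
  transitions of the finite automata alone; the pushdown automaton depends only on \<open>n\<close>.

  A reduction has to end exactly in the initial state for its output. It is therefore compiled from
  a small loop language whose output has a shape determined by \<open>n\<close>, so that the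
  position of each copied adjacency entry is known in advance. This gives both the locality required
  of an elementary reduction and the adversary argument for small exponents.\<close>

lemma exec_mono: "exec W A \<sigma> t \<sigma>' \<Longrightarrow> W \<le> W' \<Longrightarrow> exec W' A \<sigma> t \<sigma>'"
  by (induction rule: exec.induct) (auto simp del: One_nat_def intro: exec.intros)

lemma exec_OpI: "binop_val f (r a) (r b) = v \<Longrightarrow> v < W \<Longrightarrow> exec W (Op f d a b) (r, m) 1 (r(d := v), m)"
  using exec_Op by blast

section \<open>Arithmetic expressions in the size and the loop indices\<close>

datatype expr = Lit nat | Size | Idx nat | Sum expr expr | Diff expr expr | Prod expr expr

fun val :: "nat \<Rightarrow> (nat \<Rightarrow> nat) \<Rightarrow> expr \<Rightarrow> nat" where
  "val n \<rho> (Lit c) = c"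
| "val n \<rho> Size = n"
| "val n \<rho> (Idx i) = \<rho> i"
| "val n \<rho> (Sum a b) = val n \<rho> a + val n \<rho> b"
| "val n \<rho> (Diff a b) = val n \<rho> a - val n \<rho> b"
| "val n \<rho> (Prod a b) = val n \<rho> a * val n \<rho> b"

text \<open>An exponent for the base \<open>n + 2\<close>; as this base is at least 2,
  \<open>c < 2 ^ c\<close> lets a literal \<open>c\<close> count with exponent \<open>c\<close>. A
  difference counts both operands, since the value of the subtrahend has to fit into a word
  too.\<close>

fun edeg :: "expr \<Rightarrow> nat" where
  "edeg (Lit c) = c"
| "edeg Size = 1"
| "edeg (Idx i) = 1"
| "edeg (Sum a b) = edeg a + edeg b + 1"
| "edeg (Diff a b) = edeg a + edeg b"
| "edeg (Prod a b) = edeg a + edeg b"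

text \<open>One more than the largest loop index, so that \<open>eidx e \<le> k\<close> says that
  \<open>k\<close> enclosing loops suffice to evaluate the expression.\<close>

fun eidx :: "expr \<Rightarrow> nat" where
  "eidx (Lit c) = 0"
| "eidx Size = 0"
| "eidx (Idx i) = Suc i"
| "eidx (Sum a b) = max (eidx a) (eidx b)"
| "eidx (Diff a b) = max (eidx a) (eidx b)"
| "eidx (Prod a b) = max (eidx a) (eidx b)"

lemma val_less:
  assumes "\<And>i. i < eidx e \<Longrightarrow> \<rho> i \<le> n"
  shows "val n \<rho> e < (n + 2) ^ edeg e"
  using assms
proof (induction e)
  case (Lit c)
  have "c < 2 ^ c" by (rule less_exp)
  also have "\<dots> \<le> (n + 2) ^ c" by (rule power_mono) auto
  finally show ?case by simp
next
  case (Idx i)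
  then have "\<rho> i \<le> n" by simp
  then show ?case by simp
next
  case (Sum a b)
  have a: "val n \<rho> a < (n + 2) ^ edeg a" and b: "val n \<rho> b < (n + 2) ^ edeg b"
    using Sum by auto
  have "(n + 2) ^ edeg a \<le> (n + 2) ^ (edeg a + edeg b)" "(n + 2) ^ edeg b \<le> (n + 2) ^ (edeg a + edeg b)"
    by (auto intro!: power_increasing)
  then have "val n \<rho> (Sum a b) < 2 * (n + 2) ^ (edeg a + edeg b)" using a b
    unfolding val.simps by linarith
  also have "\<dots> \<le> (n + 2) * (n + 2) ^ (edeg a + edeg b)" by simp
  finally show ?case by simp
next
  case (Diff a b)
  have "val n \<rho> a < (n + 2) ^ edeg a" using Diff by auto
  also have "\<dots> \<le> (n + 2) ^ (edeg a + edeg b)" by (auto intro!: power_increasing)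
  finally show ?case by (simp add: less_imp_diff_less)
next
  case (Prod a b)
  then have "val n \<rho> a < (n + 2) ^ edeg a" "val n \<rho> b < (n + 2) ^ edeg b" by auto
  then show ?case by (auto simp: power_add intro!: mult_strict_mono)
qed auto

text \<open>
  Registers: 0 holds zero, 1 the size \<open>n\<close>, 2 the output position, 3 the address \<open>B\<close> of a copy
  of the input, 4 holds one, \<open>5 + i\<close> the loop index \<open>i < 5\<close>; registers from 10 on are scratch.
\<close>

fun cexpr :: "expr \<Rightarrow> nat \<Rightarrow> program" where
  "cexpr (Lit c) d = Const d c"
| "cexpr Size d = Op Add d 1 0"
| "cexpr (Idx i) d = Op Add d (5 + i) 0"
| "cexpr (Sum a b) d = Seq (cexpr a d) (Seq (cexpr b (Suc d)) (Op Add d d (Suc d)))"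
| "cexpr (Diff a b) d = Seq (cexpr a d) (Seq (cexpr b (Suc d)) (Op Sub d d (Suc d)))"
| "cexpr (Prod a b) d = Seq (cexpr a d) (Seq (cexpr b (Suc d)) (Op Mul d d (Suc d)))"

text \<open>Besides the exact number of steps this bounds the number of scratch registers: a binary
  operation evaluates its second operand one register higher and adds one step.\<close>

fun ecost :: "expr \<Rightarrow> nat" where
  "ecost (Sum a b) = ecost a + ecost b + 1"
| "ecost (Diff a b) = ecost a + ecost b + 1"
| "ecost (Prod a b) = ecost a + ecost b + 1"
| "ecost _ = 1"

lemma edeg_mono_power: "(n + 2 :: nat) ^ a \<le> W \<Longrightarrow> b \<le> a \<Longrightarrow> (n + 2) ^ b \<le> W"
  by (rule order_trans[OF power_increasing]) auto

text \<open>The common induction step of the three binary operations. The second operand works from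
  register \<open>Suc d\<close> upwards, so the first result survives in \<open>d\<close>.\<close>

lemma exec_cexpr_bin:
  assumes "\<exists>r1. exec W A (r, m) s (r1, m) \<and> r1 d = x \<and> (\<forall>j. j < d \<or> j \<ge> d + s \<longrightarrow> r1 j = r j)"
    and "\<And>r1. \<forall>j<d. r1 j = r j \<Longrightarrow>
      \<exists>r2. exec W B (r1, m) t (r2, m) \<and> r2 (Suc d) = y \<and> (\<forall>j. j < Suc d \<or> j \<ge> Suc d + t \<longrightarrow> r2 j = r1 j)"
    and "binop_val f x y < W" "s > 0"
  shows "\<exists>r'. exec W (Seq A (Seq B (Op f d d (Suc d)))) (r, m) (Suc (s + t)) (r', m) \<and>
    r' d = binop_val f x y \<and> (\<forall>j. j < d \<or> j \<ge> Suc (d + (s + t)) \<longrightarrow> r' j = r j)"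
proof -
  obtain r1 where r1: "exec W A (r, m) s (r1, m)" "r1 d = x" "\<forall>j. j < d \<or> j \<ge> d + s \<longrightarrow> r1 j = r j"
    using assms(1) by auto
  obtain r2 where r2: "exec W B (r1, m) t (r2, m)" "r2 (Suc d) = y"
    "\<forall>j. j < Suc d \<or> j \<ge> Suc d + t \<longrightarrow> r2 j = r1 j"
    using assms(2)[of r1] r1 by auto
  have "binop_val f (r2 d) (r2 (Suc d)) < W" using r1 r2 assms(3) by simp
  from exec_Seq[OF r1(1) exec_Seq[OF r2(1) exec_Op[of f r2 d "Suc d", OF this, of d m]]] show ?thesis
    by (intro exI[of _ "r2(d := binop_val f x y)"]) (use r1 r2 in auto)
qed

lemma ecost_pos: "ecost e > 0"
  by (cases e) auto

lemma exec_cexpr: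
  assumes "r 0 = 0" "r 1 = n" "\<And>i. i < eidx e \<Longrightarrow> r (5 + i) = \<rho> i" "\<And>i. i < eidx e \<Longrightarrow> \<rho> i \<le> n"
    "eidx e \<le> 5" "10 \<le> d" "(n + 2) ^ edeg e \<le> W"
  shows "\<exists>r'. exec W (cexpr e d) (r, m) (ecost e) (r', m) \<and> r' d = val n \<rho> e \<and>
    (\<forall>j. j < d \<or> j \<ge> d + ecost e \<longrightarrow> r' j = r j)"
  using assms
proof (induction e arbitrary: r d)
  case (Lit c)
  have "c < W" using val_less[of "Lit c" \<rho> n] Lit by simp
  then have "exec W (cexpr (Lit c) d) (r, m) (ecost (Lit c)) (r(d := c), m)"
    using exec_Const[of c W] by simp
  then show ?case by - (rule exI, rule conjI, assumption, simp)
next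
  case Size
  have "exec W (cexpr Size d) (r, m) (ecost Size) (r(d := n), m)"
    using exec_OpI[of Add r 1 0 n W d m] Size by simp
  then show ?case by - (rule exI, rule conjI, assumption, use Size in simp)
next
  case (Idx i)
  have "\<rho> i \<le> n" "(n + 2) ^ 1 \<le> W" using Idx.prems(4,7) by auto
  then have "\<rho> i < W" by simp
  then have "exec W (Op Add d (5 + i) 0) (r, m) 1 (r(d := \<rho> i), m)"
    by (intro exec_OpI) (use Idx in auto)
  then have "exec W (cexpr (Idx i) d) (r, m) (ecost (Idx i)) (r(d := \<rho> i), m)" by simp
  then show ?case by - (rule exI, rule conjI, assumption, use Idx in simp)
next
  case (Sum a b)
  have "(n + 2) ^ edeg a \<le> W" "(n + 2) ^ edeg b \<le> W"
    using edeg_mono_power[OF Sum.prems(7)] by auto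
  moreover have "val n \<rho> (Sum a b) < W"
    using less_le_trans[OF val_less[of "Sum a b" \<rho> n] Sum.prems(7)] Sum.prems(4) by blast
  ultimately have "\<exists>r'. exec W (Seq (cexpr a d) (Seq (cexpr b (Suc d)) (Op Add d d (Suc d)))) (r, m)
      (Suc (ecost a + ecost b)) (r', m) \<and> r' d = binop_val Add (val n \<rho> a) (val n \<rho> b) \<and>
    (\<forall>j. j < d \<or> j \<ge> Suc (d + (ecost a + ecost b)) \<longrightarrow> r' j = r j)"
    by (intro exec_cexpr_bin Sum.IH ecost_pos) (use Sum.prems in auto)
  then show ?case by simp
next
  case (Diff a b)
  have "(n + 2) ^ edeg a \<le> W" "(n + 2) ^ edeg b \<le> W"
    using edeg_mono_power[OF Diff.prems(7)] by auto
  moreover have "val n \<rho> (Diff a b) < W"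
    using less_le_trans[OF val_less[of "Diff a b" \<rho> n] Diff.prems(7)] Diff.prems(4) by blast
  ultimately have "\<exists>r'. exec W (Seq (cexpr a d) (Seq (cexpr b (Suc d)) (Op Sub d d (Suc d)))) (r, m)
      (Suc (ecost a + ecost b)) (r', m) \<and> r' d = binop_val Sub (val n \<rho> a) (val n \<rho> b) \<and>
    (\<forall>j. j < d \<or> j \<ge> Suc (d + (ecost a + ecost b)) \<longrightarrow> r' j = r j)"
    by (intro exec_cexpr_bin Diff.IH ecost_pos) (use Diff.prems in auto)
  then show ?case by simp
next
  case (Prod a b)
  have "(n + 2) ^ edeg a \<le> W" "(n + 2) ^ edeg b \<le> W"
    using edeg_mono_power[OF Prod.prems(7)] by auto
  moreover have "val n \<rho> (Prod a b) < W"
    using less_le_trans[OF val_less[of "Prod a b" \<rho> n] Prod.prems(7)] Prod.prems(4) by blast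
  ultimately have "\<exists>r'. exec W (Seq (cexpr a d) (Seq (cexpr b (Suc d)) (Op Mul d d (Suc d)))) (r, m)
      (Suc (ecost a + ecost b)) (r', m) \<and> r' d = binop_val Mul (val n \<rho> a) (val n \<rho> b) \<and>
    (\<forall>j. j < d \<or> j \<ge> Suc (d + (ecost a + ecost b)) \<longrightarrow> r' j = r j)"
    by (intro exec_cexpr_bin Prod.IH ecost_pos) (use Prod.prems in auto)
  then show ?case by simp
qed

section \<open>Words generated by nested loops\<close>

text \<open>An output word is a value that depends on \<open>n\<close> only, or \<open>1 - x\<close> for the input word \<open>x\<close> at a given
  position. \<open>Idx k\<close> refers to the loop with \<open>k\<close> loops around it; all loops run from 0 to \<open>n - 1\<close>.\<close>

datatype cell = Val nat | Neg nat

fun cell_val :: "(nat \<Rightarrow> nat) \<Rightarrow> cell \<Rightarrow> nat" where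
  "cell_val m (Val x) = x"
| "cell_val m (Neg i) = 1 - m i"

datatype gen = Skip | Emit expr | Emit_neg expr | Then gen gen | For gen

fun out :: "nat \<Rightarrow> nat \<Rightarrow> (nat \<Rightarrow> nat) \<Rightarrow> gen \<Rightarrow> cell list" where
  "out n k \<rho> Skip = []"
| "out n k \<rho> (Emit e) = [Val (val n \<rho> e)]"
| "out n k \<rho> (Emit_neg e) = [Neg (val n \<rho> e)]"
| "out n k \<rho> (Then g h) = out n k \<rho> g @ out n k \<rho> h"
| "out n k \<rho> (For g) = concat (map (\<lambda>v. out n (Suc k) (\<rho>(k := v)) g) [0..<n])"

fun gen_ok :: "nat \<Rightarrow> gen \<Rightarrow> bool" where
  "gen_ok k (Emit e) = (eidx e \<le> k)"
| "gen_ok k (Emit_neg e) = (eidx e \<le> k)"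
| "gen_ok k (Then g h) = (gen_ok k g \<and> gen_ok k h)"
| "gen_ok k (For g) = gen_ok (Suc k) g"
| "gen_ok k Skip = True"

fun nest :: "gen \<Rightarrow> nat" where
  "nest (Then g h) = max (nest g) (nest h)"
| "nest (For g) = Suc (nest g)"
| "nest _ = 0"

fun gdeg :: "gen \<Rightarrow> nat" where
  "gdeg (Emit e) = edeg e"
| "gdeg (Emit_neg e) = edeg e"
| "gdeg (Then g h) = gdeg g + gdeg h"
| "gdeg (For g) = gdeg g"
| "gdeg Skip = 0"

text \<open>The coefficient of \<open>(n + 1) ^ nest g\<close> in the bound on \<open>gcost\<close>.
  The 4 for a loop comes from \<open>n * (c + 3) + 3 \<le> (n + 1) * (c + 4)\<close>.\<close>

fun gsize :: "gen \<Rightarrow> nat" where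
  "gsize (Emit e) = ecost e + 4"
| "gsize (Emit_neg e) = ecost e + 6"
| "gsize (Then g h) = gsize g + gsize h"
| "gsize (For g) = gsize g + 4"
| "gsize Skip = 1"

fun gcost :: "nat \<Rightarrow> gen \<Rightarrow> nat" where
  "gcost n (Emit e) = ecost e + 2"
| "gcost n (Emit_neg e) = ecost e + 5"
| "gcost n (Then g h) = gcost n g + gcost n h"
| "gcost n (For g) = n * (gcost n g + 3) + 3"
| "gcost n Skip = 1"

lemma gcost_le: "gcost n g \<le> gsize g * (n + 1) ^ nest g"
proof (induction g)
  case (Then g h)
  have "(n + 1) ^ nest g \<le> (n + 1) ^ max (nest g) (nest h)" "(n + 1) ^ nest h \<le> (n + 1) ^ max (nest g) (nest h)"
    by (auto intro!: power_increasing simp del: Suc_eq_plus1)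
  then have "gsize g * (n + 1) ^ nest g + gsize h * (n + 1) ^ nest h
     \<le> gsize g * (n + 1) ^ max (nest g) (nest h) + gsize h * (n + 1) ^ max (nest g) (nest h)"
    by (intro add_mono mult_left_mono) auto
  with Then show ?case by (simp add: add_mult_distrib)
next
  case (For g)
  have "n * (gcost n g + 3) + 3 \<le> (n + 1) * (gcost n g + 4)" by (simp add: algebra_simps)
  also have "\<dots> \<le> (n + 1) * (gsize g * (n + 1) ^ nest g + 4 * (n + 1) ^ nest g)"
    by (intro mult_left_mono add_mono For) auto
  also have "\<dots> = gsize (For g) * (n + 1) ^ nest (For g)" by (simp add: algebra_simps)
  finally show ?case by simp
qed auto

text \<open>Every word written costs at least one step, so the time bound also bounds the length of
  the output.\<close>

lemma length_out: "length (out n k \<rho> g) \<le> gcost n g"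
proof (induction g arbitrary: k \<rho>)
  case (For g)
  have "length (out n k \<rho> (For g)) = (\<Sum>v\<leftarrow>[0..<n]. length (out n (Suc k) (\<rho>(k := v)) g))"
    by (simp add: length_concat o_def)
  also have "\<dots> \<le> (\<Sum>v\<leftarrow>[0..<n]. gcost n g)" by (intro sum_list_mono For)
  also have "\<dots> = n * gcost n g" by (simp add: sum_list_triv)
  also have "\<dots> \<le> gcost n (For g)" by (simp add: algebra_simps)
  finally show ?case .
next
  case (Then g h)
  then show ?case by (simp add: add_mono)
qed auto

text \<open>In a loop, register 10 holds the number of remaining rounds as the loop condition. The
  body uses it as scratch, hence it is recomputed from the index after each round.\<close>

fun cgen :: "nat \<Rightarrow> gen \<Rightarrow> program" where
  "cgen k Skip = Const 10 0"
| "cgen k (Emit e) = Seq (cexpr e 10) (Seq (Store 2 10) (Op Add 2 2 4))"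
| "cgen k (Emit_neg e) = Seq (cexpr e 10) (Seq (Op Add 10 10 3) (Seq (Load 10 10)
     (Seq (Op Sub 10 4 10) (Seq (Store 2 10) (Op Add 2 2 4)))))"
| "cgen k (Then g h) = Seq (cgen k g) (cgen k h)"
| "cgen k (For g) = Seq (Const (5 + k) 0) (Seq (Op Sub 10 1 (5 + k))
     (While 10 (Seq (cgen (Suc k) g) (Seq (Op Add (5 + k) (5 + k) 4) (Op Sub 10 1 (5 + k))))))"

text \<open>From this register on nothing is touched; the final cleanup relies on it.\<close>

fun gtop :: "gen \<Rightarrow> nat" where
  "gtop (Emit e) = 10 + ecost e"
| "gtop (Emit_neg e) = 10 + ecost e"
| "gtop (Then g h) = max (gtop g) (gtop h)"
| "gtop (For g) = gtop g"
| "gtop Skip = 11"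

lemma gtop_gt: "10 < gtop g"
  using ecost_pos by (induction g) auto

definition put :: "(nat \<Rightarrow> nat) \<Rightarrow> nat \<Rightarrow> nat list \<Rightarrow> nat \<Rightarrow> nat" where
  "put m p xs = (\<lambda>i. if p \<le> i \<and> i < p + length xs then xs ! (i - p) else m i)"

lemma put_Nil [simp]: "put m p [] = m"
  by (auto simp: put_def)

lemma put_single [simp]: "put m p [x] = m(p := x)"
  by (auto simp: put_def fun_eq_iff)

lemma put_append: "put (put m p xs) (p + length xs) ys = put m p (xs @ ys)"
  by (auto simp: put_def fun_eq_iff nth_append)

definition regs_ok :: "nat \<Rightarrow> nat \<Rightarrow> nat \<Rightarrow> (nat \<Rightarrow> nat) \<Rightarrow> (nat \<Rightarrow> nat) \<Rightarrow> bool" where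
  "regs_ok n B k \<rho> r \<longleftrightarrow> r 0 = 0 \<and> r 1 = n \<and> r 3 = B \<and> r 4 = 1 \<and> (\<forall>i<k. r (5 + i) = \<rho> i \<and> \<rho> i \<le> n)"

lemma exec_emit:
  assumes "r 10 = x" "r 2 = p" "r 4 = 1" "Suc p < W"
  shows "exec W (Seq (Store 2 10) (Op Add 2 2 4)) (r, m) 2 (r(2 := Suc p), m(p := x))"
proof -
  have "exec W (Op Add 2 2 4) (r, m(p := x)) 1 (r(2 := Suc p), m(p := x))"
    by (rule exec_OpI) (use assms in auto)
  with exec_Seq[OF exec_Store[of W 2 10 r m]] show ?thesis using assms by (fastforce simp: numeral_2_eq_2)
qed

text \<open>The output grows upwards from \<open>p\<close>, and the copy of the input starts at
  \<open>B\<close>. The condition that the output ends below \<open>B\<close> keeps the two apart,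
  so \<open>Emit_neg\<close> finds the original input in every round. Apart from the output
  position, the registers below \<open>5 + k\<close>, which are the constants and the enclosing loop
  indices, are preserved.\<close>

lemma exec_cgen:
  assumes "regs_ok n B k \<rho> r" "r 2 = p" "gen_ok k g" "k + nest g \<le> 5"
    "p + length (out n k \<rho> g) < B" "B + (n + 2) ^ gdeg g \<le> W" "n < B" "\<And>i. m (B + i) = xs i" 
  shows "\<exists>r' t. exec W (cgen k g) (r, m) t (r', put m p (map (cell_val xs) (out n k \<rho> g))) \<and>
     t \<le> gcost n g \<and> r' 2 = p + length (out n k \<rho> g) \<and>
     (\<forall>j. j \<noteq> 2 \<and> (j < 5 + k \<or> j \<ge> gtop g) \<longrightarrow> r' j = r j)"
  using assms
proof (induction g arbitrary: k \<rho> r p m)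
  case Skip
  define r' where "r' = r(10 := 0)"
  have "exec W (cgen k Skip) (r, m) 1 (r', m)" using Skip exec_Const[of 0 W 10 r m] by (simp add: r'_def)
  moreover have "r' 2 = p" "\<forall>j. j \<noteq> 2 \<and> (j < 5 + k \<or> j \<ge> gtop Skip) \<longrightarrow> r' j = r j"
    using Skip by (auto simp: r'_def)
  ultimately show ?case by (intro exI[of _ r'] exI[of _ 1]) auto
next
  case (Emit e)
  have "\<exists>r'. exec W (cexpr e 10) (r, m) (ecost e) (r', m) \<and> r' 10 = val n \<rho> e \<and>
    (\<forall>j. j < 10 \<or> j \<ge> 10 + ecost e \<longrightarrow> r' j = r j)"
    by (rule exec_cexpr) (use Emit.prems in \<open>auto simp: regs_ok_def\<close>)
  then obtain r1 where r1: "exec W (cexpr e 10) (r, m) (ecost e) (r1, m)" "r1 10 = val n \<rho> e"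
    "\<forall>j. j < 10 \<or> j \<ge> 10 + ecost e \<longrightarrow> r1 j = r j" by auto
  have "exec W (Seq (Store 2 10) (Op Add 2 2 4)) (r1, m) 2 (r1(2 := Suc p), m(p := val n \<rho> e))"
    by (rule exec_emit) (use Emit.prems r1 in \<open>auto simp: regs_ok_def\<close>)
  from exec_Seq[OF r1(1) this]
  have e: "exec W (cgen k (Emit e)) (r, m) (ecost e + 2)
      (r1(2 := Suc p), put m p (map (cell_val xs) (out n k \<rho> (Emit e))))" by simp
  show ?case
    by (intro exI conjI, rule e) (use r1(3) Emit.prems in auto)
next
  case (Emit_neg e)
  let ?i = "val n \<rho> e"
  have i: "?i < (n + 2) ^ edeg e"
    by (rule val_less) (use Emit_neg.prems in \<open>auto simp: regs_ok_def\<close>)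
  have "\<exists>r'. exec W (cexpr e 10) (r, m) (ecost e) (r', m) \<and> r' 10 = val n \<rho> e \<and>
    (\<forall>j. j < 10 \<or> j \<ge> 10 + ecost e \<longrightarrow> r' j = r j)"
    by (rule exec_cexpr) (use Emit_neg.prems in \<open>auto simp: regs_ok_def\<close>)
  then obtain r1 where r1: "exec W (cexpr e 10) (r, m) (ecost e) (r1, m)" "r1 10 = val n \<rho> e"
    "\<forall>j. j < 10 \<or> j \<ge> 10 + ecost e \<longrightarrow> r1 j = r j" by auto
  have r1': "r1 3 = B" "r1 4 = 1" "r1 2 = p" using r1(3) Emit_neg.prems by (auto simp: regs_ok_def)
  define r2 where "r2 = r1(10 := ?i + B)"
  have e2: "exec W (Op Add 10 10 3) (r1, m) 1 (r2, m)"
    unfolding r2_def by (rule exec_OpI) (use r1 r1' i Emit_neg.prems in auto)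
  define r3 where "r3 = r2(10 := xs ?i)"
  have e3: "exec W (Load 10 10) (r2, m) 1 (r3, m)"
    using exec_Load[of W 10 10 r2 m] Emit_neg.prems(8)[of ?i] by (simp add: r3_def r2_def add.commute)
  define r4 where "r4 = r3(10 := 1 - xs ?i)"
  have e4: "exec W (Op Sub 10 4 10) (r3, m) 1 (r4, m)"
    unfolding r4_def by (rule exec_OpI) (use r1' Emit_neg.prems in \<open>auto simp: r3_def r2_def\<close>)
  have e5: "exec W (Seq (Store 2 10) (Op Add 2 2 4)) (r4, m) 2 (r4(2 := Suc p), m(p := 1 - xs ?i))"
    by (rule exec_emit) (use Emit_neg.prems r1' in \<open>auto simp: r4_def r3_def r2_def\<close>)
  have e: "exec W (cgen k (Emit_neg e)) (r, m) (ecost e + (1 + (1 + (1 + 2))))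
      (r4(2 := Suc p), put m p (map (cell_val xs) (out n k \<rho> (Emit_neg e))))"
    unfolding cgen.simps out.simps list.map cell_val.simps put_single
    by (intro exec_Seq[OF r1(1)] exec_Seq[OF e2] exec_Seq[OF e3] exec_Seq[OF e4] e5)
  show ?case
    by (intro exI conjI, rule e)
      (use r1(3) Emit_neg.prems ecost_pos[of e] in \<open>auto simp: r4_def r3_def r2_def\<close>)
next
  case (Then g h)
  have pw: "(n + 2) ^ gdeg g \<le> (n + 2) ^ (gdeg g + gdeg h)" "(n + 2) ^ gdeg h \<le> (n + 2) ^ (gdeg g + gdeg h)"
    by (auto intro!: power_increasing simp del: add_2_eq_Suc')
  then have pw': "B + (n + 2) ^ gdeg g \<le> W" "B + (n + 2) ^ gdeg h \<le> W"
    using Then.prems(6) unfolding gdeg.simps by linarith+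
  have "\<exists>r' t. exec W (cgen k g) (r, m) t (r', put m p (map (cell_val xs) (out n k \<rho> g))) \<and>
     t \<le> gcost n g \<and> r' 2 = p + length (out n k \<rho> g) \<and>
     (\<forall>j. j \<noteq> 2 \<and> (j < 5 + k \<or> j \<ge> gtop g) \<longrightarrow> r' j = r j)"
    by (rule Then.IH(1)) (use Then.prems pw' in \<open>auto simp del: add_2_eq_Suc'\<close>)
  then obtain r1 t1 where 1: "exec W (cgen k g) (r, m) t1 (r1, put m p (map (cell_val xs) (out n k \<rho> g)))"
     "t1 \<le> gcost n g" "r1 2 = p + length (out n k \<rho> g)"
     "\<forall>j. j \<noteq> 2 \<and> (j < 5 + k \<or> j \<ge> gtop g) \<longrightarrow> r1 j = r j" by blast
  let ?m = "put m p (map (cell_val xs) (out n k \<rho> g))"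
  have "\<exists>r' t. exec W (cgen k h) (r1, ?m) t (r', put ?m (r1 2) (map (cell_val xs) (out n k \<rho> h))) \<and>
     t \<le> gcost n h \<and> r' 2 = r1 2 + length (out n k \<rho> h) \<and>
     (\<forall>j. j \<noteq> 2 \<and> (j < 5 + k \<or> j \<ge> gtop h) \<longrightarrow> r' j = r1 j)"
    by (rule Then.IH(2))
      (use Then.prems pw' 1(3,4) in \<open>auto simp: regs_ok_def put_def simp del: add_2_eq_Suc'\<close>)
  then obtain r2 t2 where 2: "exec W (cgen k h) (r1, ?m) t2 (r2, put ?m (r1 2) (map (cell_val xs) (out n k \<rho> h)))"
     "t2 \<le> gcost n h" "r2 2 = r1 2 + length (out n k \<rho> h)"
     "\<forall>j. j \<noteq> 2 \<and> (j < 5 + k \<or> j \<ge> gtop h) \<longrightarrow> r2 j = r1 j" by blast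
  have "put ?m (r1 2) (map (cell_val xs) (out n k \<rho> h)) = put m p (map (cell_val xs) (out n k \<rho> (Then g h)))"
    using put_append[of m p "map (cell_val xs) (out n k \<rho> g)" "map (cell_val xs) (out n k \<rho> h)"] by (simp add: 1(3))
  with exec_Seq[OF 1(1) 2(1)] show ?case
    by (intro exI[of _ r2] exI[of _ "t1 + t2"]) (use 1(2-4) 2(2-4) in auto)
next
  case (For g)
  define C where "C = Seq (cgen (Suc k) g) (Seq (Op Add (5 + k) (5 + k) 4) (Op Sub 10 1 (5 + k)))"
  have B: "n < W" using For.prems by simp
  \<comment> \<open>The statement for the remaining rounds, with the start index \<open>v\<close>
    free so that the induction on \<open>n - v\<close> can peel off one round.\<close>
  have loop: "\<exists>r' t. exec W (While 10 C) (r, m) t (r', put m p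
        (map (cell_val xs) (concat (map (\<lambda>v. out n (Suc k) (\<rho>(k := v)) g) [v..<n])))) \<and>
     t \<le> (n - v) * (gcost n g + 3) + 1 \<and>
     r' 2 = p + length (concat (map (\<lambda>v. out n (Suc k) (\<rho>(k := v)) g) [v..<n])) \<and>
     (\<forall>j. j \<noteq> 2 \<and> (j < 5 + k \<or> j \<ge> gtop g) \<longrightarrow> r' j = r j)"
    if "regs_ok n B k \<rho> r" "r 2 = p" "r (5 + k) = v" "r 10 = n - v" "v \<le> n" "\<And>i. m (B + i) = xs i"
      "p + length (concat (map (\<lambda>v. out n (Suc k) (\<rho>(k := v)) g) [v..<n])) < B" for v r m p
    using that
  proof (induction "n - v" arbitrary: v r m p)
    case 0
    then have "exec W (While 10 C) (r, m) 1 (r, m)" using exec_WhileFalse[of r 10 W C m] by simp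
    with 0 show ?case by (intro exI[of _ r] exI[of _ 1]) auto
  next
    case (Suc d)
    then have v: "v < n" by simp
    let ?o = "out n (Suc k) (\<rho>(k := v)) g"
    let ?rest = "concat (map (\<lambda>v. out n (Suc k) (\<rho>(k := v)) g) [Suc v..<n])"
    have os: "concat (map (\<lambda>v. out n (Suc k) (\<rho>(k := v)) g) [v..<n]) = ?o @ ?rest"
      using v by (simp add: upt_conv_Cons)
    have lp: "p + length ?o < B" using Suc.prems(7) unfolding os by simp
    have ok: "regs_ok n B (Suc k) (\<rho>(k := v)) r"
      using Suc.prems(1,3) v by (auto simp: regs_ok_def less_Suc_eq)
    have "\<exists>r' t. exec W (cgen (Suc k) g) (r, m) t (r', put m p (map (cell_val xs) ?o)) \<and>
       t \<le> gcost n g \<and> r' 2 = p + length ?o \<and>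
       (\<forall>j. j \<noteq> 2 \<and> (j < 5 + Suc k \<or> j \<ge> gtop g) \<longrightarrow> r' j = r j)"
      by (rule For.IH[OF ok Suc.prems(2) _ _ lp _ For.prems(7) Suc.prems(6)]) (use For.prems(3,4,6) in auto)
    then obtain r1 t1 where 1: "exec W (cgen (Suc k) g) (r, m) t1 (r1, put m p (map (cell_val xs) ?o))"
       "t1 \<le> gcost n g" "r1 2 = p + length ?o"
       "\<forall>j. j \<noteq> 2 \<and> (j < 5 + Suc k \<or> j \<ge> gtop g) \<longrightarrow> r1 j = r j" by blast
    let ?m = "put m p (map (cell_val xs) ?o)"
    have r1: "r1 1 = n" "r1 4 = 1" "r1 (5 + k) = v" using 1(4) Suc.prems by (auto simp: regs_ok_def)
    define r2 where "r2 = r1(5 + k := Suc v)"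
    have e2: "exec W (Op Add (5 + k) (5 + k) 4) (r1, ?m) 1 (r2, ?m)"
      unfolding r2_def by (rule exec_OpI) (use r1 v B in auto)
    define r3 where "r3 = r2(10 := n - Suc v)"
    have e3: "exec W (Op Sub 10 1 (5 + k)) (r2, ?m) 1 (r3, ?m)"
      unfolding r3_def by (rule exec_OpI) (use r1 B in \<open>auto simp: r2_def\<close>)
    have e: "exec W C (r, m) (t1 + (1 + 1)) (r3, ?m)"
      unfolding C_def by (intro exec_Seq[OF 1(1)] exec_Seq[OF e2] e3)
    have k: "k < 5" using For.prems by simp
    have r3: "regs_ok n B k \<rho> r3" "r3 2 = p + length ?o" "r3 (5 + k) = Suc v" "r3 10 = n - Suc v"
      using Suc.prems(1) 1(3,4) r1 k by (auto simp: r3_def r2_def regs_ok_def)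
    have "\<exists>r' t. exec W (While 10 C) (r3, ?m) t (r', put ?m (p + length ?o) (map (cell_val xs) ?rest)) \<and>
       t \<le> (n - Suc v) * (gcost n g + 3) + 1 \<and> r' 2 = p + length ?o + length ?rest \<and>
       (\<forall>j. j \<noteq> 2 \<and> (j < 5 + k \<or> j \<ge> gtop g) \<longrightarrow> r' j = r3 j)"
      by (rule Suc.hyps(1)) (use Suc.hyps(2) Suc.prems r3 os in \<open>auto simp: put_def\<close>)
    then obtain r4 t4 where 4: "exec W (While 10 C) (r3, ?m) t4 (r4, put ?m (p + length ?o) (map (cell_val xs) ?rest))"
       "t4 \<le> (n - Suc v) * (gcost n g + 3) + 1" "r4 2 = p + length ?o + length ?rest"
       "\<forall>j. j \<noteq> 2 \<and> (j < 5 + k \<or> j \<ge> gtop g) \<longrightarrow> r4 j = r3 j" by blast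
    have m: "put ?m (p + length ?o) (map (cell_val xs) ?rest) = put m p (map (cell_val xs) (?o @ ?rest))"
      using put_append[of m p "map (cell_val xs) ?o"] by simp
    have "r 10 \<noteq> 0" using Suc v by simp
    from exec_WhileTrue[of r, OF this e 4(1)] 
    have ex: "exec W (While 10 C) (r, m) (1 + (t1 + (1 + 1)) + t4) (r4, put m p (map (cell_val xs) (?o @ ?rest)))"
      unfolding m .
    have "n - v = Suc (n - Suc v)" using v by simp
    then have t: "1 + (t1 + (1 + 1)) + t4 \<le> (n - v) * (gcost n g + 3) + 1"
      using 1(2) 4(2) by simp
    have r4: "\<forall>j. j \<noteq> 2 \<and> (j < 5 + k \<or> j \<ge> gtop g) \<longrightarrow> r4 j = r j"
      using 4(4) 1(4) k gtop_gt[of g] by (auto simp: r3_def r2_def)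
    show ?case unfolding os using ex t 4(3) r4 by fastforce
  qed
  define r1 where "r1 = r(5 + k := 0)"
  have e1: "exec W (Const (5 + k) 0) (r, m) 1 (r1, m)"
    unfolding r1_def by (rule exec_Const) (use B in simp)
  define r2 where "r2 = r1(10 := n)"
  have k: "k < 5" using For.prems by simp
  have "r1 1 = n" "r1 (5 + k) = 0" using For.prems by (auto simp: r1_def regs_ok_def)
  then have e2: "exec W (Op Sub 10 1 (5 + k)) (r1, m) 1 (r2, m)"
    unfolding r2_def using B by (intro exec_OpI) auto
  have "\<exists>r' t. exec W (While 10 C) (r2, m) t (r', put m p
        (map (cell_val xs) (concat (map (\<lambda>v. out n (Suc k) (\<rho>(k := v)) g) [0..<n])))) \<and>
     t \<le> (n - 0) * (gcost n g + 3) + 1 \<and>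
     r' 2 = p + length (concat (map (\<lambda>v. out n (Suc k) (\<rho>(k := v)) g) [0..<n])) \<and>
     (\<forall>j. j \<noteq> 2 \<and> (j < 5 + k \<or> j \<ge> gtop g) \<longrightarrow> r' j = r2 j)"
    by (rule loop) (use For.prems k in \<open>auto simp: r2_def r1_def regs_ok_def\<close>)
  then obtain r3 t3 where 3: "exec W (While 10 C) (r2, m) t3 (r3, put m p
        (map (cell_val xs) (out n k \<rho> (For g))))"
     "t3 \<le> n * (gcost n g + 3) + 1" "r3 2 = p + length (out n k \<rho> (For g))"
     "\<forall>j. j \<noteq> 2 \<and> (j < 5 + k \<or> j \<ge> gtop g) \<longrightarrow> r3 j = r2 j" by auto
  have ex: "exec W (cgen k (For g)) (r, m) (1 + (1 + t3)) (r3, put m p (map (cell_val xs) (out n k \<rho> (For g))))"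
    using exec_Seq[OF e1 exec_Seq[OF e2 3(1)]] by (simp add: C_def)
  have "\<forall>j. j \<noteq> 2 \<and> (j < 5 + k \<or> j \<ge> gtop (For g)) \<longrightarrow> r3 j = r j"
    using 3(4) k gtop_gt[of g] by (auto simp: r2_def r1_def)
  with ex 3(2,3) show ?case
    by (intro exI[of _ r3] exI[of _ "1 + (1 + t3)"]) auto
qed


section \<open>Relocating the input and cleaning up\<close>

definition move_body :: program where
  "move_body = Seq (Op Add 6 3 5) (Seq (Load 7 5) (Seq (Store 6 7) (Seq (Store 5 0) (Op Sub 5 5 4))))"

definition wipe_body :: program where
  "wipe_body = Seq (Op Add 6 3 5) (Seq (Store 6 0) (Op Sub 5 5 4))"

text \<open>Each cell is cleared once it is copied, because the output may be shorter than the input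
  and has to be followed by zeros; \<open>c < B\<close> keeps source and target disjoint. Cell 0 is
  left to the caller, as the loop stops when its counter reaches 0.\<close>

lemma exec_move:
  assumes "r 0 = 0" "r 3 = B" "r 4 = 1" "r 5 = c" "c < B" "B + c < W"
  shows "\<exists>r' t. exec W (While 5 move_body) (r, m) t
      (r', \<lambda>i. if 1 \<le> i \<and> i \<le> c then 0 else if B + 1 \<le> i \<and> i \<le> B + c then m (i - B) else m i) \<and>
    t \<le> 6 * c + 1 \<and> (\<forall>j. j \<notin> {5, 6, 7} \<longrightarrow> r' j = r j)"
  using assms
proof (induction c arbitrary: r m)
  case 0
  then have "exec W (While 5 move_body) (r, m) 1 (r, m)" using exec_WhileFalse[of r 5 W move_body m] by simp
  moreover have "(\<lambda>i. if 1 \<le> i \<and> i \<le> 0 then 0 else if B + 1 \<le> i \<and> i \<le> B + 0 then m (i - B) else m i) = m"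
    by (auto simp: fun_eq_iff)
  ultimately show ?case by (intro exI[of _ r] exI[of _ 1]) auto
next
  case (Suc c)
  define r1 where "r1 = r(6 := B + Suc c)"
  define r2 where "r2 = r1(7 := m (Suc c))"
  define m1 where "m1 = m(B + Suc c := m (Suc c), Suc c := 0)"
  define r3 where "r3 = r2(5 := c)"
  have e1: "exec W (Op Add 6 3 5) (r, m) 1 (r1, m)"
    unfolding r1_def by (rule exec_OpI) (use Suc.prems in auto)
  have e2: "exec W (Load 7 5) (r1, m) 1 (r2, m)"
    using exec_Load[of W 7 5 r1 m] Suc.prems by (simp add: r2_def r1_def)
  have e3: "exec W (Store 6 7) (r2, m) 1 (r2, m(B + Suc c := m (Suc c)))"
    using exec_Store[of W 6 7 r2 m] Suc.prems by (simp add: r2_def r1_def)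
  have e4: "exec W (Store 5 0) (r2, m(B + Suc c := m (Suc c))) 1 (r2, m1)"
    using exec_Store[of W 5 0 r2 "m(B + Suc c := m (Suc c))"] Suc.prems by (simp add: r2_def r1_def m1_def)
  have e5: "exec W (Op Sub 5 5 4) (r2, m1) 1 (r3, m1)"
    unfolding r3_def by (rule exec_OpI) (use Suc.prems in \<open>auto simp: r2_def r1_def\<close>)
  have e: "exec W move_body (r, m) (1 + (1 + (1 + (1 + 1)))) (r3, m1)"
    unfolding move_body_def by (intro exec_Seq[OF e1] exec_Seq[OF e2] exec_Seq[OF e3] exec_Seq[OF e4] e5)
  let ?M = "\<lambda>c m i. if 1 \<le> i \<and> i \<le> c then 0 else if B + 1 \<le> i \<and> i \<le> B + c then m (i - B) else m i"
  have r3: "r3 0 = 0" "r3 3 = B" "r3 4 = 1" "r3 5 = c"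
    using Suc.prems by (auto simp: r3_def r2_def r1_def)
  obtain r4 t where 4: "exec W (While 5 move_body) (r3, m1) t (r4, ?M c m1)"
     "t \<le> 6 * c + 1" "\<forall>j. j \<notin> {5, 6, 7} \<longrightarrow> r4 j = r3 j"
    using Suc.IH[OF r3, of m1] Suc.prems(5,6) by auto
  have m: "?M c m1 = ?M (Suc c) m"
    using Suc.prems(5) by (auto simp: m1_def fun_eq_iff)
  have "r 5 \<noteq> 0" using Suc.prems by simp
  from exec_WhileTrue[of r, OF this e 4(1)]
  have ex: "exec W (While 5 move_body) (r, m) (1 + (1 + (1 + (1 + (1 + 1)))) + t) (r4, ?M (Suc c) m)"
    unfolding m .
  have r4: "\<forall>j. j \<notin> {5, 6, 7} \<longrightarrow> r4 j = r j" using 4(3) by (simp add: r3_def r2_def r1_def)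
  show ?case by (intro exI conjI, rule ex) (use 4(2) r4 in auto)
qed

lemma exec_wipe:
  assumes "r 0 = 0" "r 3 = B" "r 4 = 1" "r 5 = c" "B + c < W"
  shows "\<exists>r' t. exec W (While 5 wipe_body) (r, m) t
      (r', \<lambda>i. if B + 1 \<le> i \<and> i \<le> B + c then 0 else m i) \<and>
    t \<le> 4 * c + 1 \<and> (\<forall>j. j \<notin> {5, 6} \<longrightarrow> r' j = r j)"
  using assms
proof (induction c arbitrary: r m)
  case 0
  then have "exec W (While 5 wipe_body) (r, m) 1 (r, m)" using exec_WhileFalse[of r 5 W wipe_body m] by simp
  moreover have "(\<lambda>i. if B + 1 \<le> i \<and> i \<le> B + 0 then 0 else m i) = m"
    by (auto simp: fun_eq_iff)
  ultimately show ?case by (intro exI[of _ r] exI[of _ 1]) auto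
next
  case (Suc c)
  define r1 where "r1 = r(6 := B + Suc c)"
  define m1 where "m1 = m(B + Suc c := 0)"
  define r3 where "r3 = r1(5 := c)"
  have e1: "exec W (Op Add 6 3 5) (r, m) 1 (r1, m)"
    unfolding r1_def by (rule exec_OpI) (use Suc.prems in auto)
  have e3: "exec W (Store 6 0) (r1, m) 1 (r1, m1)"
    using exec_Store[of W 6 0 r1 m] Suc.prems by (simp add: r1_def m1_def)
  have e5: "exec W (Op Sub 5 5 4) (r1, m1) 1 (r3, m1)"
    unfolding r3_def by (rule exec_OpI) (use Suc.prems in \<open>auto simp: r1_def\<close>)
  have e: "exec W wipe_body (r, m) (1 + (1 + 1)) (r3, m1)"
    unfolding wipe_body_def by (intro exec_Seq[OF e1] exec_Seq[OF e3] e5)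
  let ?M = "\<lambda>c m i. if B + 1 \<le> i \<and> i \<le> B + c then 0 else m i"
  have r3: "r3 0 = 0" "r3 3 = B" "r3 4 = 1" "r3 5 = c"
    using Suc.prems by (auto simp: r3_def r1_def)
  obtain r4 t where 4: "exec W (While 5 wipe_body) (r3, m1) t (r4, ?M c m1)"
     "t \<le> 4 * c + 1" "\<forall>j. j \<notin> {5, 6} \<longrightarrow> r4 j = r3 j"
    using Suc.IH[OF r3, of m1] Suc.prems(5) by auto
  have m: "?M c m1 = ?M (Suc c) m"
    by (auto simp: m1_def fun_eq_iff)
  have "r 5 \<noteq> 0" using Suc.prems by simp
  from exec_WhileTrue[of r, OF this e 4(1)]
  have ex: "exec W (While 5 wipe_body) (r, m) (1 + (1 + (1 + 1)) + t) (r4, ?M (Suc c) m)"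
    unfolding m .
  have r4: "\<forall>j. j \<notin> {5, 6} \<longrightarrow> r4 j = r j" using 4(3) by (simp add: r3_def r1_def)
  show ?case by (intro exI conjI, rule ex) (use 4(2) r4 in auto)
qed

fun zero_regs :: "nat \<Rightarrow> program" where
  "zero_regs 0 = Const 0 0"
| "zero_regs (Suc j) = Seq (Const j 0) (zero_regs j)"

lemma exec_zero_regs:
  assumes "0 < K" "\<forall>j\<ge>K. r j = 0" "0 < W"
  shows "exec W (zero_regs K) (r, m) (K + 1) ((\<lambda>_. 0), m)"
  using assms
proof (induction K arbitrary: r)
  case (Suc K)
  show ?case
  proof (cases "K = 0")
    case True
    have "r(0 := 0) = (\<lambda>_. 0)" using Suc.prems(2) True by (auto simp: fun_eq_iff Suc_le_eq)
    moreover have "r(0 := 0, 0 := 0) = r(0 := 0)" by simp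
    ultimately show ?thesis
      using exec_Seq[OF exec_Const[of 0 W 0 r m] exec_Const[of 0 W 0 "r(0 := 0)" m]] Suc.prems True
      by (simp add: numeral_2_eq_2)
  next
    case False
    have "\<forall>j\<ge>K. (r(K := 0)) j = 0" using Suc.prems(2) by (simp add: Suc_le_eq)
    with exec_Seq[OF exec_Const[of 0 W K r m] Suc.IH[of "r(K := 0)"]] False Suc.prems
    show ?thesis by simp
  qed
qed simp

text \<open>The address \<open>B\<close> of the copy. For \<open>nest g \<le> 2\<close> it exceeds
  the output length, which is at most \<open>gsize g * (n + 1) ^ 2\<close>, and it exceeds
  \<open>n * n\<close>, so neither the output nor the original input reaches it.\<close>

definition base_expr :: "gen \<Rightarrow> expr" where
  "base_expr g = Prod (Lit (gsize g + 1)) (Prod (Sum Size (Lit 1)) (Sum Size (Lit 1)))"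

text \<open>The copy and all registers are erased at the end, since
  \<open>elementary_reduction\<close> demands an exact initial state, with zeros wherever the output
  does not reach.\<close>

definition reduction :: "gen \<Rightarrow> program" where
  "reduction g =
    Seq (Const 4 1) (Seq (Load 1 0) (Seq (cexpr (base_expr g) 10) (Seq (Op Add 3 10 0)
    (Seq (Op Mul 5 1 1) (Seq (While 5 move_body) (Seq (Store 3 1) (Seq (Store 0 0)
    (Seq (cgen 0 g)
    (Seq (Op Mul 5 1 1) (Seq (While 5 wipe_body) (Seq (Store 3 0)
    (zero_regs (gtop g + 10 + ecost (base_expr g))))))))))))))"

definition input_cell :: "nat list \<Rightarrow> nat \<Rightarrow> nat" where
  "input_cell xs i = (if i < length xs then xs ! i else 0)"

definition reduced :: "gen \<Rightarrow> nat list \<Rightarrow> nat list" where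
  "reduced g xs = map (cell_val (input_cell xs)) (out (hd xs) 0 (\<lambda>_. 0) g)"

lemma exec_reduction:
  assumes "length xs = n * n + 1" "hd xs = n" "gen_ok 0 g" "nest g \<le> 2"
    "(n + 2) ^ (edeg (base_expr g) + gdeg g + 3) \<le> W"
  shows "\<exists>t. exec W (reduction g) (initial_state xs) t (initial_state (reduced g xs)) \<and>
    t \<le> (2 * gsize g + gtop g + 2 * ecost (base_expr g) + 50) * (n + 1) ^ 2"
proof -
  define B where "B = (gsize g + 1) * (n + 1) ^ 2"
  define K where "K = gtop g + 10 + ecost (base_expr g)"
  have vB: "val n \<rho> (base_expr g) = B" for \<rho>
    by (simp add: base_expr_def B_def power2_eq_square)
  have eB: "eidx (base_expr g) = 0" by (simp add: base_expr_def)
  have B0: "B < (n + 2) ^ edeg (base_expr g)"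
    using val_less[of "base_expr g" "\<lambda>_. 0" n] by (simp add: vB eB del: add_2_eq_Suc')
  have pw: "(n + 2) ^ edeg (base_expr g) \<le> (n + 2) ^ (edeg (base_expr g) + gdeg g + 2)"
    "(n + 2) ^ (gdeg g + 2) \<le> (n + 2) ^ (edeg (base_expr g) + gdeg g + 2)"
    by (auto intro!: power_increasing simp del: add_2_eq_Suc')
  have "(n + 2) ^ edeg (base_expr g) + (n + 2) ^ (gdeg g + 2) \<le> 2 * (n + 2) ^ (edeg (base_expr g) + gdeg g + 2)"
    using add_mono[OF pw] by simp
  also have "\<dots> \<le> (n + 2) * (n + 2) ^ (edeg (base_expr g) + gdeg g + 2)" by (intro mult_right_mono) auto
  also have "\<dots> = (n + 2) ^ (edeg (base_expr g) + gdeg g + 3)" by (simp add: numeral_3_eq_3)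
  finally have W: "(n + 2) ^ edeg (base_expr g) + (n + 2) ^ (gdeg g + 2) \<le> W" using assms(5) by simp
  have "(n + 2) ^ gdeg g \<le> (n + 2) ^ (gdeg g + 2)" "(n + 2) ^ 2 \<le> (n + 2) ^ (gdeg g + 2)"
    by (auto intro!: power_increasing simp del: add_2_eq_Suc')
  then have W1: "B + (n + 2) ^ gdeg g \<le> W" and "B + (n + 2) ^ 2 \<le> W" using W B0 by linarith+
  moreover have "n * n < (n + 2) ^ 2" by (simp add: power2_eq_square)
  ultimately have W2: "B + n * n < W" by linarith
  have Bn: "n * n < B" "n < B"
    by (auto simp: B_def power2_eq_square)
  have W3: "1 < W" using W2 Bn(1) by linarith
  have xs0: "xs ! 0 = n" using assms(1,2) by (cases xs) auto
  define m0 where "m0 = (\<lambda>i. if i < length xs then xs ! i else 0)"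
  define r1 where "r1 = (\<lambda>_ :: nat. 0 :: nat)(4 := 1)"
  have e1: "exec W (Const 4 1) ((\<lambda>_. 0), m0) 1 (r1, m0)" unfolding r1_def by (rule exec_Const) (rule W3)
  define r2 where "r2 = r1(1 := n)"
  have e2: "exec W (Load 1 0) (r1, m0) 1 (r2, m0)"
    using exec_Load[of W 1 0 r1 m0] assms(1) by (simp add: r2_def r1_def m0_def xs0)
  have "\<exists>r'. exec W (cexpr (base_expr g) 10) (r2, m0) (ecost (base_expr g)) (r', m0) \<and>
    r' 10 = val n (\<lambda>_. 0) (base_expr g) \<and> (\<forall>j. j < 10 \<or> j \<ge> 10 + ecost (base_expr g) \<longrightarrow> r' j = r2 j)"
    by (rule exec_cexpr) (use eB W in \<open>auto simp: r2_def r1_def simp del: add_2_eq_Suc'\<close>)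
  then obtain r3 where e3: "exec W (cexpr (base_expr g) 10) (r2, m0) (ecost (base_expr g)) (r3, m0)"
    and r3: "r3 10 = B" "\<forall>j. j < 10 \<or> j \<ge> 10 + ecost (base_expr g) \<longrightarrow> r3 j = r2 j" by (auto simp: vB)
  define r4 where "r4 = r3(3 := B)"
  have e4: "exec W (Op Add 3 10 0) (r3, m0) 1 (r4, m0)"
    unfolding r4_def by (rule exec_OpI) (use r3 W2 in \<open>auto simp: r2_def r1_def\<close>)
  define r5 where "r5 = r4(5 := n * n)"
  have e5: "exec W (Op Mul 5 1 1) (r4, m0) 1 (r5, m0)"
    unfolding r5_def by (rule exec_OpI) (use r3 W2 in \<open>auto simp: r4_def r2_def r1_def\<close>)
  have r5: "r5 0 = 0" "r5 3 = B" "r5 4 = 1" "r5 5 = n * n" "r5 1 = n" "r5 2 = 0"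
    using r3 by (auto simp: r5_def r4_def r2_def r1_def)
  obtain r6 t6 where e6: "exec W (While 5 move_body) (r5, m0) t6
      (r6, \<lambda>i. if 1 \<le> i \<and> i \<le> n * n then 0 else if B + 1 \<le> i \<and> i \<le> B + n * n then m0 (i - B) else m0 i)"
    and t6: "t6 \<le> 6 * (n * n) + 1" and r6: "\<forall>j. j \<notin> {5, 6, 7} \<longrightarrow> r6 j = r5 j"
    using exec_move[OF r5(1-4) Bn(1) W2, of m0] by auto
  define m6 where "m6 = (\<lambda>i. if 1 \<le> i \<and> i \<le> n * n then 0 else if B + 1 \<le> i \<and> i \<le> B + n * n then m0 (i - B) else m0 i)"
  have e7: "exec W (Store 3 1) (r6, m6) 1 (r6, m6(B := n))"
    using exec_Store[of W 3 1 r6 m6] r6 r5 by simp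
  define m8 where "m8 = m6(B := n, 0 := 0)"
  have e8: "exec W (Store 0 0) (r6, m6(B := n)) 1 (r6, m8)"
    using exec_Store[of W 0 0 r6 "m6(B := n)"] r6 r5 by (simp add: m8_def)
  have m8: "m8 = (\<lambda>i. if B \<le> i then input_cell xs (i - B) else 0)"
    using assms(1) Bn by (auto simp: m8_def m6_def m0_def fun_eq_iff input_cell_def xs0)
  let ?out = "out n 0 (\<lambda>_. 0) g"
  have "(n + 1) ^ nest g \<le> (n + 1) ^ 2" by (rule power_increasing) (use assms in auto)
  then have "gsize g * (n + 1) ^ nest g \<le> gsize g * (n + 1) ^ 2" by (rule mult_left_mono) simp
  then have cost: "gcost n g \<le> gsize g * (n + 1) ^ 2" using gcost_le[of n g] by linarith
  have "length ?out \<le> gsize g * (n + 1) ^ 2" by (rule order_trans[OF length_out cost])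
  also have "\<dots> < B" unfolding B_def by (rule mult_strict_right_mono) auto
  finally have lo: "length ?out < B" .
  have "\<exists>r' t. exec W (cgen 0 g) (r6, m8) t (r', put m8 0 (map (cell_val (input_cell xs)) ?out)) \<and>
     t \<le> gcost n g \<and> r' 2 = 0 + length ?out \<and>
     (\<forall>j. j \<noteq> 2 \<and> (j < 5 + 0 \<or> j \<ge> gtop g) \<longrightarrow> r' j = r6 j)"
    by (rule exec_cgen[OF _ _ assms(3) _ _ W1 Bn(2)])
      (use r6 r5 assms(4) lo in \<open>auto simp: regs_ok_def m8\<close>)
  then obtain r9 t9 where e9: "exec W (cgen 0 g) (r6, m8) t9 (r9, put m8 0 (map (cell_val (input_cell xs)) ?out))"
    and t9: "t9 \<le> gcost n g" and r9: "\<forall>j. j \<noteq> 2 \<and> (j < 5 + 0 \<or> j \<ge> gtop g) \<longrightarrow> r9 j = r6 j" by blast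
  define m9 where "m9 = put m8 0 (map (cell_val (input_cell xs)) ?out)"
  define r10 where "r10 = r9(5 := n * n)"
  have e10: "exec W (Op Mul 5 1 1) (r9, m9) 1 (r10, m9)"
    unfolding r10_def by (rule exec_OpI) (use r9 r6 r5 W2 in auto)
  have r10: "r10 0 = 0" "r10 3 = B" "r10 4 = 1" "r10 5 = n * n"
    using r9 r6 r5 by (auto simp: r10_def)
  obtain r11 t11 where e11: "exec W (While 5 wipe_body) (r10, m9) t11
      (r11, \<lambda>i. if B + 1 \<le> i \<and> i \<le> B + n * n then 0 else m9 i)"
    and t11: "t11 \<le> 4 * (n * n) + 1" and r11: "\<forall>j. j \<notin> {5, 6} \<longrightarrow> r11 j = r10 j"
    using exec_wipe[OF r10 W2, of m9] by auto
  let ?m11 = "\<lambda>i. if B + 1 \<le> i \<and> i \<le> B + n * n then 0 else m9 i"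
  have e12: "exec W (Store 3 0) (r11, ?m11) 1 (r11, ?m11(B := 0))"
    using exec_Store[of W 3 0 r11 ?m11] r11 r10 by simp
  have r11z: "\<forall>j\<ge>K. r11 j = 0"
    using r11 r9 r6 r3(2) gtop_gt[of g] by (auto simp: K_def r10_def r5_def r4_def r2_def r1_def)
  have e13: "exec W (zero_regs K) (r11, ?m11(B := 0)) (K + 1) ((\<lambda>_. 0), ?m11(B := 0))"
    by (rule exec_zero_regs) (use r11z W3 in \<open>auto simp: K_def\<close>)
  \<comment> \<open>As \<open>m8\<close> vanishes below \<open>B\<close>, only the copy was nonzero
    behind the output, and it has just been wiped.\<close>
  have fin: "((\<lambda>_. 0), ?m11(B := 0)) = initial_state (reduced g xs)"
    using lo assms(1) unfolding initial_state_def reduced_def assms(2)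
    by (auto simp: fun_eq_iff m9_def put_def m8 input_cell_def)
  have ini: "initial_state xs = ((\<lambda>_. 0), m0)" by (simp add: initial_state_def m0_def)
  have ex: "exec W (reduction g) (initial_state xs)
      (1 + (1 + (ecost (base_expr g) + (1 + (1 + (t6 + (1 + (1 + (t9 + (1 + (t11 + (1 + (K + 1)))))))))))))
      (initial_state (reduced g xs))"
    unfolding reduction_def ini fin[symmetric] K_def[symmetric]
    by (intro exec_Seq[OF e1] exec_Seq[OF e2] exec_Seq[OF e3] exec_Seq[OF e4] exec_Seq[OF e5]
        exec_Seq[OF e6[folded m6_def]] exec_Seq[OF e7] exec_Seq[OF e8] exec_Seq[OF e9[folded m9_def]]
        exec_Seq[OF e10] exec_Seq[OF e11] exec_Seq[OF e12] e13)
  have "1 + (1 + (ecost (base_expr g) + (1 + (1 + (t6 + (1 + (1 + (t9 + (1 + (t11 + (1 + (K + 1))))))))))))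
      \<le> gsize g * (n + 1) ^ 2 + (gtop g + 2 * ecost (base_expr g) + 30) + 10 * (n * n)"
    using t6 t9 t11 cost by (simp add: K_def)
  also have "\<dots> \<le> gsize g * (n + 1) ^ 2 + (gtop g + 2 * ecost (base_expr g) + 30) * (n + 1) ^ 2 + 10 * (n + 1) ^ 2"
    by (intro add_mono) (auto simp: power2_eq_square)
  also have "\<dots> \<le> (2 * gsize g + gtop g + 2 * ecost (base_expr g) + 50) * (n + 1) ^ 2"
    unfolding add_mult_distrib[symmetric] by (intro mult_right_mono) auto
  finally show ?thesis using ex by blast
qed

section \<open>Reductions of graph codes: word bounds, locality and transfer of running
  times\<close>

lemma length_graph_code: "length (graph_code n E) = n * n + 1"
  by (simp add: graph_code_def matrix_entries_def)

lemma hd_graph_code: "hd (graph_code n E) = n"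
  by (simp add: graph_code_def)

lemma input_cell_graph_code:
  "u < n \<Longrightarrow> v < n \<Longrightarrow> input_cell (graph_code n E) (u * n + v + 1) = of_bool ((u, v) \<in> E)"
proof -
  assume uv: "u < n" "v < n"
  then have "u * n + v < Suc u * n" by simp
  also have "\<dots> \<le> n * n" using uv by (intro mult_right_mono) auto
  finally show ?thesis using uv
    by (simp add: input_cell_def graph_code_def matrix_entries_def)
qed

lemma word_bound_graph_code: "(n + 2) ^ c \<le> word_bound c (graph_code n E)"
proof -
  have "n \<le> n * n" by simp
  then have "n + 2 \<le> n * n + 1 + Max (insert 0 (set (graph_code n E))) + 2" by linarith
  then show ?thesis unfolding word_bound_def length_graph_code by (rule power_mono) simp
qed

lemma val_out_less:
  assumes "Val x \<in> set (out n k \<rho> g)" "gen_ok k g" "\<forall>i<k. \<rho> i \<le> n"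
  shows "x < (n + 2) ^ gdeg g"
  using assms
proof (induction g arbitrary: k \<rho>)
  case (Emit e)
  then show ?case using val_less[of e \<rho> n] by auto
next
  case (Then g h)
  have "(n + 2) ^ gdeg g \<le> (n + 2) ^ (gdeg g + gdeg h)" "(n + 2) ^ gdeg h \<le> (n + 2) ^ (gdeg g + gdeg h)"
    by (auto intro!: power_increasing simp del: add_2_eq_Suc')
  moreover have "x < (n + 2) ^ gdeg g \<or> x < (n + 2) ^ gdeg h"
    using Then by auto
  ultimately show ?case unfolding gdeg.simps by linarith
next
  case (For g)
  from For.prems(1) obtain v where v: "v < n" "Val x \<in> set (out n (Suc k) (\<rho>(k := v)) g)" by auto
  show ?case using For.IH[OF v(2)] For.prems v(1) by (auto simp: less_Suc_eq)
qed auto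

text \<open>The instance may be longer and contain larger numbers than the graph, but only
  polynomially. A larger exponent in the word bound of the graph code therefore provides words long
  enough to run the given algorithm on the instance.\<close>

lemma reduced_bound:
  assumes "gen_ok 0 g" "nest g \<le> 2"
  shows "\<exists>d. \<forall>n E. word_bound c (reduced g (graph_code n E)) \<le> (n + 2) ^ d"
proof -
  define a where "a = gsize g + 3"
  define b where "b = gdeg g"
  have "word_bound c (reduced g (graph_code n E)) \<le> (n + 2) ^ ((a + b + 2) * c)" for n E
  proof -
    let ?ys = "reduced g (graph_code n E)"
    have len: "length ?ys \<le> (n + 2) ^ a"
    proof -
      have "length ?ys \<le> gsize g * (n + 1) ^ nest g"
        using length_out[of n 0 "\<lambda>_. 0" g] gcost_le[of n g] by (simp add: reduced_def hd_graph_code)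
      also have "\<dots> \<le> (n + 2) ^ gsize g * (n + 2) ^ 3"
      proof (intro mult_mono)
        have "gsize g < 2 ^ gsize g" by (rule less_exp)
        also have "\<dots> \<le> (n + 2) ^ gsize g" by (rule power_mono) auto
        finally show "gsize g \<le> (n + 2) ^ gsize g" by simp
        have "(n + 1) ^ nest g \<le> (n + 2) ^ nest g" by (rule power_mono) auto
        also have "\<dots> \<le> (n + 2) ^ 3" by (rule power_increasing) (use assms in auto)
        finally show "(n + 1) ^ nest g \<le> (n + 2) ^ 3" .
      qed auto
      finally show ?thesis by (simp add: a_def power_add del: add_2_eq_Suc')
    qed
    have "x \<le> (n + 2) ^ b" if "x \<in> set ?ys" for x
    proof -
      from that obtain y where y: "y \<in> set (out n 0 (\<lambda>_. 0) g)" "x = cell_val (input_cell (graph_code n E)) y"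
        by (auto simp: reduced_def hd_graph_code)
      show ?thesis
      proof (cases y)
        case (Val v)
        then show ?thesis using val_out_less[of v n 0 "\<lambda>_. 0" g] y assms(1) by (simp add: b_def)
      next
        case (Neg i)
        then have "x \<le> 1" using y by simp
        also have "1 \<le> (n + 2) ^ b" by simp
        finally show ?thesis .
      qed
    qed
    then have "Max (insert 0 (set ?ys)) \<le> (n + 2) ^ b" by simp
    with len have "length ?ys + Max (insert 0 (set ?ys)) + 2 \<le> (n + 2) ^ a + (n + 2) ^ b + 2" by linarith
    also have "\<dots> \<le> (n + 2) ^ (a + b) + (n + 2) ^ (a + b) + 2 * (n + 2) ^ (a + b)"
      by (intro add_mono power_increasing) auto
    also have "\<dots> = 4 * (n + 2) ^ (a + b)" by simp
    also have "\<dots> \<le> (n + 2) ^ 2 * (n + 2) ^ (a + b)" by (intro mult_right_mono) (auto simp: power2_eq_square)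
    also have "\<dots> = (n + 2) ^ (a + b + 2)" by (simp add: power_add del: add_2_eq_Suc')
    finally show ?thesis unfolding word_bound_def power_mult by (rule power_mono) simp
  qed
  then show ?thesis by blast
qed

lemma exec_reduction_graph_code:
  assumes "gen_ok 0 g" "nest g \<le> 2"
  shows "\<exists>c K. \<forall>n E. \<exists>t. exec (word_bound c (graph_code n E)) (reduction g) (initial_state (graph_code n E)) t
      (initial_state (reduced g (graph_code n E))) \<and> t \<le> K * (n * n + 1)"
proof -
  define c where "c = edeg (base_expr g) + gdeg g + 3"
  define L where "L = 2 * gsize g + gtop g + 2 * ecost (base_expr g) + 50"
  have *: "\<exists>t. exec (word_bound c (graph_code n E)) (reduction g) (initial_state (graph_code n E)) t
      (initial_state (reduced g (graph_code n E))) \<and> t \<le> 4 * L * (n * n + 1)" for n E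
  proof -
    obtain t where t: "exec (word_bound c (graph_code n E)) (reduction g) (initial_state (graph_code n E)) t
      (initial_state (reduced g (graph_code n E)))" "t \<le> L * (n + 1) ^ 2"
      using exec_reduction[OF length_graph_code hd_graph_code assms word_bound_graph_code[of n _ E, folded c_def]]
      by (auto simp: c_def L_def)
    have "n \<le> n * n" by simp
    have "(n + 1) ^ 2 = n * n + 2 * n + 1" by (simp add: power2_eq_square)
    also have "\<dots> \<le> 4 * (n * n + 1)"
    proof -
      have "q + 2 * n + 1 \<le> 4 * (q + 1)" if "n \<le> q" for q :: nat using that by simp
      then show ?thesis using \<open>n \<le> n * n\<close> .
    qed
    finally have "(n + 1) ^ 2 \<le> 4 * (n * n + 1)" .
    then have "L * (n + 1) ^ 2 \<le> L * (4 * (n * n + 1))" by (rule mult_left_mono) simp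
    also have "\<dots> = 4 * L * (n * n + 1)" by (simp only: mult.assoc[symmetric] mult.commute[of L 4])
    finally have "t \<le> 4 * L * (n * n + 1)" by (rule order_trans[OF t(2)])
    with t(1) show ?thesis by (intro exI conjI)
  qed
  show ?thesis by (rule exI[of _ c], rule exI[of _ "4 * L"], rule allI, rule allI, rule *)
qed

text \<open>A \<open>Neg\<close> cell reads a single input position and a \<open>Val\<close> cell
  none, so \<open>q = 1\<close> works. The time is linear in the length of the graph code, so the
  logarithm gets exponent 0.\<close>

lemma elementary_reduction:
  assumes "gen_ok 0 g" "nest g \<le> 2"
  shows "elementary_reduction (reduction g)"
proof -
  obtain c K where cK: "\<exists>t. exec (word_bound c (graph_code n E)) (reduction g) (initial_state (graph_code n E)) t
      (initial_state (reduced g (graph_code n E))) \<and> t \<le> K * (n * n + 1)" for n E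
    using exec_reduction_graph_code[OF assms] by blast
  have 1: "\<exists>t. exec (word_bound c xs) (reduction g) (initial_state xs) t (initial_state (reduced g xs)) \<and>
      real t \<le> real K * real (length xs) * (1 + log 2 (real (length xs))) ^ 0" if xs: "xs \<in> graph_codes" for xs
  proof -
    from xs obtain n E where xs: "xs = graph_code n E" by (auto simp: graph_codes_def)
    obtain t where "exec (word_bound c xs) (reduction g) (initial_state xs) t (initial_state (reduced g xs))"
      "t \<le> K * length xs" using cK[of n E] by (auto simp: xs length_graph_code)
    moreover from this(2) have "real t \<le> real K * real (length xs)"
      by (metis of_nat_le_iff of_nat_mult)
    ultimately show ?thesis by auto
  qed
  \<comment> \<open>A \<open>Val\<close> cell depends on the size although \<open>J\<close> contains
    no position for it. This is harmless because the length \<open>n * n + 1\<close> already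
    determines \<open>n\<close>.\<close>
  have hd: "hd xs = hd ys" if "xs \<in> graph_codes" "ys \<in> graph_codes" "length xs = length ys" for xs ys
  proof -
    from that(1,2) obtain n E n' E' where xs: "xs = graph_code n E" and ys: "ys = graph_code n' E'"
      by (auto simp: graph_codes_def)
    have "n * n + 1 = n' * n' + 1" using that(3) unfolding xs ys length_graph_code .
    then have "n ^ 2 = n' ^ 2" unfolding power2_eq_square by (rule add_right_imp_eq)
    then have "n = n'" by (rule power2_eq_imp_eq) auto
    then show ?thesis by (simp add: xs ys hd_graph_code)
  qed
  have 3: "\<exists>J. finite J \<and> card J \<le> 1 \<and> (\<forall>xs\<in>graph_codes. \<forall>ys\<in>graph_codes.
      length xs = N \<and> length ys = N \<and> j < length (reduced g xs) \<and> (\<forall>i\<in>J. i < N \<longrightarrow> xs ! i = ys ! i)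
        \<longrightarrow> reduced g xs ! j = reduced g ys ! j)" for N j
  proof (cases "\<exists>zs\<in>graph_codes. length zs = N")
    case True
    then obtain zs where zs: "zs \<in> graph_codes" "length zs = N" by blast
    define os where "os = out (hd zs) 0 (\<lambda>_. 0) g"
    define J where "J = (case os ! j of Val _ \<Rightarrow> {} | Neg i \<Rightarrow> {i})"
    have "reduced g xs ! j = reduced g ys ! j"
      if "xs \<in> graph_codes" "ys \<in> graph_codes" "length xs = N" "length ys = N" "j < length (reduced g xs)"
        "\<forall>i\<in>J. i < N \<longrightarrow> xs ! i = ys ! i" for xs ys
    proof -
      have h: "hd xs = hd zs" "hd ys = hd zs"
        using hd[OF that(1) zs(1)] hd[OF that(2) zs(1)] that(3,4) zs(2) by simp_all
      have j: "j < length os" using that(5) h(1) by (simp add: reduced_def os_def)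
      have red: "reduced g ws ! j = cell_val (input_cell ws) (os ! j)" if "hd ws = hd zs" for ws
        using j by (simp add: reduced_def that os_def)
      show ?thesis
        using that(3,4,6) unfolding red[OF h(1)] red[OF h(2)] J_def
        by (cases "os ! j") (simp_all add: input_cell_def)
    qed
    then show ?thesis by (intro exI[of _ J]) (auto simp: J_def split: cell.splits)
  qed auto
  have 2: "length (reduced g xs) = length (reduced g ys)"
    if "xs \<in> graph_codes" "ys \<in> graph_codes" "length xs = length ys" for xs ys
    using hd[OF that] by (simp add: reduced_def)
  have A: "\<forall>xs\<in>graph_codes. \<exists>t.
      exec (word_bound c xs) (reduction g) (initial_state xs) t (initial_state (reduced g xs)) \<and>
      real t \<le> real K * real (length xs) * (1 + log 2 (real (length xs))) ^ 0"
    by (rule ballI, rule 1)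
  have B: "\<forall>xs\<in>graph_codes. \<forall>ys\<in>graph_codes.
      length xs = length ys \<longrightarrow> length (reduced g xs) = length (reduced g ys)"
    by (rule ballI, rule ballI, rule impI, rule 2)
  have D: "\<forall>N j. \<exists>J. finite J \<and> card J \<le> 1 \<and> (\<forall>xs\<in>graph_codes. \<forall>ys\<in>graph_codes.
      length xs = N \<and> length ys = N \<and> j < length (reduced g xs) \<and> (\<forall>i\<in>J. i < N \<longrightarrow> xs ! i = ys ! i)
        \<longrightarrow> reduced g xs ! j = reduced g ys ! j)"
    by (rule allI, rule allI, rule 3)
  show ?thesis unfolding elementary_reduction_def
    by (rule exI[of _ "reduced g"], rule exI[of _ c], rule exI[of _ 0], rule exI[of _ "real K"], rule exI[of _ 1],
        rule conjI, rule A, rule conjI, rule B, rule D)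
qed

text \<open>A graph of size \<open>n\<close> yields an instance of size \<open>a * n + b\<close>.
  For \<open>n \<ge> 1\<close> this is at most \<open>(a + b) * n\<close>, and a nonnegative
  exponent makes the power monotone.\<close>

lemma bigo_linear_substitution:
  assumes "T \<in> O(\<lambda>n. real n powr e)" "e \<ge> 0" "a \<ge> 1"
  shows "(\<lambda>n. T (a * n + b)) \<in> O(\<lambda>n :: nat. real n powr e)"
proof -
  from assms(1) obtain C where C: "C > 0" "eventually (\<lambda>n. norm (T n) \<le> C * norm (real n powr e)) at_top"
    by (auto elim!: landau_o.bigE)
  from C(2) obtain N where N: "\<And>n. n \<ge> N \<Longrightarrow> norm (T n) \<le> C * norm (real n powr e)"
    by (auto simp: eventually_at_top_linorder)
  show ?thesis
  proof (rule bigoI)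
    show "eventually (\<lambda>n. norm (T (a * n + b)) \<le> (C * real (a + b) powr e) * norm (real n powr e)) at_top"
      unfolding eventually_at_top_linorder
    proof (intro exI[of _ "max 1 N"] allI impI)
      fix n assume n: "n \<ge> max 1 N"
      have "n \<le> a * n" using assms(3) by simp
      then have N': "norm (T (a * n + b)) \<le> C * norm (real (a * n + b) powr e)" using n by (intro N) linarith
      have "real (a * n + b) powr e \<le> (real (a + b) * real n) powr e"
      proof (rule powr_mono2)
        have "b * 1 \<le> b * n" using n by (intro mult_left_mono) auto
        then have "a * n + b \<le> (a + b) * n" by (simp add: add_mult_distrib)
        then show "real (a * n + b) \<le> real (a + b) * real n" by (metis of_nat_le_iff of_nat_mult)
      qed (use assms in auto)
      then have "C * real (a * n + b) powr e \<le> C * (real (a + b) powr e * real n powr e)"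
        unfolding powr_mult by (rule mult_left_mono) (use C(1) in simp)
      moreover have "norm (real x powr e) = real x powr e" for x :: nat by simp
      ultimately show "norm (T (a * n + b)) \<le> (C * real (a + b) powr e) * norm (real n powr e)"
        using N' unfolding mult.assoc by (metis order_trans)
    qed
  qed
qed

text \<open>Writing the instance takes quadratic time, which \<open>e \<ge> 2\<close> absorbs. That
  the composed program stays in \<open>C\<close> is what \<open>combinatorial_class\<close>
  grants.\<close>

lemma clique_solvable_by_reduction:
  assumes C: "combinatorial_class C" and g: "gen_ok 0 g" "nest g \<le> 2" and a: "a \<ge> 1" and e: "e \<ge> 2"
    and X: "\<And>n E. simple_graph n E \<Longrightarrow> (reduced g (graph_code n E), a * n + b, has_clique r n E) \<in> X"
    and sol: "solvable_in_power C X e"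
  shows "solvable_in_power C (clique_problem r) e"
proof -
  from sol obtain A T where A: "A \<in> C" "T \<in> O(\<lambda>n. real n powr e)" "decides_in_time A X T"
    by (auto simp: solvable_in_power_def)
  from A(3) obtain cA where cA: "\<And>xs n ans. (xs, n, ans) \<in> X \<Longrightarrow> \<exists>t r m.
      exec (word_bound cA xs) A (initial_state xs) t (r, m) \<and> r 0 = of_bool ans \<and> real t \<le> T n"
    unfolding decides_in_time_def by blast
  obtain cR K where R: "\<exists>t. exec (word_bound cR (graph_code n E)) (reduction g) (initial_state (graph_code n E)) t
      (initial_state (reduced g (graph_code n E))) \<and> t \<le> K * (n * n + 1)" for n E
    using exec_reduction_graph_code[OF g] by blast
  obtain d where d: "word_bound cA (reduced g (graph_code n E)) \<le> (n + 2) ^ d" for n E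
    using reduced_bound[OF g] by blast
  define T' where "T' n = real K * (real n powr 2 + 1) + T (a * n + b)" for n
  have "(\<lambda>n. real K * (real n powr 2 + 1)) \<in> O(\<lambda>n :: nat. real n powr e)"
  proof (rule bigoI)
    show "eventually (\<lambda>n. norm (real K * (real n powr 2 + 1)) \<le> (2 * real K) * norm (real n powr e)) at_top"
      unfolding eventually_at_top_linorder
    proof (intro exI[of _ 1] allI impI)
      fix n :: nat assume n: "n \<ge> 1"
      have "real n powr 2 \<le> real n powr e" using n e by (intro powr_mono) auto
      moreover have "1 \<le> real n powr e" using n e by (intro ge_one_powr_ge_zero) auto
      ultimately have "real n powr 2 + 1 \<le> 2 * real n powr e" by linarith
      then have "real K * (real n powr 2 + 1) \<le> real K * (2 * real n powr e)" by (intro mult_left_mono) auto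
      then show "norm (real K * (real n powr 2 + 1)) \<le> (2 * real K) * norm (real n powr e)" by simp
    qed
  qed
  then have T': "T' \<in> O(\<lambda>n. real n powr e)"
    unfolding T'_def using e a by (intro sum_in_bigo bigo_linear_substitution A(2)) auto
  have "decides_in_time (Seq (reduction g) A) (clique_problem r) T'"
    unfolding decides_in_time_def
  \<comment> \<open>The exponent covers both phases: \<open>cR\<close> the reduction, and
    \<open>d\<close> the run of \<open>A\<close>, whose word bound on the instance is at most
    \<open>(n + 2) ^ d\<close>.\<close>
  proof (intro exI[of _ "cR + d"] ballI, clarify)
    fix xs n ans assume "(xs, n, ans) \<in> clique_problem r"
    then obtain E where E: "xs = graph_code n E" "ans = has_clique r n E" "simple_graph n E"
      by (auto simp: clique_problem_def)
    let ?W = "word_bound (cR + d) xs"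
    have pw: "word_bound c' xs \<le> ?W" if "c' \<le> cR + d" for c'
      unfolding word_bound_def by (rule power_increasing) (use that in auto)
    obtain t1 where t1: "exec (word_bound cR xs) (reduction g) (initial_state xs) t1 (initial_state (reduced g xs))"
      "t1 \<le> K * (n * n + 1)" using R[of n E] unfolding E by blast
    obtain t2 rg m where t2: "exec (word_bound cA (reduced g xs)) A (initial_state (reduced g xs)) t2 (rg, m)"
      "rg 0 = of_bool ans" "real t2 \<le> T (a * n + b)"
      using cA[OF X[OF E(3)]] unfolding E by blast
    have "word_bound cA (reduced g xs) \<le> (n + 2) ^ d" unfolding E by (rule d)
    also have "\<dots> \<le> word_bound d xs" unfolding E by (rule word_bound_graph_code)
    also have "\<dots> \<le> ?W" by (rule pw) simp
    finally have W: "word_bound cA (reduced g xs) \<le> ?W" .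
    have ex: "exec ?W (Seq (reduction g) A) (initial_state xs) (t1 + t2) (rg, m)"
      by (rule exec_Seq[OF exec_mono[OF t1(1) pw] exec_mono[OF t2(1) W]]) simp
    have "real t1 \<le> real (K * (n * n + 1))" using t1(2) by (rule of_nat_mono)
    also have "\<dots> = real K * (real n powr 2 + 1)" by (simp add: power2_eq_square algebra_simps)
    finally have "real (t1 + t2) \<le> T' n"
      using t2(3) unfolding T'_def by simp
    with ex show "\<exists>t r m. exec ?W (Seq (reduction g) A) (initial_state xs) t (r, m) \<and> r 0 = of_bool ans \<and> real t \<le> T' n"
      using t2(2) by blast
  qed
  moreover have "Seq (reduction g) A \<in> C"
    using C A(1) elementary_reduction[OF g] by (auto simp: combinatorial_class_def)
  ultimately show ?thesis using T' unfolding solvable_in_power_def by blast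
qed


section \<open>The pushdown automaton and the finite automata\<close>

text \<open>
  A run is divided into blocks \<open>a\<^sup>c t\<close>, one for each entry of a list of actions that all
  machines share; only the numbers \<open>c\<close> are free. The state of the pushdown automaton is a counter,
  which a block increases by \<open>c\<close> (\<open>Acc\<close>; \<open>Mark\<close> in addition pushes the separator 2), empties onto
  the stack in unary (\<open>Dump\<close>), or leaves alone while popping a separator and \<open>c\<close> ones (\<open>Pull\<close>).
  An error replaces the top of the stack by the symbol 3, which is never removed.
\<close>

datatype action = Acc | Mark | Dump | Pull

fun step_letter :: "action \<Rightarrow> nat" where
  "step_letter Acc = 0" | "step_letter Mark = 0" | "step_letter Dump = 1" | "step_letter Pull = 2"

fun end_letter :: "action \<Rightarrow> nat" where
  "end_letter Acc = 3" | "end_letter Mark = 4" | "end_letter Dump = 5" | "end_letter Pull = 6"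

lemma letters_distinct: "step_letter a \<noteq> end_letter b"
  by (cases a; cases b) auto

definition block :: "action \<Rightarrow> nat \<Rightarrow> nat list" where
  "block a c = replicate c (step_letter a) @ [end_letter a]"

text \<open>Failures are moves and not missing transitions, since a DPDA state that reads letters
  needs a transition for every letter and top symbol. Even the end-of-stack symbol may be
  overwritten by 3, as the pushed word then lacks it. For \<open>a = 1\<close> the failure pushes
  \<open>[3, 3]\<close>, so that the length of the pushed word, and with it the shape of the code,
  does not depend on the state \<open>p\<close>.\<close>

definition delta :: "nat \<Rightarrow> nat \<Rightarrow> nat \<Rightarrow> nat \<Rightarrow> nat \<times> nat list" where
  "delta n p a \<alpha> =
     (if a = 0 then (if p < n then (p + 1, [\<alpha>]) else (p, [3]))
      else if a = 1 then (p - 1, if p > 0 then [\<alpha>, 1] else [3, 3])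
      else if a = 2 then (p, if \<alpha> = 1 then [] else [3])
      else if a = 3 then (p, [\<alpha>])
      else if a = 4 then (p, [\<alpha>, 2])
      else if a = 5 then (p, if p > 0 then [3] else [\<alpha>])
      else (p, if \<alpha> = 2 then [] else [3]))"

definition state_transitions :: "nat \<Rightarrow> nat \<Rightarrow> (nat, nat, nat) transition list" where
  "state_transitions n p = concat (map (\<lambda>a. map (\<lambda>\<alpha>. (p, Some a, \<alpha>, delta n p a \<alpha>)) [0..<4]) [0..<7])"

text \<open>State \<open>n\<close> is listed apart because the loops of the generator end at
  \<open>n - 1\<close>.\<close>

definition counter_transitions :: "nat \<Rightarrow> (nat, nat, nat) transition list" where
  "counter_transitions n = concat (map (state_transitions n) [0..<n]) @ state_transitions n n"

definition counter_pda :: "nat \<Rightarrow> machine" where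
  "counter_pda n = \<lparr>states = {..<n + 1}, alphabet = {..<7}, stack_alphabet = {..<4}, bottom = 0,
     transitions = set (counter_transitions n), initial = 0, final = {0}\<rparr>"

lemma counter_pda_simps [simp]:
  "states (counter_pda n) = {..<n + 1}" "alphabet (counter_pda n) = {..<7}"
  "stack_alphabet (counter_pda n) = {..<4}" "bottom (counter_pda n) = 0"
  "initial (counter_pda n) = 0" "final (counter_pda n) = {0}"
  by (simp_all add: counter_pda_def)

lemma counter_pda_transitions:
  "(p, x, \<alpha>, r) \<in> transitions (counter_pda n) \<longleftrightarrow>
     p \<le> n \<and> \<alpha> < 4 \<and> (\<exists>a<7. x = Some a \<and> r = delta n p a \<alpha>)"
proof -
  have *: "(p, x, \<alpha>, r) \<in> set (state_transitions n p') \<longleftrightarrow>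
      p = p' \<and> \<alpha> < 4 \<and> (\<exists>a<7. x = Some a \<and> r = delta n p a \<alpha>)" for p'
    by (auto simp: state_transitions_def image_iff simp del: upt_rec_numeral)
  have "transitions (counter_pda n) = (\<Union>p'\<in>{..n}. set (state_transitions n p'))"
    by (auto simp: counter_pda_def counter_transitions_def le_less)
  then show ?thesis by (auto simp: *)
qed

lemma dpda_counter_pda: "dpda (counter_pda n)"
  unfolding dpda_def
proof (intro conjI)
  show "pda (counter_pda n)"
    unfolding pda_def counter_pda_simps
  proof (intro conjI)
    show "finite (transitions (counter_pda n))" by (simp add: counter_pda_def)
    have d: "fst (delta n p a \<alpha>) \<le> n" "snd (delta n p a \<alpha>) \<in> lists {..<4}" if "p \<le> n" "\<alpha> < 4" for p a \<alpha>
      using that by (auto simp: delta_def)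
    show "transitions (counter_pda n) \<subseteq> {..<n + 1} \<times> ({None} \<union> Some ` {..<7}) \<times> {..<4} \<times> {..<n + 1} \<times> lists {..<4}"
    proof
      fix t assume "t \<in> transitions (counter_pda n)"
      moreover obtain p x \<alpha> q \<beta> where t: "t = (p, x, \<alpha>, q, \<beta>)" by (cases t)
      ultimately obtain a where "p \<le> n" "\<alpha> < 4" "a < 7" "x = Some a" "delta n p a \<alpha> = (q, \<beta>)"
        by (auto simp: counter_pda_transitions)
      then show "t \<in> {..<n + 1} \<times> ({None} \<union> Some ` {..<7}) \<times> {..<4} \<times> {..<n + 1} \<times> lists {..<4}"
        using d[of p \<alpha> a] by (auto simp: t less_Suc_eq_le)
    qed
    show "\<forall>(p, a, \<alpha>, q, \<beta>)\<in>transitions (counter_pda n).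
       (0 \<in> set \<beta>) = (\<alpha> = 0 \<and> (\<exists>\<gamma>. \<beta> = 0 # \<gamma> \<and> 0 \<notin> set \<gamma>))"
      by (auto simp: counter_pda_transitions delta_def split: if_splits)
  qed auto
  show "\<forall>p a \<alpha> q \<beta> q' \<beta>'. (p, a, \<alpha>, q, \<beta>) \<in> transitions (counter_pda n) \<longrightarrow>
      (p, a, \<alpha>, q', \<beta>') \<in> transitions (counter_pda n) \<longrightarrow> q = q' \<and> \<beta> = \<beta>'"
    by (metis Pair_inject counter_pda_transitions option.inject)
  have "\<exists>q \<beta>. (p, Some a, \<alpha>, q, \<beta>) \<in> transitions (counter_pda n)" if "p \<le> n" "a < 7" "\<alpha> < 4" for p a \<alpha>
    using that by (auto simp: counter_pda_transitions) (metis surj_pair)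
  then show "let defined = \<lambda>p a \<alpha>. \<exists>q \<beta>. (p, a, \<alpha>, q, \<beta>) \<in> transitions (counter_pda n) in
      \<forall>p\<in>states (counter_pda n).
        (\<forall>a\<in>alphabet (counter_pda n). \<forall>\<alpha>\<in>stack_alphabet (counter_pda n). defined p (Some a) \<alpha>) \<and>
        (\<forall>\<alpha>\<in>stack_alphabet (counter_pda n). \<not> defined p None \<alpha>) \<or>
        (\<forall>\<alpha>\<in>stack_alphabet (counter_pda n). defined p None \<alpha>) \<and>
        (\<forall>a\<in>alphabet (counter_pda n). \<forall>\<alpha>\<in>stack_alphabet (counter_pda n). \<not> defined p (Some a) \<alpha>)"
    unfolding Let_def by (auto simp: counter_pda_transitions less_Suc_eq_le)
qed

lemma push_bounded_counter_pda: "b \<ge> 2 \<Longrightarrow> push_bounded b (counter_pda n)"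
proof -
  assume b: "b \<ge> 2"
  have "enat k \<le> b" if "k \<le> 2" for k
    using that b order_trans[of "enat k" 2 b] by (simp add: numeral_eq_enat)
  then show ?thesis
    by (auto simp: push_bounded_def counter_pda_transitions delta_def split: if_splits)
qed

section \<open>Accepting runs of the pushdown automaton\<close>

definition realtime :: "('q, 'a, 'g) automaton \<Rightarrow> bool" where
  "realtime M \<longleftrightarrow> (\<forall>(p, a, \<alpha>, q, \<beta>) \<in> transitions M. a \<noteq> None)"

lemma run_Nil_realtime: "realtime M \<Longrightarrow> run M c [] c' \<longleftrightarrow> c = c'"
  by (auto elim: run.cases intro: run_refl simp: realtime_def)

lemma run_Cons_realtime:
  assumes "realtime M"
  shows "run M (p, \<gamma>) (a # w) c \<longleftrightarrow>
    (\<exists>\<gamma>' \<alpha> q \<beta>. \<gamma> = \<gamma>' @ [\<alpha>] \<and> (p, Some a, \<alpha>, q, \<beta>) \<in> transitions M \<and> run M (q, \<gamma>' @ \<beta>) w c)"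
proof
  assume "run M (p, \<gamma>) (a # w) c"
  then show "\<exists>\<gamma>' \<alpha> q \<beta>. \<gamma> = \<gamma>' @ [\<alpha>] \<and> (p, Some a, \<alpha>, q, \<beta>) \<in> transitions M \<and> run M (q, \<gamma>' @ \<beta>) w c"
    using assms by (cases rule: run.cases) (auto simp: realtime_def)
qed (auto intro: run_letter)

lemma realtime_counter_pda: "realtime (counter_pda n)"
  by (auto simp: realtime_def counter_pda_transitions)

definition accepts_from :: "nat \<Rightarrow> nat \<Rightarrow> nat list \<Rightarrow> nat list \<Rightarrow> bool" where
  "accepts_from n y st w \<longleftrightarrow> run (counter_pda n) (y, st) w (0, [0])"

lemma lang_counter_pda: "w \<in> lang (counter_pda n) \<longleftrightarrow> accepts_from n 0 [0] w"
  by (simp add: lang_def accepts_from_def)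

lemma accepts_from_Nil: "accepts_from n y st [] \<longleftrightarrow> y = 0 \<and> st = [0]"
  by (simp add: accepts_from_def run_Nil_realtime realtime_counter_pda)

lemma accepts_from_Cons:
  "accepts_from n y st (a # w) \<longleftrightarrow> (\<exists>st' \<alpha>. st = st' @ [\<alpha>] \<and> y \<le> n \<and> a < 7 \<and> \<alpha> < 4 \<and>
     accepts_from n (fst (delta n y a \<alpha>)) (st' @ snd (delta n y a \<alpha>)) w)"
  unfolding accepts_from_def run_Cons_realtime[OF realtime_counter_pda]
  by (auto simp: counter_pda_transitions prod_eq_iff)

text \<open>The symbol 3 survives every letter, and an empty stack enables no transition, so neither
  leads to the stack \<open>[0]\<close>. Acceptance from a configuration thus implies the side
  conditions on it, which keeps the equivalences below short.\<close>

lemma accepts_from_inv: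
  "accepts_from n y st w \<Longrightarrow> y \<le> n \<and> st \<noteq> [] \<and> (\<forall>\<alpha>\<in>set st. \<alpha> < 3)"
proof (induction w arbitrary: y st)
  case Nil
  then show ?case by (auto simp: accepts_from_Nil)
next
  case (Cons a w)
  then obtain st' \<alpha> where *: "st = st' @ [\<alpha>]" "y \<le> n" "a < 7" "\<alpha> < 4"
     "accepts_from n (fst (delta n y a \<alpha>)) (st' @ snd (delta n y a \<alpha>)) w"
    by (auto simp: accepts_from_Cons)
  with Cons.IH[OF *(5)] have "\<forall>\<beta>\<in>set st' \<union> set (snd (delta n y a \<alpha>)). \<beta> < 3" by auto
  moreover have "3 \<in> set (snd (delta n y a 3))" by (auto simp: delta_def)
  ultimately have "\<alpha> \<noteq> 3" by auto
  with * \<open>\<forall>\<beta>\<in>_. \<beta> < 3\<close> show ?case by auto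
qed

lemma accepts_from_snoc:
  "accepts_from n y (st @ [\<alpha>]) (a # w) \<longleftrightarrow> y \<le> n \<and> a < 7 \<and> \<alpha> < 4 \<and>
     accepts_from n (fst (delta n y a \<alpha>)) (st @ snd (delta n y a \<alpha>)) w"
  by (auto simp: accepts_from_Cons)

text \<open>After letters 1 and 4 the new stack no longer reveals that the old one was nonempty, and
  after letter 1 the new state \<open>y - 1\<close> does not reveal \<open>y \<le> n\<close>. These
  conditions are therefore stated explicitly.\<close>

lemma accepts_from_letter:
  "accepts_from n y st (0 # w) \<longleftrightarrow> y < n \<and> accepts_from n (y + 1) st w"
  "accepts_from n y st (1 # w) \<longleftrightarrow> 0 < y \<and> y \<le> n \<and> accepts_from n (y - 1) (st @ [1]) w \<and> st \<noteq> []"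
  "accepts_from n y st (2 # w) \<longleftrightarrow> (\<exists>st'. st = st' @ [1] \<and> accepts_from n y st' w)"
  "accepts_from n y st (3 # w) \<longleftrightarrow> accepts_from n y st w"
  "accepts_from n y st (4 # w) \<longleftrightarrow> accepts_from n y (st @ [2]) w \<and> st \<noteq> []"
  "accepts_from n y st (5 # w) \<longleftrightarrow> y = 0 \<and> accepts_from n y st w"
  "accepts_from n y st (6 # w) \<longleftrightarrow> (\<exists>st'. st = st' @ [2] \<and> accepts_from n y st' w)"
proof -
  note inv = accepts_from_inv[of n y st] accepts_from_inv[of n "y + 1" st w] accepts_from_inv[of n y "butlast st" w]
    accepts_from_inv[of n "y - 1" "st @ [1]" w] accepts_from_inv[of n y "st @ [2]" w]
  have nil: "\<not> accepts_from n y [] w" for y w using accepts_from_inv[of n y "[]" w] by auto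
  have J: "\<not> accepts_from n y (st @ [3]) w" "\<not> accepts_from n y (st @ [3, b]) w" for y st b
    using accepts_from_inv[of n _ "_ @ [3]" w] accepts_from_inv[of n _ "_ @ [3, b]" w] by auto
  show "accepts_from n y st (0 # w) \<longleftrightarrow> y < n \<and> accepts_from n (y + 1) st w"
    using inv(2) by (cases st rule: rev_cases) (auto simp: accepts_from_snoc delta_def nil J)
  show "accepts_from n y st (1 # w) \<longleftrightarrow> 0 < y \<and> y \<le> n \<and> accepts_from n (y - 1) (st @ [1]) w \<and> st \<noteq> []"
    using inv(4) by (cases st rule: rev_cases) (auto simp: accepts_from_snoc delta_def nil J)
  show "accepts_from n y st (2 # w) \<longleftrightarrow> (\<exists>st'. st = st' @ [1] \<and> accepts_from n y st' w)"
    using inv(3) by (cases st rule: rev_cases) (auto simp: accepts_from_snoc delta_def nil J)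
  show "accepts_from n y st (3 # w) \<longleftrightarrow> accepts_from n y st w"
    using inv(1)[of w] by (cases st rule: rev_cases) (auto simp: accepts_from_snoc delta_def nil J)
  show "accepts_from n y st (4 # w) \<longleftrightarrow> accepts_from n y (st @ [2]) w \<and> st \<noteq> []"
    using inv(5) by (cases st rule: rev_cases) (auto simp: accepts_from_snoc delta_def nil J)
  show "accepts_from n y st (5 # w) \<longleftrightarrow> y = 0 \<and> accepts_from n y st w"
    using inv(1)[of w] by (cases st rule: rev_cases) (auto simp: accepts_from_snoc delta_def nil J)
  show "accepts_from n y st (6 # w) \<longleftrightarrow> (\<exists>st'. st = st' @ [2] \<and> accepts_from n y st' w)"
    using inv(3) by (cases st rule: rev_cases) (auto simp: accepts_from_snoc delta_def nil J)
qed

lemma accepts_from_replicate_0: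
  "accepts_from n y st (replicate c 0 @ w) \<longleftrightarrow> y + c \<le> n \<and> accepts_from n (y + c) st w"
proof (induction c arbitrary: y)
  case 0
  show ?case using accepts_from_inv[of n y st w] by auto
qed (auto simp: accepts_from_letter)

lemma accepts_from_replicate_1:
  "accepts_from n y st (replicate c 1 @ w) \<longleftrightarrow>
     c \<le> y \<and> y \<le> n \<and> st \<noteq> [] \<and> accepts_from n (y - c) (st @ replicate c 1) w"
proof (induction c arbitrary: y st)
  case 0
  show ?case using accepts_from_inv[of n y st w] by auto
next
  case (Suc c)
  have "accepts_from n y st (replicate (Suc c) 1 @ w) \<longleftrightarrow>
      0 < y \<and> y \<le> n \<and> accepts_from n (y - 1) (st @ [1]) (replicate c 1 @ w) \<and> st \<noteq> []"
    by (simp add: accepts_from_letter(2) del: One_nat_def)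
  also have "\<dots> \<longleftrightarrow> Suc c \<le> y \<and> y \<le> n \<and> st \<noteq> [] \<and> accepts_from n (y - Suc c) (st @ replicate (Suc c) 1) w"
    unfolding Suc by auto
  finally show ?case .
qed

lemma accepts_from_replicate_2:
  "accepts_from n y st (replicate c 2 @ w) \<longleftrightarrow> (\<exists>st'. st = st' @ replicate c 1 \<and> accepts_from n y st' w)"
proof (induction c arbitrary: st)
  case (Suc c)
  have "accepts_from n y st (replicate (Suc c) 2 @ w) \<longleftrightarrow>
      (\<exists>st'. st = st' @ [1] \<and> (\<exists>st''. st' = st'' @ replicate c 1 \<and> accepts_from n y st'' w))"
    by (simp add: accepts_from_letter(3) Suc del: One_nat_def)
  also have "\<dots> \<longleftrightarrow> (\<exists>st'. st = st' @ (replicate c 1 @ [1]) \<and> accepts_from n y st' w)"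
    by auto
  also have "replicate c (1 :: nat) @ [1] = replicate (Suc c) 1" by (simp add: replicate_append_same)
  finally show ?case .
qed auto

text \<open>The net effect of a whole block. In \<open>Pull\<close> the step letters remove the ones
  and the end letter the 2 below them, hence the order \<open>[2] @ replicate c 1\<close>.\<close>

fun counter_step :: "nat \<Rightarrow> action \<Rightarrow> nat \<Rightarrow> nat \<times> nat list \<Rightarrow> nat \<times> nat list \<Rightarrow> bool" where
  "counter_step n Acc c (y, st) s \<longleftrightarrow> y + c \<le> n \<and> s = (y + c, st)"
| "counter_step n Mark c (y, st) s \<longleftrightarrow> y + c \<le> n \<and> st \<noteq> [] \<and> s = (y + c, st @ [2])"
| "counter_step n Dump c (y, st) s \<longleftrightarrow> y = c \<and> y \<le> n \<and> st \<noteq> [] \<and> s = (0, st @ replicate c 1)"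
| "counter_step n Pull c (y, st) s \<longleftrightarrow> (\<exists>st'. st = st' @ [2] @ replicate c 1 \<and> s = (y, st'))"

lemma accepts_from_block:
  "accepts_from n y st (block a c @ w) \<longleftrightarrow>
     (\<exists>y' st'. counter_step n a c (y, st) (y', st') \<and> accepts_from n y' st' w)"
proof (cases a)
  case Pull
  have "accepts_from n y st (block a c @ w) \<longleftrightarrow> (\<exists>st'. st = st' @ replicate c 1 \<and> accepts_from n y st' (6 # w))"
    by (simp add: Pull block_def accepts_from_replicate_2)
  also have "\<dots> \<longleftrightarrow> (\<exists>y' st'. counter_step n a c (y, st) (y', st') \<and> accepts_from n y' st' w)"
    by (auto simp: Pull accepts_from_letter(7))
  finally show ?thesis .
next
  case Dump
  have "accepts_from n y st (block a c @ w) \<longleftrightarrow>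
      c \<le> y \<and> y \<le> n \<and> st \<noteq> [] \<and> accepts_from n (y - c) (st @ replicate c 1) (5 # w)"
    using accepts_from_replicate_1[of n y st c "5 # w"] by (simp add: Dump block_def)
  also have "\<dots> \<longleftrightarrow> (\<exists>y' st'. counter_step n a c (y, st) (y', st') \<and> accepts_from n y' st' w)"
    by (auto simp: Dump accepts_from_letter(6))
  finally show ?thesis .
qed (auto simp: block_def accepts_from_replicate_0 accepts_from_letter)


section \<open>The layered finite automata\<close>

text \<open>
  In each block a finite automaton holds a vertex, which \<open>Test\<close> compares with \<open>c\<close> and sets to 0,
  \<open>Count\<close> increases by \<open>c\<close>, \<open>Jump\<close> moves along an edge, \<open>Guess\<close> chooses anew. Except for
  \<open>Keep\<close>, \<open>Test\<close> and \<open>Count\<close>, these force \<open>c = 0\<close>.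
\<close>

datatype kind = Keep | Test | Count | Jump | Hold | Guess | Reset

fun step_rel :: "kind \<Rightarrow> nat \<Rightarrow> nat \<Rightarrow> bool" where
  "step_rel Keep u v \<longleftrightarrow> u = v"
| "step_rel Test u v \<longleftrightarrow> u = v + 1"
| "step_rel Count u v \<longleftrightarrow> u + 1 = v"
| "step_rel _ u v \<longleftrightarrow> False"

fun end_rel :: "(nat \<times> nat) set \<Rightarrow> kind \<Rightarrow> nat \<Rightarrow> nat \<Rightarrow> bool" where
  "end_rel E Keep u v \<longleftrightarrow> u = v"
| "end_rel E Test u v \<longleftrightarrow> u + v = 0"
| "end_rel E Count u v \<longleftrightarrow> u = v"
| "end_rel E Jump u v \<longleftrightarrow> (u, v) \<in> E"
| "end_rel E Hold u v \<longleftrightarrow> u = v"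
| "end_rel E Guess u v \<longleftrightarrow> True"
| "end_rel E Reset u v \<longleftrightarrow> v = 0"

text \<open>All pairs of vertices get a transition, so that the encoding of the automaton has a fixed
  shape; the pairs that are not in the relation read the stack symbol 1, which never occurs.\<close>

definition pair_transitions ::
  "nat \<Rightarrow> (nat \<times> nat) set \<Rightarrow> nat \<Rightarrow> action \<Rightarrow> kind \<Rightarrow> nat \<Rightarrow> nat \<Rightarrow> (nat, nat, nat) transition list" where
  "pair_transitions n E l a k u v =
     [(l * n + u, Some (step_letter a), of_bool (\<not> step_rel k u v), l * n + v, [of_bool (\<not> step_rel k u v)]),
      (l * n + u, Some (end_letter a), of_bool (\<not> end_rel E k u v), Suc l * n + v, [of_bool (\<not> end_rel E k u v)])]"

definition layer_transitions ::
  "nat \<Rightarrow> (nat \<times> nat) set \<Rightarrow> nat \<Rightarrow> action \<times> kind \<Rightarrow> (nat, nat, nat) transition list" where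
  "layer_transitions n E l ak =
     concat (map (\<lambda>u. concat (map (\<lambda>v. pair_transitions n E l (fst ak) (snd ak) u v) [0..<n])) [0..<n])"

definition tracker_transitions ::
  "nat \<Rightarrow> (nat \<times> nat) set \<Rightarrow> (action \<times> kind) list \<Rightarrow> (nat, nat, nat) transition list" where
  "tracker_transitions n E aks = concat (map (\<lambda>l. layer_transitions n E l (aks ! l)) [0..<length aks])"

text \<open>State \<open>l * n + u\<close> stands for vertex \<open>u\<close> in block
  \<open>l\<close>, and one more layer follows the last block. The additional state keeps the
  initial state 0 legal when \<open>n = 0\<close>.\<close>

definition tracker :: "nat \<Rightarrow> (nat \<times> nat) set \<Rightarrow> (action \<times> kind) list \<Rightarrow> machine" where
  "tracker n E aks = \<lparr>states = {..<(length aks + 1) * n + 1}, alphabet = {..<7}, stack_alphabet = {..<4}, bottom = 0,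
     transitions = set (tracker_transitions n E aks), initial = 0,
     final = (\<lambda>x. length aks * n + x) ` {..<n}\<rparr>"

lemma tracker_simps [simp]:
  "states (tracker n E aks) = {..<(length aks + 1) * n + 1}" "alphabet (tracker n E aks) = {..<7}"
  "stack_alphabet (tracker n E aks) = {..<4}" "bottom (tracker n E aks) = 0"
  "initial (tracker n E aks) = 0" "final (tracker n E aks) = (\<lambda>x. length aks * n + x) ` {..<n}"
  by (simp_all add: tracker_def)

lemma tracker_transitions_cases:
  assumes "t \<in> transitions (tracker n E aks)"
  obtains l u v where "l < length aks" "u < n" "v < n"
    "t \<in> set (pair_transitions n E l (fst (aks ! l)) (snd (aks ! l)) u v)"
  using assms by (auto simp: tracker_def tracker_transitions_def layer_transitions_def)

lemma pair_transitions_in_tracker: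
  assumes "l < length aks" "u < n" "v < n"
  shows "set (pair_transitions n E l (fst (aks ! l)) (snd (aks ! l)) u v) \<subseteq> transitions (tracker n E aks)"
  using assms by (force simp: tracker_def tracker_transitions_def layer_transitions_def)

lemma layer_index_less: "l < L \<Longrightarrow> u < n \<Longrightarrow> l * n + u < L * n" for l n u L :: nat
proof -
  assume *: "l < L" "u < n"
  then have "l * n + u < Suc l * n" by simp
  also have "\<dots> \<le> L * n" by (rule mult_right_mono) (use * in auto)
  finally show ?thesis .
qed

lemma layer_index_inject:
  fixes l l' u u' n :: nat
  assumes "u < n" "u' < n"
  shows "l * n + u = l' * n + u' \<longleftrightarrow> l = l' \<and> u = u'"
proof
  assume eq: "l * n + u = l' * n + u'"
  have "l = (l * n + u) div n" "u = (l * n + u) mod n" using assms by auto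
  moreover have "l' = (l' * n + u') div n" "u' = (l' * n + u') mod n" using assms by auto
  ultimately show "l = l' \<and> u = u'" unfolding eq by metis
qed auto

lemma step_letter_less: "step_letter a < 7" and end_letter_less: "end_letter a < 7"
  by (cases a; simp)+

lemma nfa_tracker: "nfa (tracker n E aks)"
  unfolding nfa_def pda_def tracker_simps
proof (intro conjI)
  show "finite (transitions (tracker n E aks))" by (simp add: tracker_def)
  show "transitions (tracker n E aks) \<subseteq> {..<(length aks + 1) * n + 1} \<times> ({None} \<union> Some ` {..<7}) \<times> {..<4}
      \<times> {..<(length aks + 1) * n + 1} \<times> lists {..<4}"
  proof
    fix t assume "t \<in> transitions (tracker n E aks)"
    then obtain l u v where luv: "l < length aks" "u < n" "v < n"
      "t \<in> set (pair_transitions n E l (fst (aks ! l)) (snd (aks ! l)) u v)"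
      by (rule tracker_transitions_cases)
    have "l * n + u < (length aks + 1) * n" "l * n + v < (length aks + 1) * n" "Suc l * n + v < (length aks + 1) * n"
      using luv by (auto intro!: layer_index_less simp del: mult_Suc)
    with luv(4) show "t \<in> {..<(length aks + 1) * n + 1} \<times> ({None} \<union> Some ` {..<7}) \<times> {..<4}
      \<times> {..<(length aks + 1) * n + 1} \<times> lists {..<4}"
      by (auto simp: pair_transitions_def step_letter_less end_letter_less)
  qed
  show "(\<lambda>x. length aks * n + x) ` {..<n} \<subseteq> {..<(length aks + 1) * n + 1}" by auto
  show "\<forall>(p, a, \<alpha>, q, \<beta>)\<in>transitions (tracker n E aks).
       (0 \<in> set \<beta>) = (\<alpha> = 0 \<and> (\<exists>\<gamma>. \<beta> = 0 # \<gamma> \<and> 0 \<notin> set \<gamma>))"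
    by (auto elim!: tracker_transitions_cases simp: pair_transitions_def)
  show "\<forall>(p, a, \<alpha>, q, \<beta>)\<in>transitions (tracker n E aks). a \<noteq> None \<and> \<beta> = [\<alpha>]"
    by (auto elim!: tracker_transitions_cases simp: pair_transitions_def)
qed auto

lemma realtime_tracker: "realtime (tracker n E aks)"
  using nfa_tracker[of n E aks] by (auto simp: realtime_def nfa_def)

text \<open>Unrelated pairs ask for the symbol 1 and drop out here. Layer and vertex are recovered
  from the state by division with remainder.\<close>

lemma tracker_enabled:
  assumes "u < n" "l < length aks"
  shows "(l * n + u, Some b, 0, q, \<beta>) \<in> transitions (tracker n E aks) \<longleftrightarrow>
    (\<exists>v<n. b = step_letter (fst (aks ! l)) \<and> step_rel (snd (aks ! l)) u v \<and> q = l * n + v \<and> \<beta> = [0] \<or>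
           b = end_letter (fst (aks ! l)) \<and> end_rel E (snd (aks ! l)) u v \<and> q = Suc l * n + v \<and> \<beta> = [0])"
    (is "?L = ?R")
proof
  assume ?L
  then obtain l' u' v where luv: "l' < length aks" "u' < n" "v < n"
    "(l * n + u, Some b, 0, q, \<beta>) \<in> set (pair_transitions n E l' (fst (aks ! l')) (snd (aks ! l')) u' v)"
    by (rule tracker_transitions_cases)
  from luv(4) have "l * n + u = l' * n + u'" by (auto simp: pair_transitions_def)
  then have "l' = l" "u' = u" using layer_index_inject[OF assms(1) luv(2)] by auto
  with luv show ?R by (auto simp: pair_transitions_def)
next
  assume ?R
  then obtain v where v: "v < n" "(l * n + u, Some b, 0, q, \<beta>) \<in> set (pair_transitions n E l (fst (aks ! l)) (snd (aks ! l)) u v)"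
    by (auto simp: pair_transitions_def)
  with pair_transitions_in_tracker[OF assms(2,1) v(1)] show ?L by blast
qed

lemma tracker_stuck:
  assumes "u < n"
  shows "(length aks * n + u, Some b, \<alpha>, q, \<beta>) \<notin> transitions (tracker n E aks)"
proof
  assume "(length aks * n + u, Some b, \<alpha>, q, \<beta>) \<in> transitions (tracker n E aks)"
  then obtain l' u' v where luv: "l' < length aks" "u' < n" "v < n"
    "(length aks * n + u, Some b, \<alpha>, q, \<beta>) \<in> set (pair_transitions n E l' (fst (aks ! l')) (snd (aks ! l')) u' v)"
    by (rule tracker_transitions_cases)
  from luv(4) have "length aks * n + u = l' * n + u'" by (auto simp: pair_transitions_def)
  with luv assms show False by (simp add: layer_index_inject)
qed

definition tracks :: "nat \<Rightarrow> (nat \<times> nat) set \<Rightarrow> (action \<times> kind) list \<Rightarrow> nat \<Rightarrow> nat \<Rightarrow> nat list \<Rightarrow> bool" where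
  "tracks n E aks l u w \<longleftrightarrow> (\<exists>f \<in> final (tracker n E aks). run (tracker n E aks) (l * n + u, [0]) w (f, [0]))"

lemma lang_tracker: "w \<in> lang (tracker n E aks) \<longleftrightarrow> tracks n E aks 0 0 w"
  by (simp add: lang_def tracks_def)

lemma tracks_end:
  assumes "u < n"
  shows "tracks n E aks (length aks) u w \<longleftrightarrow> w = []"
proof (cases w)
  case Nil
  then show ?thesis using assms by (auto simp: tracks_def intro: run_refl)
next
  case (Cons b w')
  then show ?thesis
    by (auto simp: tracks_def run_Cons_realtime[OF realtime_tracker] tracker_stuck[OF assms])
qed

lemma tracks_Nil:
  assumes "u < n" "l < length aks"
  shows "\<not> tracks n E aks l u []"
proof -
  have "l * n + u < length aks * n" by (rule layer_index_less) (use assms in auto)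
  then show ?thesis by (auto simp: tracks_def run_Nil_realtime[OF realtime_tracker])
qed

lemma tracks_Cons:
  assumes "u < n" "l < length aks"
  shows "tracks n E aks l u (b # w) \<longleftrightarrow>
    (\<exists>v<n. b = step_letter (fst (aks ! l)) \<and> step_rel (snd (aks ! l)) u v \<and> tracks n E aks l v w \<or>
           b = end_letter (fst (aks ! l)) \<and> end_rel E (snd (aks ! l)) u v \<and> tracks n E aks (Suc l) v w)"
proof -
  have "[0] = \<gamma> @ [\<alpha>] \<longleftrightarrow> \<gamma> = [] \<and> \<alpha> = 0" for \<gamma> and \<alpha> :: nat by (cases \<gamma>) auto
  then show ?thesis
    unfolding tracks_def run_Cons_realtime[OF realtime_tracker] by (simp add: tracker_enabled[OF assms]) blast
qed

text \<open>The closed form of \<open>c\<close> moves along \<open>step_rel\<close> followed by one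
  along \<open>end_rel\<close>. Vertices passed by step moves lie between \<open>u\<close> and
  \<open>v\<close>, so bounding the larger of the two suffices.\<close>

fun kind_step :: "nat \<Rightarrow> (nat \<times> nat) set \<Rightarrow> kind \<Rightarrow> nat \<Rightarrow> nat \<Rightarrow> nat \<Rightarrow> bool" where
  "kind_step n E Keep c u v \<longleftrightarrow> u < n \<and> v = u"
| "kind_step n E Test c u v \<longleftrightarrow> u < n \<and> u = c \<and> v = 0"
| "kind_step n E Count c u v \<longleftrightarrow> v < n \<and> v = u + c"
| "kind_step n E Jump c u v \<longleftrightarrow> c = 0 \<and> u < n \<and> v < n \<and> (u, v) \<in> E"
| "kind_step n E Hold c u v \<longleftrightarrow> c = 0 \<and> u < n \<and> v = u"
| "kind_step n E Guess c u v \<longleftrightarrow> c = 0 \<and> u < n \<and> v < n"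
| "kind_step n E Reset c u v \<longleftrightarrow> c = 0 \<and> u < n \<and> v = 0"

lemma kind_step_less: "kind_step n E k c u v \<Longrightarrow> u < n \<and> v < n"
  by (cases k) auto

lemma kind_step_0: "kind_step n E k 0 u v \<longleftrightarrow> u < n \<and> v < n \<and> end_rel E k u v"
  by (cases k) auto

lemma kind_step_Suc: "kind_step n E k (Suc c) u v \<longleftrightarrow> (\<exists>x. u < n \<and> step_rel k u x \<and> kind_step n E k c x v)"
  by (cases k) auto

text \<open>Inside layer \<open>l\<close> only the two letters of its action can be read, and the
  end letter is the only way out, so what is read there is a block.\<close>

lemma tracks_block:
  assumes "u < n" "l < length aks"
  shows "tracks n E aks l u w \<longleftrightarrow>
    (\<exists>c w' v. w = block (fst (aks ! l)) c @ w' \<and> kind_step n E (snd (aks ! l)) c u v \<and> tracks n E aks (Suc l) v w')"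
  using assms(1)
proof (induction w arbitrary: u)
  case Nil
  then show ?case using tracks_Nil[OF Nil assms(2)] by (auto simp: block_def)
next
  case (Cons b w)
  let ?a = "fst (aks ! l)" and ?k = "snd (aks ! l)"
  have "(\<exists>c w' v. b # w = block ?a c @ w' \<and> kind_step n E ?k c u v \<and> tracks n E aks (Suc l) v w') \<longleftrightarrow>
    (\<exists>v. b = end_letter ?a \<and> kind_step n E ?k 0 u v \<and> tracks n E aks (Suc l) v w) \<or>
    (\<exists>c w' v. b = step_letter ?a \<and> w = block ?a c @ w' \<and> kind_step n E ?k (Suc c) u v \<and> tracks n E aks (Suc l) v w')"
    (is "?P \<longleftrightarrow> ?Q1 \<or> ?Q2")
  proof
    assume ?P
    then obtain c w' v where *: "b # w = block ?a c @ w'" "kind_step n E ?k c u v" "tracks n E aks (Suc l) v w'" by blast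
    then show "?Q1 \<or> ?Q2" by (cases c) (auto simp: block_def)
  next
    assume "?Q1 \<or> ?Q2"
    then show ?P
    proof
      assume ?Q1
      then obtain v where "b = end_letter ?a" "kind_step n E ?k 0 u v" "tracks n E aks (Suc l) v w" by blast
      moreover from this(1) have "b # w = block ?a 0 @ w" by (simp add: block_def)
      ultimately show ?P by blast
    next
      assume ?Q2
      then obtain c w' v where *: "b = step_letter ?a" "w = block ?a c @ w'" "kind_step n E ?k (Suc c) u v" "tracks n E aks (Suc l) v w'"
        by blast
      then have "b # w = block ?a (Suc c) @ w'" by (simp add: block_def)
      with * show ?P by blast
    qed
  qed
  also have "?Q1 \<longleftrightarrow> (\<exists>v<n. b = end_letter ?a \<and> end_rel E ?k u v \<and> tracks n E aks (Suc l) v w)"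
    using Cons.prems by (auto simp: kind_step_0)
  also have "?Q2 \<longleftrightarrow> (\<exists>x<n. b = step_letter ?a \<and> step_rel ?k u x \<and> tracks n E aks l x w)"
  proof
    assume ?Q2
    then obtain c w' v where *: "b = step_letter ?a" "w = block ?a c @ w'" "kind_step n E ?k (Suc c) u v" "tracks n E aks (Suc l) v w'"
      by blast
    then obtain x where x: "step_rel ?k u x" "kind_step n E ?k c x v" by (auto simp: kind_step_Suc)
    then have "x < n" using kind_step_less by blast
    with Cons.IH[of x] * x show "\<exists>x<n. b = step_letter ?a \<and> step_rel ?k u x \<and> tracks n E aks l x w" by blast
  next
    assume "\<exists>x<n. b = step_letter ?a \<and> step_rel ?k u x \<and> tracks n E aks l x w"
    then obtain x where x: "x < n" "b = step_letter ?a" "step_rel ?k u x" "tracks n E aks l x w" by blast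
    then obtain c w' v where *: "w = block ?a c @ w'" "kind_step n E ?k c x v" "tracks n E aks (Suc l) v w'"
      using Cons.IH[of x] by blast
    then have "kind_step n E ?k (Suc c) u v" using x(3) Cons.prems by (auto simp: kind_step_Suc)
    with * x(2) show ?Q2 by blast
  qed
  finally show ?case unfolding tracks_Cons[OF Cons.prems assms(2)] by blast
qed


section \<open>The protocol\<close>

type_synonym protocol = "(action \<times> (nat \<Rightarrow> kind)) list"
type_synonym joint_state = "nat \<times> nat list \<times> (nat \<Rightarrow> nat)"

definition for_tracker :: "protocol \<Rightarrow> nat \<Rightarrow> (action \<times> kind) list" where
  "for_tracker ls i = map (\<lambda>(a, kd). (a, kd i)) ls"

lemma length_for_tracker [simp]: "length (for_tracker ls i) = length ls"
  by (simp add: for_tracker_def)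

context
  fixes n m :: nat and E :: "(nat \<times> nat) set"
begin

text \<open>Indices from \<open>m\<close> on belong to no automaton. Freezing their values makes
  successors equal as functions, so that the effect of a deterministic piece is an equation.\<close>

fun joint_step :: "action \<times> (nat \<Rightarrow> kind) \<Rightarrow> nat \<Rightarrow> joint_state \<Rightarrow> joint_state \<Rightarrow> bool" where
  "joint_step (a, kd) c (y, st, x) (y', st', x') \<longleftrightarrow>
     counter_step n a c (y, st) (y', st') \<and> (\<forall>i<m. kind_step n E (kd i) c (x i) (x' i)) \<and> (\<forall>i\<ge>m. x' i = x i)"

fun joint :: "protocol \<Rightarrow> joint_state \<Rightarrow> joint_state \<Rightarrow> bool" where
  "joint [] s s' \<longleftrightarrow> s = s'"
| "joint (l # ls) s s' \<longleftrightarrow> (\<exists>c s1. joint_step l c s s1 \<and> joint ls s1 s')"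

lemma joint_append: "joint (ls @ ls') s s' \<longleftrightarrow> (\<exists>s1. joint ls s s1 \<and> joint ls' s1 s')"
proof (induction ls arbitrary: s)
  case (Cons l ls)
  show ?case unfolding append_Cons joint.simps Cons by blast
qed auto

lemma joint_append_det:
  "(\<And>s. joint ls a s \<longleftrightarrow> s = b) \<Longrightarrow> joint (ls @ ls') a s' \<longleftrightarrow> joint ls' b s'"
  by (simp add: joint_append)

lemma joint_append_ex:
  assumes "\<And>s. joint ls a s \<longleftrightarrow> (\<exists>q. P q \<and> s = f q)"
  shows "joint (ls @ ls') a s' \<longleftrightarrow> (\<exists>q. P q \<and> joint ls' (f q) s')"
  unfolding joint_append assms by blast

lemma ex_joint_state: "(\<exists>s :: joint_state. P s) \<longleftrightarrow> (\<exists>y st x. P (y, st, x))"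
  by auto

text \<open>A finite automaton forces the word into the blocks of the protocol, whence
  \<open>m > 0\<close>; the pushdown automaton alone reads blocks in any order. Step letters differ
  from end letters, so a word determines its first block and all machines see the same
  \<open>c\<close>.\<close>

lemma common_word_iff_joint:
  assumes "m > 0" "l \<le> length ls" "\<And>i. i < m \<Longrightarrow> x i < n"
  shows "(\<exists>w. accepts_from n y st w \<and> (\<forall>i<m. tracks n E (for_tracker ls i) l (x i) w)) \<longleftrightarrow>
    (\<exists>x'. joint (drop l ls) (y, st, x) (0, [0], x'))"
  using assms(2,3)
proof (induction "length ls - l" arbitrary: l y st x)
  case 0
  then have l: "l = length ls" by simp
  have "tracks n E (for_tracker ls i) l (x i) w \<longleftrightarrow> w = []" if "i < m" for i w
    using tracks_end[OF 0(3)[OF that], of E "for_tracker ls i" w] by (simp add: l)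
  then have "(\<forall>i<m. tracks n E (for_tracker ls i) l (x i) w) \<longleftrightarrow> w = []" for w
    using assms(1) unfolding l by blast
  then show ?case by (simp add: l accepts_from_Nil)
next
  case (Suc d)
  then have l: "l < length ls" by simp
  obtain a kd where akd: "ls ! l = (a, kd)" by (cases "ls ! l")
  have ft: "for_tracker ls i ! l = (a, kd i)" for i using l akd by (simp add: for_tracker_def)
  have tr: "tracks n E (for_tracker ls i) l (x i) w \<longleftrightarrow>
    (\<exists>c w' v. w = block a c @ w' \<and> kind_step n E (kd i) c (x i) v \<and> tracks n E (for_tracker ls i) (Suc l) v w')"
    if "i < m" for i w
    using tracks_block[OF Suc.prems(2)[OF that], of l "for_tracker ls i" E w] l by (simp add: ft)
  have dr: "drop l ls = (a, kd) # drop (Suc l) ls" using Cons_nth_drop_Suc[OF l] akd by simp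
  have IH: "(\<exists>w. accepts_from n y st w \<and> (\<forall>i<m. tracks n E (for_tracker ls i) (Suc l) (x i) w)) \<longleftrightarrow>
    (\<exists>x'. joint (drop (Suc l) ls) (y, st, x) (0, [0], x'))" if "\<forall>i<m. x i < n" for y st x
    by (rule Suc.hyps(1)) (use Suc.hyps(2) l that in auto)
  show ?case
  proof
    assume "\<exists>w. accepts_from n y st w \<and> (\<forall>i<m. tracks n E (for_tracker ls i) l (x i) w)"
    then obtain w where w: "accepts_from n y st w" "\<And>i. i < m \<Longrightarrow> tracks n E (for_tracker ls i) l (x i) w" by blast
    from tr[OF assms(1)] w(2)[OF assms(1)] obtain c w' where cw: "w = block a c @ w'" by blast
    have "\<exists>v. kind_step n E (kd i) c (x i) v \<and> tracks n E (for_tracker ls i) (Suc l) v w'" if i: "i < m" for i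
    proof -
      obtain c' w'' v where *: "w = block a c' @ w''" "kind_step n E (kd i) c' (x i) v"
        "tracks n E (for_tracker ls i) (Suc l) v w''"
        using tr[OF i] w(2)[OF i] by blast
      have "c = c' \<and> w' = w''" if "block a c @ w' = block a c' @ w''" for c'
        using that
      proof (induction c arbitrary: c')
        case 0
        then show ?case by (cases c') (auto simp: block_def letters_distinct letters_distinct[symmetric])
      next
        case (Suc c)
        then show ?case by (cases c') (auto simp: block_def letters_distinct)
      qed
      with * cw show ?thesis by auto
    qed
    then obtain f where f: "\<And>i. i < m \<Longrightarrow> kind_step n E (kd i) c (x i) (f i) \<and> tracks n E (for_tracker ls i) (Suc l) (f i) w'"
      by metis
    define x1 where "x1 i = (if i < m then f i else x i)" for i
    obtain y1 st1 where s1: "counter_step n a c (y, st) (y1, st1)" "accepts_from n y1 st1 w'"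
      using w(1) by (auto simp: cw accepts_from_block)
    have "joint_step (a, kd) c (y, st, x) (y1, st1, x1)" using s1 f by (simp add: x1_def)
    moreover have "\<exists>x'. joint (drop (Suc l) ls) (y1, st1, x1) (0, [0], x')"
    proof -
      have "\<forall>i<m. x1 i < n" using f kind_step_less by (fastforce simp: x1_def)
      moreover have "\<exists>w. accepts_from n y1 st1 w \<and> (\<forall>i<m. tracks n E (for_tracker ls i) (Suc l) (x1 i) w)"
        using s1(2) f by (auto simp: x1_def)
      ultimately show ?thesis using IH by simp
    qed
    ultimately show "\<exists>x'. joint (drop l ls) (y, st, x) (0, [0], x')" unfolding dr joint.simps by blast
  next
    assume "\<exists>x'. joint (drop l ls) (y, st, x) (0, [0], x')"
    then obtain c y1 st1 x1 x' where *: "joint_step (a, kd) c (y, st, x) (y1, st1, x1)"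
      "joint (drop (Suc l) ls) (y1, st1, x1) (0, [0], x')"
      unfolding dr joint.simps ex_joint_state by blast
    then have "\<forall>i<m. x1 i < n" using kind_step_less by fastforce
    then obtain w where w: "accepts_from n y1 st1 w" "\<forall>i<m. tracks n E (for_tracker ls i) (Suc l) (x1 i) w"
      using IH[of x1 y1 st1] *(2) by blast
    have "accepts_from n y st (block a c @ w)" using *(1) w(1) by (auto simp: accepts_from_block)
    moreover have "tracks n E (for_tracker ls i) l (x i) (block a c @ w)" if "i < m" for i
    proof -
      have "kind_step n E (kd i) c (x i) (x1 i)" "tracks n E (for_tracker ls i) (Suc l) (x1 i) w"
        using *(1) w(2) that by auto
      then show ?thesis unfolding tr[OF that] by blast
    qed
    ultimately show "\<exists>w. accepts_from n y st w \<and> (\<forall>i<m. tracks n E (for_tracker ls i) l (x i) w)" by blast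
  qed
qed

text \<open>The separator lies below the ones, so a number taken from the top ends where its
  separator appears, and parsing from the right is unique.\<close>

definition unary :: "nat \<Rightarrow> nat list" where
  "unary c = 2 # replicate c 1"

definition unaries :: "nat \<Rightarrow> (nat \<Rightarrow> nat) \<Rightarrow> nat list" where
  "unaries k x = concat (map (\<lambda>i. unary (x i)) [0..<k])"

lemma unaries_simps [simp]: "unaries 0 x = []" "unaries (Suc k) x = unaries k x @ unary (x k)"
  by (simp_all add: unaries_def)

lemma unary_parse: "st @ unary c = st' @ unary c' \<longleftrightarrow> st = st' \<and> c = c'"
proof
  assume "st @ unary c = st' @ unary c'"
  then have "rev (st @ unary c) = rev (st' @ unary c')" by (rule arg_cong)
  then have "replicate c 1 @ 2 # rev st = replicate c' 1 @ 2 # rev st'" by (simp add: unary_def)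
  then show "st = st' \<and> c = c'"
  proof (induction c arbitrary: c')
    case 0
    then show ?case by (cases c') auto
  next
    case (Suc c)
    then show ?case by (cases c') auto
  qed
qed auto

text \<open>\<open>Keep\<close> tolerates every block length, so the other automata neither restrict
  \<open>c\<close> nor change.\<close>

abbreviation only :: "nat \<Rightarrow> kind \<Rightarrow> nat \<Rightarrow> kind" where
  "only i k \<equiv> \<lambda>j. if j = i then k else Keep"

definition bounded :: "(nat \<Rightarrow> nat) \<Rightarrow> bool" where
  "bounded x \<longleftrightarrow> (\<forall>i<m. x i < n)"

lemma only_iff:
  assumes "bounded x" "i < m" "\<And>v. kind_step n E k c (x i) v \<longleftrightarrow> P \<and> v = w"
  shows "(\<forall>j<m. kind_step n E (only i k j) c (x j) (x' j)) \<and> (\<forall>j\<ge>m. x' j = x j) \<longleftrightarrow> P \<and> x' = x(i := w)"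
proof
  assume *: "(\<forall>j<m. kind_step n E (only i k j) c (x j) (x' j)) \<and> (\<forall>j\<ge>m. x' j = x j)"
  then have "kind_step n E (only i k i) c (x i) (x' i)" using assms(2) by blast
  then have P: "P" "x' i = w" using assms(3) by auto
  have "x' j = x j" if "j \<noteq> i" for j
  proof (cases "j < m")
    case True
    then have "kind_step n E (only i k j) c (x j) (x' j)" using * by blast
    then show ?thesis using that by simp
  qed (use * in auto)
  with P show "P \<and> x' = x(i := w)" by auto
next
  assume "P \<and> x' = x(i := w)"
  then show "(\<forall>j<m. kind_step n E (only i k j) c (x j) (x' j)) \<and> (\<forall>j\<ge>m. x' j = x j)"
    using assms by (auto simp: bounded_def)
qed

section \<open>Effects of single blocks\<close>

lemma joint_single: "joint [l] s s' \<longleftrightarrow> (\<exists>c. joint_step l c s s')"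
  unfolding joint.simps by blast

lemma joint_Acc_only_Test:
  assumes "bounded x" "i < m"
  shows "joint [(Acc, only i Test)] (0, st, x) s \<longleftrightarrow> s = (x i, st, x(i := 0))"
proof -
  have k: "kind_step n E Test c (x i) v \<longleftrightarrow> x i = c \<and> v = 0" for c v using assms by (auto simp: bounded_def)
  obtain y' st' x' where s: "s = (y', st', x')" by (cases s)
  have "x i \<le> n" using assms by (auto simp: bounded_def less_imp_le)
  then show ?thesis unfolding joint_single s joint_step.simps only_iff[OF assms k] by auto
qed

lemma joint_Dump_only_Count:
  assumes "bounded x" "i < m" "y \<le> n" "st \<noteq> []"
  shows "joint [(Dump, only i Count)] (y, st, x) s \<longleftrightarrow>
    x i + y < n \<and> s = (0, st @ replicate y 1, x(i := x i + y))"
proof -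
  have k: "kind_step n E Count c (x i) v \<longleftrightarrow> x i + c < n \<and> v = x i + c" for c v by auto
  obtain y' st' x' where s: "s = (y', st', x')" by (cases s)
  show ?thesis unfolding joint_single s joint_step.simps only_iff[OF assms(1,2) k] using assms by auto
qed

lemma joint_Pull_only_Count:
  assumes "bounded x" "i < m"
  shows "joint [(Pull, only i Count)] (y, st @ unary c, x) s \<longleftrightarrow> x i + c < n \<and> s = (y, st, x(i := x i + c))"
proof -
  have k: "kind_step n E Count c (x i) v \<longleftrightarrow> x i + c < n \<and> v = x i + c" for c v by auto
  obtain y' st' x' where s: "s = (y', st', x')" by (cases s)
  have p: "[2] @ replicate c 1 = unary c" for c by (simp add: unary_def)
  show ?thesis unfolding joint_single s joint_step.simps only_iff[OF assms k] counter_step.simps p unary_parse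
    by auto
qed

lemma joint_Pull_only_Test:
  assumes "bounded x" "i < m"
  shows "joint [(Pull, only i Test)] (y, st @ unary c, x) s \<longleftrightarrow> x i = c \<and> s = (y, st, x(i := 0))"
proof -
  have k: "kind_step n E Test c (x i) v \<longleftrightarrow> x i = c \<and> v = 0" for c v using assms by (auto simp: bounded_def)
  obtain y' st' x' where s: "s = (y', st', x')" by (cases s)
  have p: "[2] @ replicate c 1 = unary c" for c by (simp add: unary_def)
  show ?thesis unfolding joint_single s joint_step.simps only_iff[OF assms k] counter_step.simps p unary_parse
    by auto
qed

lemma joint_Mark_Hold:
  assumes "bounded x" "m > 0" "y \<le> n" "st \<noteq> []"
  shows "joint [(Mark, \<lambda>_. Hold)] (y, st, x) s \<longleftrightarrow> s = (y, st @ [2], x)"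
proof -
  have k: "(\<forall>j<m. kind_step n E Hold c (x j) (x' j)) \<and> (\<forall>j\<ge>m. x' j = x j) \<longleftrightarrow> c = 0 \<and> x' = x" for c x'
    using assms(1,2) by (auto simp: fun_eq_iff bounded_def) (metis not_less)+
  obtain y' st' x' where s: "s = (y', st', x')" by (cases s)
  show ?thesis unfolding joint_single s joint_step.simps k using assms by auto
qed

lemma joint_Dump_Keep:
  assumes "bounded x" "m > 0" "y \<le> n" "st \<noteq> []"
  shows "joint [(Dump, \<lambda>_. Keep)] (y, st, x) s \<longleftrightarrow> s = (0, st @ replicate y 1, x)"
proof -
  have k: "(\<forall>j<m. kind_step n E Keep c (x j) (x' j)) \<and> (\<forall>j\<ge>m. x' j = x j) \<longleftrightarrow> x' = x" for c x'
    using assms(1,2) by (auto simp: fun_eq_iff bounded_def) (metis not_less)+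
  obtain y' st' x' where s: "s = (y', st', x')" by (cases s)
  show ?thesis unfolding joint_single s joint_step.simps k using assms by auto
qed

text \<open>All automata count down to 0 over the same block, so they held the same number, and the
  block length copies it into the counter.\<close>

lemma joint_Acc_Test:
  assumes "bounded x" "m > 0"
  shows "joint [(Acc, \<lambda>_. Test)] (0, st, x) s \<longleftrightarrow>
    (\<exists>c. (\<forall>i<m. x i = c) \<and> s = (c, st, \<lambda>i. if i < m then 0 else x i))"
proof -
  let ?z = "\<lambda>i. if i < m then 0 else x i"
  have k: "(\<forall>j<m. kind_step n E Test c (x j) (x' j)) \<and> (\<forall>j\<ge>m. x' j = x j) \<longleftrightarrow> (\<forall>i<m. x i = c) \<and> x' = ?z" for c x'
    using assms(1) by (auto simp: fun_eq_iff bounded_def)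
  obtain y' st' x' where s: "s = (y', st', x')" by (cases s)
  have c: "c \<le> n" if "\<forall>i<m. x i = c" for c
  proof -
    have "x 0 < n" "x 0 = c" using assms that by (auto simp: bounded_def)
    then show ?thesis by simp
  qed
  have "counter_step n Acc c (0, st) (y', st') \<and> (\<forall>i<m. x i = c) \<and> x' = ?z \<longleftrightarrow>
      (\<forall>i<m. x i = c) \<and> (y', st', x') = (c, st, ?z)" for c
  proof (cases "\<forall>i<m. x i = c")
    case True
    with c[OF True] show ?thesis by simp
  next
    case False
    then show ?thesis by blast
  qed
  then show ?thesis unfolding joint_single s joint_step.simps k by blast
qed

text \<open>These four kinds have no move on a step letter, hence the block has \<open>c = 0\<close>
  and the counter stays; \<open>m > 0\<close> provides an automaton that enforces this.\<close>

lemma joint_Acc_still: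
  assumes "m > 0" "y \<le> n" "\<And>i. J i \<in> {Jump, Hold, Guess, Reset}"
  shows "joint [(Acc, J)] (y, st, x) s \<longleftrightarrow>
    (\<exists>x'. (\<forall>i<m. kind_step n E (J i) 0 (x i) (x' i)) \<and> (\<forall>i\<ge>m. x' i = x i) \<and> s = (y, st, x'))"
proof -
  have c: "c = 0" if "kind_step n E (J 0) c u v" for c u v using assms(3)[of 0] that by auto
  obtain y' st' x' where s: "s = (y', st', x')" by (cases s)
  show ?thesis unfolding joint_single s joint_step.simps using assms(1,2) c by auto
qed

text \<open>The vertex travels through the counter because \<open>Test\<close> erases it: during
  \<open>Dump\<close> the counter is unloaded onto the stack and, by the same block length, back
  into automaton \<open>i\<close>. The separator has to be pushed in between, below the
  ones.\<close>

definition push_one :: "nat \<Rightarrow> protocol" where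
  "push_one i = [(Acc, only i Test)] @ [(Mark, \<lambda>_. Hold)] @ [(Dump, only i Count)]"

lemma bounded_upd: "bounded x \<Longrightarrow> v < n \<Longrightarrow> bounded (x(i := v))"
  by (auto simp: bounded_def)

lemma joint_push_one:
  assumes "bounded x" "i < m" "st \<noteq> []"
  shows "joint (push_one i) (0, st, x) s \<longleftrightarrow> s = (0, st @ unary (x i), x)"
proof -
  have m: "m > 0" and xi: "x i < n" using assms by (auto simp: bounded_def)
  have b: "bounded (x(i := 0))" using assms(1) xi by (intro bounded_upd) auto
  have 2: "joint [(Mark, \<lambda>_. Hold)] (x i, st, x(i := 0)) s \<longleftrightarrow> s = (x i, st @ [2], x(i := 0))" for s
    by (rule joint_Mark_Hold) (use b m xi assms in auto)
  have 3: "joint [(Dump, only i Count)] (x i, st @ [2], x(i := 0)) s \<longleftrightarrow> s = (0, st @ unary (x i), x)" for s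
    using joint_Dump_only_Count[OF b assms(2), of "x i" "st @ [2]" s] xi by (simp add: unary_def)
  show ?thesis
    unfolding push_one_def joint_append_det[OF joint_Acc_only_Test[OF assms(1,2)]] joint_append_det[OF 2] by (rule 3)
qed

fun push_all :: "nat \<Rightarrow> protocol" where
  "push_all 0 = []"
| "push_all (Suc k) = push_all k @ push_one k"

lemma joint_push_all:
  assumes "bounded x" "k \<le> m" "st \<noteq> []"
  shows "joint (push_all k) (0, st, x) s \<longleftrightarrow> s = (0, st @ unaries k x, x)"
  using assms(2)
proof (induction k arbitrary: s)
  case (Suc k)
  then have IH: "joint (push_all k) (0, st, x) s \<longleftrightarrow> s = (0, st @ unaries k x, x)" for s by simp
  show ?case
    unfolding push_all.simps joint_append_det[OF IH] 
    using joint_push_one[OF assms(1), of k "st @ unaries k x" s] Suc.prems assms(3) by simp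
qed auto

text \<open>The largest index comes first, as the stack returns the numbers in reverse order.
  \<open>Count\<close> loads them into automata that hold 0; \<open>Test\<close> compares them with
  the values held.\<close>

fun pop_all :: "kind \<Rightarrow> nat \<Rightarrow> protocol" where
  "pop_all kd 0 = []"
| "pop_all kd (Suc k) = [(Pull, only k kd)] @ pop_all kd k"

lemma joint_pop_all_Count:
  assumes "bounded x" "k \<le> m" "\<forall>i<k. x i = 0"
  shows "joint (pop_all Count k) (y, st @ unaries k v, x) s \<longleftrightarrow>
    (\<forall>i<k. v i < n) \<and> s = (y, st, \<lambda>i. if i < k then v i else x i)"
  using assms
proof (induction k arbitrary: x s)
  case (Suc k)
  have 1: "joint [(Pull, only k Count)] (y, (st @ unaries k v) @ unary (v k), x) s \<longleftrightarrow>
      v k < n \<and> s = (y, st @ unaries k v, x(k := v k))" for s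
    using joint_Pull_only_Count[of x k y "st @ unaries k v" "v k" s] Suc.prems by simp
  have IH: "joint (pop_all Count k) (y, st @ unaries k v, x(k := v k)) s \<longleftrightarrow>
      (\<forall>i<k. v i < n) \<and> s = (y, st, \<lambda>i. if i < k then v i else (x(k := v k)) i)" if "v k < n" for s
    by (rule Suc.IH) (use Suc.prems that in \<open>auto simp: bounded_def\<close>)
  have f: "(\<lambda>i. if i < k then v i else (x(k := v k)) i) = (\<lambda>i. if i < Suc k then v i else x i)"
    by (auto simp: fun_eq_iff less_Suc_eq)
  have "joint (pop_all Count (Suc k)) (y, st @ unaries (Suc k) v, x) s \<longleftrightarrow>
      v k < n \<and> joint (pop_all Count k) (y, st @ unaries k v, x(k := v k)) s"
    unfolding pop_all.simps joint_append using 1 by simp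
  also have "\<dots> \<longleftrightarrow> (\<forall>i<Suc k. v i < n) \<and> s = (y, st, \<lambda>i. if i < Suc k then v i else x i)"
  proof -
    have "(\<forall>i<Suc k. v i < n) \<longleftrightarrow> v k < n \<and> (\<forall>i<k. v i < n)" by (auto simp: less_Suc_eq)
    then show ?thesis using IH[unfolded f] by blast
  qed
  finally show ?case .
qed auto

lemma joint_pop_all_Test:
  assumes "bounded x" "k \<le> m"
  shows "joint (pop_all Test k) (y, st @ unaries k v, x) s \<longleftrightarrow>
    (\<forall>i<k. v i = x i) \<and> s = (y, st, \<lambda>i. if i < k then 0 else x i)"
  using assms
proof (induction k arbitrary: x s)
  case (Suc k)
  have "n > 0" using Suc.prems by (auto simp: bounded_def)
  have 1: "joint [(Pull, only k Test)] (y, (st @ unaries k v) @ unary (v k), x) s \<longleftrightarrow>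
      v k = x k \<and> s = (y, st @ unaries k v, x(k := 0))" for s
    using joint_Pull_only_Test[of x k y "st @ unaries k v" "v k" s] Suc.prems by auto
  have IH: "joint (pop_all Test k) (y, st @ unaries k v, x(k := 0)) s \<longleftrightarrow>
      (\<forall>i<k. v i = (x(k := 0)) i) \<and> s = (y, st, \<lambda>i. if i < k then 0 else (x(k := 0)) i)" for s
    by (rule Suc.IH) (use Suc.prems \<open>n > 0\<close> in \<open>auto simp: bounded_def\<close>)
  have f: "(\<lambda>i. if i < k then 0 else (x(k := 0)) i) = (\<lambda>i. if i < Suc k then 0 else x i)"
    by (auto simp: fun_eq_iff less_Suc_eq)
  have "joint (pop_all Test (Suc k)) (y, st @ unaries (Suc k) v, x) s \<longleftrightarrow>
      v k = x k \<and> joint (pop_all Test k) (y, st @ unaries k v, x(k := 0)) s"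
    unfolding pop_all.simps joint_append using 1 by simp
  also have "\<dots> \<longleftrightarrow> (\<forall>i<Suc k. v i = x i) \<and> s = (y, st, \<lambda>i. if i < Suc k then 0 else x i)"
  proof -
    have "(\<forall>i<Suc k. v i = x i) \<longleftrightarrow> v k = x k \<and> (\<forall>i<k. v i = (x(k := 0)) i)" by (auto simp: less_Suc_eq)
    then show ?thesis unfolding IH f by blast
  qed
  finally show ?case .
qed auto

text \<open>The common value \<open>q\<close> that the automata jump to (or already hold) waits in the counter of the
  pushdown automaton while their own values are restored from the stack.\<close>

definition collect :: "(nat \<Rightarrow> kind) \<Rightarrow> protocol" where
  "collect J = push_all m @ [(Acc, J)] @ [(Acc, \<lambda>_. Test)] @ pop_all Count m @ [(Mark, \<lambda>_. Hold)] @ [(Dump, \<lambda>_. Keep)]"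

text \<open>Each automaton checks only the edge from its own vertex to a vertex of its choice; that
  all choices are one vertex \<open>q\<close> is what the common \<open>Test\<close> block
  adds.\<close>

lemma joint_collect:
  assumes x: "bounded x" and m: "m > 0" and st: "st \<noteq> []" and J: "\<And>i. J i \<in> {Jump, Hold}"
  shows "joint (collect J) (0, st, x) s \<longleftrightarrow>
    (\<exists>q. (\<forall>i<m. kind_step n E (J i) 0 (x i) q) \<and> s = (0, st @ unary q, x))"
proof -
  let ?st = "st @ unaries m x"
  let ?A = "[(Acc, J)] @ [(Acc, \<lambda>_. Test)]" and ?B = "pop_all Count m" and ?C = "[(Mark, \<lambda>_. Hold)] @ [(Dump, \<lambda>_. Keep)]"
  let ?P = "\<lambda>q. \<forall>i<m. kind_step n E (J i) 0 (x i) q"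
  let ?z = "\<lambda>i. if i < m then 0 else x i"
  have J': "J i \<in> {Jump, Hold, Guess, Reset}" for i using J[of i] by auto
  have A: "joint ?A (0, ?st, x) s \<longleftrightarrow> (\<exists>q. ?P q \<and> s = (q, ?st, ?z))" for s
  proof
    assume "joint ?A (0, ?st, x) s"
    then obtain x' where x': "\<forall>i<m. kind_step n E (J i) 0 (x i) (x' i)" "\<forall>i\<ge>m. x' i = x i"
      "joint [(Acc, \<lambda>_. Test)] (0, ?st, x') s"
      unfolding joint_append joint_Acc_still[OF m le0 J'] by blast
    then have b: "bounded x'" using kind_step_less unfolding bounded_def by blast
    then obtain c where c: "\<forall>i<m. x' i = c" "s = (c, ?st, \<lambda>i. if i < m then 0 else x' i)"
      using x'(3) joint_Acc_Test[OF b m] by blast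
    moreover have "(\<lambda>i. if i < m then 0 else x' i) = ?z" using x'(2) by (auto simp: fun_eq_iff)
    ultimately show "\<exists>q. ?P q \<and> s = (q, ?st, ?z)" using x'(1) by auto
  next
    assume "\<exists>q. ?P q \<and> s = (q, ?st, ?z)"
    then obtain q where q: "?P q" "s = (q, ?st, ?z)" by blast
    define x' where "x' i = (if i < m then q else x i)" for i
    have "joint [(Acc, J)] (0, ?st, x) (0, ?st, x')"
      unfolding joint_Acc_still[OF m le0 J'] using q(1) by (auto simp: x'_def)
    moreover have b: "bounded x'" using q(1) kind_step_less by (fastforce simp: bounded_def x'_def)
    have "(\<lambda>i. if i < m then 0 else x' i) = ?z" by (auto simp: fun_eq_iff x'_def)
    then have "joint [(Acc, \<lambda>_. Test)] (0, ?st, x') s"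
      unfolding joint_Acc_Test[OF b m] using q(2) by (auto simp: x'_def)
    ultimately show "joint ?A (0, ?st, x) s" unfolding joint_append by blast
  qed
  have BC: "joint (?B @ ?C) (q, ?st, ?z) s \<longleftrightarrow> s = (0, st @ unary q, x)" if "?P q" for q s
  proof -
    have "kind_step n E (J 0) 0 (x 0) q" using that m by blast
    then have qn: "q < n" using kind_step_less by blast
    then have z: "bounded ?z" by (auto simp: bounded_def)
    have rest: "(\<lambda>i. if i < m then x i else ?z i) = x" by auto
    have vx: "\<forall>i<m. x i < n" using x by (simp add: bounded_def)
    have B: "joint ?B (q, ?st, ?z) s \<longleftrightarrow> s = (q, st, x)" for s
      using joint_pop_all_Count[OF z order_refl, of q st x s] vx unfolding rest by simp
    have C1: "joint [(Mark, \<lambda>_. Hold)] (q, st, x) s \<longleftrightarrow> s = (q, st @ [2], x)" for s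
      by (rule joint_Mark_Hold) (use x m st qn in auto)
    have C2: "joint [(Dump, \<lambda>_. Keep)] (q, st @ [2], x) s \<longleftrightarrow> s = (0, (st @ [2]) @ replicate q 1, x)" for s
      by (rule joint_Dump_Keep) (use x m st qn in auto)
    show ?thesis
      unfolding joint_append_det[OF B] joint_append_det[OF C1] C2 by (simp add: unary_def)
  qed
  have "joint (collect J) (0, st, x) s \<longleftrightarrow> joint (?A @ (?B @ ?C)) (0, ?st, x) s"
    using joint_append_det[OF joint_push_all[OF x order_refl st], of "?A @ (?B @ ?C)" s]
    by (simp only: collect_def append_assoc)
  also have "\<dots> \<longleftrightarrow> (\<exists>q. ?P q \<and> joint (?B @ ?C) (q, ?st, ?z) s)"
    using A by (rule joint_append_ex)
  also have "\<dots> \<longleftrightarrow> (\<exists>q. ?P q \<and> s = (0, st @ unary q, x))" using BC by blast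
  finally show ?thesis .
qed

fun collect_all :: "(nat \<Rightarrow> nat \<Rightarrow> kind) \<Rightarrow> nat \<Rightarrow> protocol" where
  "collect_all J 0 = []"
| "collect_all J (Suc k) = collect_all J k @ collect (J k)"

lemma unaries_cong: "(\<And>i. i < k \<Longrightarrow> x i = y i) \<Longrightarrow> unaries k x = unaries k y"
  by (induction k) auto

lemma joint_collect_all:
  assumes x: "bounded x" and m: "m > 0" and st: "st \<noteq> []" and J: "\<And>j i. J j i \<in> {Jump, Hold}"
  shows "joint (collect_all J k) (0, st, x) s \<longleftrightarrow>
    (\<exists>q. (\<forall>j<k. \<forall>i<m. kind_step n E (J j i) 0 (x i) (q j)) \<and> s = (0, st @ unaries k q, x))"
proof (induction k arbitrary: s)
  case (Suc k)
  let ?P = "\<lambda>k q. \<forall>j<k. \<forall>i<m. kind_step n E (J j i) 0 (x i) (q j)"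
  have "joint (collect_all J (Suc k)) (0, st, x) s \<longleftrightarrow>
      (\<exists>q. ?P k q \<and> joint (collect (J k)) (0, st @ unaries k q, x) s)"
    unfolding collect_all.simps by (rule joint_append_ex) (rule Suc.IH)
  also have "\<dots> \<longleftrightarrow> (\<exists>q. ?P k q \<and>
      (\<exists>c. (\<forall>i<m. kind_step n E (J k i) 0 (x i) c) \<and> s = (0, (st @ unaries k q) @ unary c, x)))"
    using joint_collect[OF x m _ J] st by simp
  also have "\<dots> \<longleftrightarrow> (\<exists>q. ?P (Suc k) q \<and> s = (0, st @ unaries (Suc k) q, x))"
  proof
    assume "\<exists>q. ?P k q \<and> (\<exists>c. (\<forall>i<m. kind_step n E (J k i) 0 (x i) c) \<and> s = (0, (st @ unaries k q) @ unary c, x))"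
    then obtain q c where *: "?P k q" "\<forall>i<m. kind_step n E (J k i) 0 (x i) c" "s = (0, (st @ unaries k q) @ unary c, x)"
      by blast
    \<comment> \<open>The first \<open>k\<close> rounds leave \<open>q\<close> unconstrained from
      \<open>k\<close> on, so the new vertex can be stored there.\<close>
    have "?P (Suc k) (q(k := c))" using *(1,2) by (auto simp: less_Suc_eq)
    moreover have "unaries k (q(k := c)) = unaries k q" by (rule unaries_cong) auto
    ultimately show "\<exists>q. ?P (Suc k) q \<and> s = (0, st @ unaries (Suc k) q, x)"
      using *(3) by (intro exI[of _ "q(k := c)"]) simp
  next
    assume "\<exists>q. ?P (Suc k) q \<and> s = (0, st @ unaries (Suc k) q, x)"
    then show "\<exists>q. ?P k q \<and> (\<exists>c. (\<forall>i<m. kind_step n E (J k i) 0 (x i) c) \<and> s = (0, (st @ unaries k q) @ unary c, x))"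
      by (auto simp: less_Suc_eq)
  qed
  finally show ?case .
qed auto

text \<open>The new tuple is gathered completely on the stack before the old one is given up, since
  each new entry is tested against all old ones. \<open>Reset\<close> then makes room, because
  \<open>Count\<close> adds to the value held.\<close>

definition exchange :: "bool \<Rightarrow> protocol" where
  "exchange self = collect_all (\<lambda>j i. if self \<and> i = j then Hold else Jump) m @ [(Acc, \<lambda>_. Reset)] @ pop_all Count m"

text \<open>With \<open>self\<close>, the automata check that they hold a clique; without, they move on to vertices
  that are adjacent to all the old ones.\<close>

lemma joint_exchange:
  assumes x: "bounded x" and m: "m > 0" and st: "st \<noteq> []"
  shows "joint (exchange self) (0, st, x) s \<longleftrightarrow>
    (\<exists>q. (\<forall>j<m. q j < n \<and> (\<forall>i<m. if self \<and> i = j then q j = x i else (x i, q j) \<in> E)) \<and>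
      s = (0, st, \<lambda>i. if i < m then q i else x i))"
proof -
  let ?J = "\<lambda>j i. if self \<and> i = j then Hold else Jump"
  let ?z = "\<lambda>i. if i < m then 0 else x i"
  have A: "joint (collect_all ?J m) (0, st, x) s \<longleftrightarrow>
    (\<exists>q. (\<forall>j<m. \<forall>i<m. kind_step n E (?J j i) 0 (x i) (q j)) \<and> s = (0, st @ unaries m q, x))" for s
    by (rule joint_collect_all[OF x m st]) auto
  have P: "(\<forall>j<m. \<forall>i<m. kind_step n E (?J j i) 0 (x i) (q j)) \<longleftrightarrow>
     (\<forall>j<m. q j < n \<and> (\<forall>i<m. if self \<and> i = j then q j = x i else (x i, q j) \<in> E))" for q
  proof -
    have "(\<forall>i<m. kind_step n E (?J j i) 0 (x i) (q j)) \<longleftrightarrow>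
       q j < n \<and> (\<forall>i<m. if self \<and> i = j then q j = x i else (x i, q j) \<in> E)" for j
      using m x by (auto simp: bounded_def split: if_splits)
    then show ?thesis by simp
  qed
  have "0 < n" using x m by (auto simp: bounded_def)
  then have z: "bounded ?z" by (simp add: bounded_def)
  have R: "joint [(Acc, \<lambda>_. Reset)] (0, st', x) s \<longleftrightarrow> s = (0, st', ?z)" for st' s
  proof -
    have "(\<forall>i<m. kind_step n E Reset 0 (x i) (x' i)) \<and> (\<forall>i\<ge>m. x' i = x i) \<longleftrightarrow> x' = ?z" for x'
      using x by (auto simp: fun_eq_iff bounded_def)
    with joint_Acc_still[OF m le0, of "\<lambda>_. Reset" st' x s] show ?thesis by auto
  qed
  have B: "joint ([(Acc, \<lambda>_. Reset)] @ pop_all Count m) (0, st @ unaries m q, x) s \<longleftrightarrow>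
      s = (0, st, \<lambda>i. if i < m then q i else x i)" if "\<forall>j<m. q j < n" for q s
  proof -
    have "(\<lambda>i. if i < m then q i else ?z i) = (\<lambda>i. if i < m then q i else x i)" by auto
    with joint_pop_all_Count[OF z order_refl, of 0 st q s] that show ?thesis
      unfolding joint_append_det[OF R] by simp
  qed
  have "joint (exchange self) (0, st, x) s \<longleftrightarrow> (\<exists>q. (\<forall>j<m. \<forall>i<m. kind_step n E (?J j i) 0 (x i) (q j)) \<and>
      joint ([(Acc, \<lambda>_. Reset)] @ pop_all Count m) (0, st @ unaries m q, x) s)"
    unfolding exchange_def by (rule joint_append_ex) (rule A)
  also have "\<dots> \<longleftrightarrow> (\<exists>q. (\<forall>j<m. q j < n \<and> (\<forall>i<m. if self \<and> i = j then q j = x i else (x i, q j) \<in> E)) \<and>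
      s = (0, st, \<lambda>i. if i < m then q i else x i))"
    unfolding P using B by blast
  finally show ?thesis .
qed

section \<open>The whole protocol, and cliques as triples of tuples\<close>

definition clique_tuple :: "(nat \<Rightarrow> nat) \<Rightarrow> bool" where
  "clique_tuple p \<longleftrightarrow> (\<forall>i<m. \<forall>j<m. i \<noteq> j \<longrightarrow> (p i, p j) \<in> E)"

definition joined :: "(nat \<Rightarrow> nat) \<Rightarrow> (nat \<Rightarrow> nat) \<Rightarrow> bool" where
  "joined p q \<longleftrightarrow> (\<forall>i<m. \<forall>j<m. (p i, q j) \<in> E)"

text \<open>With \<open>Hold\<close> on the diagonal the collected tuple must be \<open>x\<close>
  itself, so the first exchange only tests \<open>clique_tuple\<close>; the second moves on to a
  joined tuple.\<close>

lemma joint_exchange_twice: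
  assumes x: "bounded x" and m: "m > 0" and st: "st \<noteq> []" and x0: "\<forall>i\<ge>m. x i = 0"
  shows "joint (exchange True @ exchange False) (0, st, x) s \<longleftrightarrow>
    (\<exists>q. (clique_tuple x \<and> joined x q \<and> bounded q \<and> (\<forall>i\<ge>m. q i = 0)) \<and> s = (0, st, q))"
proof -
  have T: "joint (exchange True) (0, st, x) s \<longleftrightarrow> clique_tuple x \<and> s = (0, st, x)" for s
  proof
    assume "joint (exchange True) (0, st, x) s"
    then obtain q where q: "\<forall>j<m. q j < n \<and> (\<forall>i<m. if True \<and> i = j then q j = x i else (x i, q j) \<in> E)"
      "s = (0, st, \<lambda>i. if i < m then q i else x i)" unfolding joint_exchange[OF x m st] by blast
    then have *: "\<forall>j<m. q j = x j" by auto
    then have "(\<lambda>i. if i < m then q i else x i) = x" by auto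
    moreover have "clique_tuple x" unfolding clique_tuple_def using q(1) * by metis
    ultimately show "clique_tuple x \<and> s = (0, st, x)" using q(2) by simp
  next
    assume *: "clique_tuple x \<and> s = (0, st, x)"
    moreover have "(\<lambda>i. if i < m then x i else x i) = x" by auto
    ultimately show "joint (exchange True) (0, st, x) s" unfolding joint_exchange[OF x m st]
      using x by (intro exI[of _ x]) (auto simp: clique_tuple_def bounded_def)
  qed
  have F: "joint (exchange False) (0, st, x) s \<longleftrightarrow>
      (\<exists>q. (joined x q \<and> bounded q \<and> (\<forall>i\<ge>m. q i = 0)) \<and> s = (0, st, q))" for s
  proof
    assume "joint (exchange False) (0, st, x) s"
    then obtain q where q: "\<forall>j<m. q j < n \<and> (\<forall>i<m. (x i, q j) \<in> E)"
      "s = (0, st, \<lambda>i. if i < m then q i else x i)" unfolding joint_exchange[OF x m st] by auto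
    then show "\<exists>q. (joined x q \<and> bounded q \<and> (\<forall>i\<ge>m. q i = 0)) \<and> s = (0, st, q)"
      using x0 by (intro exI[of _ "\<lambda>i. if i < m then q i else x i"]) (auto simp: joined_def bounded_def)
  next
    assume "\<exists>q. (joined x q \<and> bounded q \<and> (\<forall>i\<ge>m. q i = 0)) \<and> s = (0, st, q)"
    then obtain q where q: "joined x q" "bounded q" "\<forall>i\<ge>m. q i = 0" "s = (0, st, q)" by blast
    have "(\<lambda>i. if i < m then q i else x i) = q" using q(3) x0 by auto
    then show "joint (exchange False) (0, st, x) s" unfolding joint_exchange[OF x m st]
      using q by (intro exI[of _ q]) (auto simp: joined_def bounded_def)
  qed
  show ?thesis unfolding joint_append T using F by blast
qed

definition protocol :: protocol where
  "protocol = [(Acc, \<lambda>_. Guess)] @ push_all m @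
     (exchange True @ exchange False) @ (exchange True @ exchange False) @ (exchange True @ exchange False) @
     pop_all Test m"

lemma joint_protocol:
  assumes m: "m > 0" and n: "n > 0"
  shows "(\<exists>x'. joint protocol (0, [0], \<lambda>_. 0) (0, [0], x')) \<longleftrightarrow>
    (\<exists>p q r. bounded p \<and> bounded q \<and> bounded r \<and> clique_tuple p \<and> clique_tuple q \<and> clique_tuple r \<and>
       joined p q \<and> joined q r \<and> joined r p)" (is "?L \<longleftrightarrow> ?R")
proof -
  let ?X = "exchange True @ exchange False"
  \<comment> \<open>The joint run starts with the zero function, so tuples stay 0 from
    \<open>m\<close> on. Agreement below \<open>m\<close>, which is all that the final
    \<open>Test\<close> checks, then is equality of functions.\<close>
  let ?ok = "\<lambda>x. bounded x \<and> (\<forall>i\<ge>m. x i = 0)"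
  have z: "bounded (\<lambda>_. 0)" using n by (simp add: bounded_def)
  have G: "joint [(Acc, \<lambda>_. Guess)] (0, [0], \<lambda>_. 0) s \<longleftrightarrow> (\<exists>p. ?ok p \<and> s = (0, [0], p))" for s
  proof -
    have "joint [(Acc, \<lambda>_. Guess)] (0, [0], \<lambda>_. 0) s \<longleftrightarrow>
        (\<exists>p. (\<forall>i<m. kind_step n E Guess 0 0 (p i)) \<and> (\<forall>i\<ge>m. p i = 0) \<and> s = (0, [0], p))"
      by (rule joint_Acc_still[OF m le0]) simp
    then show ?thesis using n by (simp add: bounded_def)
  qed
  have X: "joint ?X (0, [0] @ unaries m p, x) s \<longleftrightarrow> (\<exists>q. (clique_tuple x \<and> joined x q \<and> ?ok q) \<and> s = (0, [0] @ unaries m p, q))"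
    if "?ok x" for x p s
    by (rule joint_exchange_twice) (use that m in auto)
  have P: "joint (push_all m) (0, [0], p) s \<longleftrightarrow> s = (0, [0] @ unaries m p, p)" if "?ok p" for p s
    by (rule joint_push_all) (use that in auto)
  have C: "(\<exists>x'. joint (pop_all Test m) (0, [0] @ unaries m p, x) (0, [0], x')) \<longleftrightarrow> x = p"
    if "?ok x" "?ok p" for x p
  proof -
    have "(\<forall>i<m. p i = x i) \<longleftrightarrow> x = p"
    proof
      assume *: "\<forall>i<m. p i = x i"
      show "x = p"
      proof
        fix i show "x i = p i" using * that by (cases "i < m") auto
      qed
    qed auto
    then show ?thesis using joint_pop_all_Test[of x m 0 "[0]" p] that by auto
  qed
  have "?L \<longleftrightarrow> (\<exists>p. ?ok p \<and> (\<exists>q. (clique_tuple p \<and> joined p q \<and> ?ok q) \<and>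
     (\<exists>r. (clique_tuple q \<and> joined q r \<and> ?ok r) \<and>
     (\<exists>p'. (clique_tuple r \<and> joined r p' \<and> ?ok p') \<and>
     (\<exists>x'. joint (pop_all Test m) (0, [0] @ unaries m p, p') (0, [0], x'))))))" (is "_ \<longleftrightarrow> ?M")
  proof
    assume ?L
    then obtain x' where "joint protocol (0, [0], \<lambda>_. 0) (0, [0], x')" by (rule exE)
    then have "\<exists>p. ?ok p \<and> joint (push_all m @ ?X @ ?X @ ?X @ pop_all Test m) (0, [0], p) (0, [0], x')"
      unfolding protocol_def joint_append_ex[OF G] .
    then obtain p where p1: "?ok p"
      and p2: "joint (push_all m @ ?X @ ?X @ ?X @ pop_all Test m) (0, [0], p) (0, [0], x')" by (elim exE conjE) blast
    note p = p1 p2[unfolded joint_append_det[OF P[OF p1]]]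
    let ?st = "[0] @ unaries m p"
    obtain q where q: "clique_tuple p \<and> joined p q \<and> ?ok q" "joint (?X @ ?X @ pop_all Test m) (0, ?st, q) (0, [0], x')"
      using p(2) unfolding joint_append_ex[OF X[OF p(1)]] by blast
    obtain r where r: "clique_tuple q \<and> joined q r \<and> ?ok r" "joint (?X @ pop_all Test m) (0, ?st, r) (0, [0], x')"
      using q unfolding joint_append_ex[OF X[OF q(1)[THEN conjunct2, THEN conjunct2]]] by blast
    obtain p' where "clique_tuple r \<and> joined r p' \<and> ?ok p'" "joint (pop_all Test m) (0, ?st, p') (0, [0], x')"
      using r unfolding joint_append_ex[OF X[OF r(1)[THEN conjunct2, THEN conjunct2]]] by blast
    with p(1) q(1) r(1) show ?M by blast
  next
    assume ?M
    then obtain p q r p' x' where p: "?ok p" and q: "clique_tuple p \<and> joined p q \<and> ?ok q"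
      and r: "clique_tuple q \<and> joined q r \<and> ?ok r" and p': "clique_tuple r \<and> joined r p' \<and> ?ok p'"
      and x': "joint (pop_all Test m) (0, [0] @ unaries m p, p') (0, [0], x')" by blast
    let ?st = "[0] @ unaries m p"
    have "joint (?X @ pop_all Test m) (0, ?st, r) (0, [0], x')"
      unfolding joint_append_ex[OF X[OF r[THEN conjunct2, THEN conjunct2]]] using p' x' by blast
    then have "joint (?X @ ?X @ pop_all Test m) (0, ?st, q) (0, [0], x')"
      unfolding joint_append_ex[OF X[OF q[THEN conjunct2, THEN conjunct2]]] using r by blast
    then have "joint (?X @ ?X @ ?X @ pop_all Test m) (0, ?st, p) (0, [0], x')"
      unfolding joint_append_ex[OF X[OF p]] using q by blast
    then have "joint (push_all m @ ?X @ ?X @ ?X @ pop_all Test m) (0, [0], p) (0, [0], x')"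
      unfolding joint_append_det[OF P[OF p]] .
    then show ?L unfolding protocol_def joint_append_ex[OF G] using p by blast
  qed
  also have "?M \<longleftrightarrow> (\<exists>p. ?ok p \<and> (\<exists>q. (clique_tuple p \<and> joined p q \<and> ?ok q) \<and>
     (\<exists>r. (clique_tuple q \<and> joined q r \<and> ?ok r) \<and> clique_tuple r \<and> joined r p)))" (is "_ \<longleftrightarrow> ?N")
  proof
    assume ?M
    then obtain p q r p' where p: "?ok p" "clique_tuple p \<and> joined p q \<and> ?ok q" "clique_tuple q \<and> joined q r \<and> ?ok r"
      and p': "clique_tuple r \<and> joined r p' \<and> ?ok p'"
      and x': "\<exists>x'. joint (pop_all Test m) (0, [0] @ unaries m p, p') (0, [0], x')"
      by (elim exE conjE) blast
    have "p' = p" using C[OF p'[THEN conjunct2, THEN conjunct2] p(1)] x' by (rule iffD1)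
    with p p' show ?N by blast
  next
    assume ?N
    then obtain p q r where p: "?ok p" "clique_tuple p \<and> joined p q \<and> ?ok q" "clique_tuple q \<and> joined q r \<and> ?ok r"
      and r: "clique_tuple r" "joined r p" by (elim exE conjE) blast
    have "\<exists>x'. joint (pop_all Test m) (0, [0] @ unaries m p, p) (0, [0], x')"
      using C[OF p(1) p(1)] refl by (rule iffD2)
    with p r show ?M by blast
  qed
  also have "\<dots> \<longleftrightarrow> ?R"
  proof
    assume ?R
    then obtain p q r where *: "bounded p" "bounded q" "bounded r" "clique_tuple p" "clique_tuple q" "clique_tuple r"
       "joined p q" "joined q r" "joined r p" by blast
    \<comment> \<open>Arbitrary tuples are cut off at \<open>m\<close> to satisfy
      \<open>?ok\<close>; all conditions look only at entries below \<open>m\<close>.\<close>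
    define cut :: "(nat \<Rightarrow> nat) \<Rightarrow> nat \<Rightarrow> nat" where "cut f i = (if i < m then f i else 0)" for f i
    have "?ok (cut p)" "?ok (cut q)" "?ok (cut r)" "clique_tuple (cut p)" "clique_tuple (cut q)" "clique_tuple (cut r)"
       "joined (cut p) (cut q)" "joined (cut q) (cut r)" "joined (cut r) (cut p)"
      using * by (auto simp: cut_def bounded_def clique_tuple_def joined_def)
    then show "\<exists>p. ?ok p \<and> (\<exists>q. (clique_tuple p \<and> joined p q \<and> ?ok q) \<and>
     (\<exists>r. (clique_tuple q \<and> joined q r \<and> ?ok r) \<and> clique_tuple r \<and> joined r p))" by blast
  qed blast
  finally show ?thesis .
qed

text \<open>Irreflexivity makes the entries of a clique tuple distinct and joined tuples disjoint,
  so the triple comprises \<open>3 * m\<close> vertices. \<open>joined\<close> only looks one way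
  around the cycle \<open>p\<close>, \<open>q\<close>, \<open>r\<close>; symmetry of
  \<open>E\<close> supplies the other direction.\<close>

lemma has_clique_iff_tuples:
  assumes "simple_graph n E"
  shows "has_clique (3 * m) n E \<longleftrightarrow>
    (\<exists>p q r. bounded p \<and> bounded q \<and> bounded r \<and> clique_tuple p \<and> clique_tuple q \<and> clique_tuple r \<and>
       joined p q \<and> joined q r \<and> joined r p)"
proof
  assume "has_clique (3 * m) n E"
  then obtain S where S: "S \<subseteq> {..<n}" "card S = 3 * m" "\<forall>u\<in>S. \<forall>v\<in>S. u \<noteq> v \<longrightarrow> (u, v) \<in> E"
    by (auto simp: has_clique_def)
  have "finite S" using S(1) finite_subset by blast
  then obtain h where h: "bij_betw h {0..<3 * m} S"
    using ex_bij_betw_nat_finite[of S] S(2) by auto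
  have hS: "h i \<in> S" if "i < 3 * m" for i
    by (rule bij_betw_apply[OF h]) (use that in simp)
  have hn: "h i < n" if "i < 3 * m" for i
    using hS[OF that] S(1) by blast
  have hE: "(h i, h j) \<in> E" if "i < 3 * m" "j < 3 * m" "i \<noteq> j" for i j
  proof -
    have "h i \<noteq> h j" using inj_onD[OF bij_betw_imp_inj_on[OF h], of i j] that by auto
    then show ?thesis using hS[OF that(1)] hS[OF that(2)] S(3) by blast
  qed
  show "\<exists>p q r. bounded p \<and> bounded q \<and> bounded r \<and> clique_tuple p \<and> clique_tuple q \<and> clique_tuple r \<and>
       joined p q \<and> joined q r \<and> joined r p"
    by (intro exI[of _ h] exI[of _ "\<lambda>i. h (m + i)"] exI[of _ "\<lambda>i. h (2 * m + i)"])
      (auto simp: bounded_def clique_tuple_def joined_def intro!: hn hE)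
next
  assume "\<exists>p q r. bounded p \<and> bounded q \<and> bounded r \<and> clique_tuple p \<and> clique_tuple q \<and> clique_tuple r \<and>
       joined p q \<and> joined q r \<and> joined r p"
  then obtain p q r where *: "bounded p" "bounded q" "bounded r" "clique_tuple p" "clique_tuple q" "clique_tuple r"
    "joined p q" "joined q r" "joined r p" by blast
  have irr: "(u, u) \<notin> E" for u using assms by (auto simp: simple_graph_def irrefl_def)
  have sy: "(u, v) \<in> E \<Longrightarrow> (v, u) \<in> E" for u v using assms by (auto simp: simple_graph_def dest: symD)
  have inj: "inj_on f {..<m}" if "clique_tuple f" for f
    unfolding inj_on_def using that irr by (metis clique_tuple_def lessThan_iff)
  have disj: "f ` {..<m} \<inter> g ` {..<m} = {}" if "joined f g" for f g
    using that irr by (auto simp: joined_def) metis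
  let ?S = "p ` {..<m} \<union> q ` {..<m} \<union> r ` {..<m}"
  have "card ?S = card (p ` {..<m} \<union> q ` {..<m}) + card (r ` {..<m})"
    by (rule card_Un_disjoint) (use disj[OF *(8)] disj[OF *(9)] in auto)
  also have "card (p ` {..<m} \<union> q ` {..<m}) = card (p ` {..<m}) + card (q ` {..<m})"
    by (rule card_Un_disjoint) (use disj[OF *(7)] in auto)
  finally have "card ?S = 3 * m"
    using inj *(4-6) by (simp add: card_image)
  moreover have "?S \<subseteq> {..<n}" using *(1-3) by (auto simp: bounded_def)
  moreover have "(u, v) \<in> E" if "u \<in> ?S" "v \<in> ?S" "u \<noteq> v" for u v
  proof -
    have c: "(f i, f j) \<in> E" if "clique_tuple f" "i < m" "j < m" "f i \<noteq> f j" for f i j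
      using that by (metis clique_tuple_def)
    have j: "(f i, g j) \<in> E" "(g j, f i) \<in> E" if "joined f g" "i < m" "j < m" for f g i j
      using that sy by (auto simp: joined_def)
    show ?thesis
      using that by (elim UnE imageE) (simp_all add: c[OF *(4)] c[OF *(5)] c[OF *(6)] j[OF *(7)] j[OF *(8)] j[OF *(9)])
  qed
  ultimately show "has_clique (3 * m) n E" unfolding has_clique_def by (intro exI[of _ ?S] conjI ballI impI)
qed

end


section \<open>Writing down the machines\<close>

fun emits :: "expr list \<Rightarrow> gen" where
  "emits [] = Skip"
| "emits (e # es) = Then (Emit e) (emits es)"

fun seqs :: "gen list \<Rightarrow> gen" where
  "seqs [] = Skip"
| "seqs (g # gs) = Then g (seqs gs)"

lemma out_emits [simp]: "out n k \<rho> (emits es) = map (\<lambda>e. Val (val n \<rho> e)) es"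
  by (induction es) auto

lemma out_seqs [simp]: "out n k \<rho> (seqs gs) = concat (map (out n k \<rho>) gs)"
  by (induction gs) auto

lemma gen_ok_emits [simp]: "gen_ok k (emits es) \<longleftrightarrow> (\<forall>e\<in>set es. eidx e \<le> k)"
  by (induction es) auto

lemma gen_ok_seqs [simp]: "gen_ok k (seqs gs) \<longleftrightarrow> (\<forall>g\<in>set gs. gen_ok k g)"
  by (induction gs) auto

lemma nest_emits [simp]: "nest (emits es) = 0"
  by (induction es) auto

lemma nest_seqs: "nest (seqs gs) \<le> d \<longleftrightarrow> (\<forall>g\<in>set gs. nest g \<le> d)"
  by (induction gs) auto

text \<open>The generator has no conditionals; truncated subtraction replaces them.
  \<open>1 - e\<close> is 1 exactly for \<open>e = 0\<close>, and subtracting it from 1 negates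
  this.\<close>

definition sign :: "expr \<Rightarrow> expr" where
  "sign e = Diff (Lit 1) (Diff (Lit 1) e)"

definition select :: "expr \<Rightarrow> nat \<Rightarrow> nat \<Rightarrow> expr" where
  "select e a b = Sum (Prod (Lit a) (sign e)) (Prod (Lit b) (Diff (Lit 1) e))"

definition differ :: "expr \<Rightarrow> expr \<Rightarrow> expr" where
  "differ a b = sign (Sum (Diff a b) (Diff b a))"

lemma val_sign [simp]: "val n \<rho> (sign e) = of_bool (val n \<rho> e > 0)"
  by (auto simp: sign_def)

lemma val_select [simp]: "val n \<rho> (select e a b) = (if val n \<rho> e > 0 then a else b)"
  by (auto simp: select_def)

lemma val_differ [simp]: "val n \<rho> (differ a b) = of_bool (val n \<rho> a \<noteq> val n \<rho> b)"
  by (auto simp: differ_def)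

lemma eidx_sign [simp]: "eidx (sign e) = eidx e"
  and eidx_select [simp]: "eidx (select e x y) = eidx e"
  and eidx_differ [simp]: "eidx (differ a b) = max (eidx a) (eidx b)"
  by (auto simp: sign_def select_def differ_def)

text \<open>Conditions on letter and top symbol are decided when the generator is built; only those
  on the state, which varies with the loop, become arithmetic.\<close>

definition delta_exprs :: "expr \<Rightarrow> nat \<Rightarrow> nat \<Rightarrow> expr \<times> expr list" where
  "delta_exprs p a \<alpha> =
     (if a = 0 then (Sum p (sign (Diff Size p)), [select (Diff Size p) \<alpha> 3])
      else if a = 1 then (Diff p (Lit 1), [select p \<alpha> 3, select p 1 3])
      else if a = 2 then (p, if \<alpha> = 1 then [] else [Lit 3])
      else if a = 3 then (p, [Lit \<alpha>])
      else if a = 4 then (p, [Lit \<alpha>, Lit 2])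
      else if a = 5 then (p, [select p 3 \<alpha>])
      else (p, if \<alpha> = 2 then [] else [Lit 3]))"

lemma delta_exprs:
  "delta n (val n \<rho> p) a \<alpha> = (val n \<rho> (fst (delta_exprs p a \<alpha>)), map (val n \<rho>) (snd (delta_exprs p a \<alpha>)))"
  by (auto simp: delta_def delta_exprs_def)

definition move_gen :: "expr \<Rightarrow> nat \<Rightarrow> nat \<Rightarrow> gen" where
  "move_gen p a \<alpha> = emits ([p, Lit (Suc a), Lit \<alpha>, fst (delta_exprs p a \<alpha>),
     Lit (length (snd (delta_exprs p a \<alpha>)))] @ snd (delta_exprs p a \<alpha>))"

definition state_gen :: "expr \<Rightarrow> gen" where
  "state_gen p = seqs (concat (map (\<lambda>a. map (\<lambda>\<alpha>. move_gen p a \<alpha>) [0..<4]) [0..<7]))"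

text \<open>The factor 28 is the 7 letters times the 4 stack symbols: each state has one transition
  for each of them.\<close>

definition pda_gen :: gen where
  "pda_gen = seqs [emits [Sum Size (Lit 1), Lit 0, Lit 1, Lit 0, Prod (Lit 28) (Sum Size (Lit 1))],
     For (state_gen (Idx 0)), state_gen Size]"

lemma out_move_gen:
  "map (cell_val f) (out n k \<rho> (move_gen p a \<alpha>)) =
     transition_code (val n \<rho> p, Some a, \<alpha>, delta n (val n \<rho> p) a \<alpha>)"
  by (simp add: move_gen_def delta_exprs o_def)

lemma out_state_gen:
  "map (cell_val f) (out n k \<rho> (state_gen p)) = concat (map transition_code (state_transitions n (val n \<rho> p)))"
proof -
  have *: "map (cell_val f) (concat (map (out n k \<rho>) (concat (map (\<lambda>a. map (\<lambda>\<alpha>. move_gen p a \<alpha>) ys) xs)))) =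
      concat (map transition_code (concat (map (\<lambda>a. map (\<lambda>\<alpha>. (val n \<rho> p, Some a, \<alpha>, delta n (val n \<rho> p) a \<alpha>)) ys) xs)))"
    for xs ys
  proof (induction xs)
    case (Cons a xs)
    have "map (cell_val f) (concat (map (out n k \<rho>) (map (\<lambda>\<alpha>. move_gen p a \<alpha>) ys))) =
        concat (map transition_code (map (\<lambda>\<alpha>. (val n \<rho> p, Some a, \<alpha>, delta n (val n \<rho> p) a \<alpha>)) ys))"
      by (induction ys) (simp_all only: list.map concat.simps map_append out_move_gen)
    with Cons show ?case by (simp only: list.map concat.simps concat_append map_append)
  qed simp
  show ?thesis unfolding state_gen_def out_seqs state_transitions_def by (rule *)
qed

lemma distinct_concat_map:
  assumes "distinct xs" "\<And>x. x \<in> set xs \<Longrightarrow> distinct (f x)"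
    "\<And>x y. x \<in> set xs \<Longrightarrow> y \<in> set xs \<Longrightarrow> x \<noteq> y \<Longrightarrow> set (f x) \<inter> set (f y) = {}"
  shows "distinct (concat (map f xs))"
  using assms
proof (induction xs)
  case (Cons x xs)
  have "set (f x) \<inter> set (f y) = {}" if "y \<in> set xs" for y
    by (rule Cons.prems(3)) (use that Cons.prems(1) in auto)
  moreover have "distinct (concat (map f xs))"
    by (rule Cons.IH) (use Cons.prems in auto)
  ultimately show ?case using Cons.prems(2)[of x] by auto
qed simp

lemma length_concat_const: "(\<And>x. x \<in> set xs \<Longrightarrow> length (f x) = c) \<Longrightarrow> length (concat (map f xs)) = length xs * c"
  by (induction xs) auto

lemma distinct_state_transitions: "distinct (state_transitions n p)"
  unfolding state_transitions_def
proof (rule distinct_concat_map)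
  show "distinct (map (\<lambda>\<alpha>. (p, Some a, \<alpha>, delta n p a \<alpha>)) [0..<4])" for a
    by (simp add: distinct_map inj_on_def del: upt_rec_numeral)
qed auto

lemma set_state_transitions: "t \<in> set (state_transitions n p) \<Longrightarrow> fst t = p"
  by (auto simp: state_transitions_def)

lemma length_state_transitions: "length (state_transitions n p) = 28"
  unfolding state_transitions_def by (subst length_concat_const[where c = 4]) auto

lemma distinct_counter_transitions: "distinct (counter_transitions n)"
proof -
  have "distinct (concat (map (state_transitions n) [0..<n]))"
    by (rule distinct_concat_map) (auto simp: distinct_state_transitions dest!: set_state_transitions)
  then show ?thesis unfolding counter_transitions_def
    by (auto simp: distinct_state_transitions dest!: set_state_transitions)
qed

lemma length_counter_transitions: "length (counter_transitions n) = 28 * (n + 1)"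
  by (simp add: counter_transitions_def length_concat_const[where c = 28] length_state_transitions)

lemma codes_counter_pda: "codes_machine (map (cell_val f) (out n 0 \<rho> pda_gen)) (counter_pda n)"
proof -
  have "map (cell_val f) (out n 0 \<rho> (For (state_gen (Idx 0)))) =
      concat (map transition_code (concat (map (state_transitions n) [0..<n])))"
  proof -
    have "map (cell_val f) (concat (map (\<lambda>v. out n (Suc 0) (\<rho>(0 := v)) (state_gen (Idx 0))) xs)) =
      concat (map transition_code (concat (map (state_transitions n) xs)))" for xs
      by (induction xs) (simp_all add: out_state_gen)
    then show ?thesis by simp
  qed
  then have "map (cell_val f) (out n 0 \<rho> pda_gen) =
      [n + 1, 0, 1] @ [0] @ [28 * (n + 1)] @ concat (map transition_code (counter_transitions n))"
    by (simp add: pda_gen_def out_state_gen counter_transitions_def del: out.simps(5))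
  then show ?thesis unfolding codes_machine_def
    by (intro exI[of _ "[0]"] exI[of _ "counter_transitions n"])
      (simp add: distinct_counter_transitions length_counter_transitions counter_pda_def)
qed

section \<open>Code of the finite automata\<close>

fun step_gen :: "kind \<Rightarrow> gen" where
  "step_gen Keep = Emit (differ (Idx 0) (Idx 1))"
| "step_gen Test = Emit (differ (Idx 0) (Sum (Idx 1) (Lit 1)))"
| "step_gen Count = Emit (differ (Sum (Idx 0) (Lit 1)) (Idx 1))"
| "step_gen _ = Emit (Lit 1)"

text \<open>Only \<open>Jump\<close> consults the input: behind the leading word \<open>n\<close>,
  the adjacency bit of \<open>u\<close> and \<open>v\<close> is at position
  \<open>u * n + v + 1\<close>. It is negated since the symbol 0 marks an enabled
  transition.\<close>

fun end_gen :: "kind \<Rightarrow> gen" where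
  "end_gen Test = Emit (sign (Sum (Idx 0) (Idx 1)))"
| "end_gen Jump = Emit_neg (Sum (Sum (Prod (Idx 0) Size) (Idx 1)) (Lit 1))"
| "end_gen Guess = Emit (Lit 0)"
| "end_gen Reset = Emit (sign (Idx 1))"
| "end_gen _ = Emit (differ (Idx 0) (Idx 1))"

lemma out_step_gen:
  "map (cell_val f) (out n k \<rho> (step_gen kd)) = [of_bool (\<not> step_rel kd (\<rho> 0) (\<rho> 1))]"
  by (cases kd) auto

lemma out_end_gen:
  assumes "\<rho> 0 < n" "\<rho> 1 < n"
  shows "map (cell_val (input_cell (graph_code n E))) (out n k \<rho> (end_gen kd)) = [of_bool (\<not> end_rel E kd (\<rho> 0) (\<rho> 1))]"
  using input_cell_graph_code[OF assms, of E] by (cases kd) auto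

text \<open>Each symbol is generated twice, once as the top symbol read and once as the word pushed;
  the \<open>Lit 1\<close> before the second occurrence is the length of that word.\<close>

definition pair_gen :: "nat \<Rightarrow> action \<Rightarrow> kind \<Rightarrow> gen" where
  "pair_gen l a kd = seqs
     [emits [Sum (Prod (Lit l) Size) (Idx 0), Lit (Suc (step_letter a))], step_gen kd,
      emits [Sum (Prod (Lit l) Size) (Idx 1), Lit 1], step_gen kd,
      emits [Sum (Prod (Lit l) Size) (Idx 0), Lit (Suc (end_letter a))], end_gen kd,
      emits [Sum (Prod (Lit (Suc l)) Size) (Idx 1), Lit 1], end_gen kd]"

lemma out_pair_gen:
  assumes "\<rho> 0 = u" "\<rho> (Suc 0) = v" "u < n" "v < n"
  shows "map (cell_val (input_cell (graph_code n E))) (out n k \<rho> (pair_gen l a kd)) =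
    concat (map transition_code (pair_transitions n E l a kd u v))"
proof -
  have "\<rho> 0 < n" "\<rho> 1 < n" using assms by auto
  then show ?thesis
    by (simp add: pair_gen_def pair_transitions_def out_step_gen out_end_gen assms(1,2))
qed

definition tracker_gen :: "(action \<times> kind) list \<Rightarrow> gen" where
  "tracker_gen aks = seqs
     ([emits [Sum (Prod (Lit (length aks + 1)) Size) (Lit 1), Lit 0, Size],
       For (Emit (Sum (Prod (Lit (length aks)) Size) (Idx 0))),
       Emit (Prod (Lit (2 * length aks)) (Prod Size Size))] @
      map (\<lambda>l. For (For (pair_gen l (fst (aks ! l)) (snd (aks ! l))))) [0..<length aks])"

lemma out_layer:
  "map (cell_val (input_cell (graph_code n E))) (out n 0 \<rho> (For (For (pair_gen l (fst ak) (snd ak))))) =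
    concat (map transition_code (layer_transitions n E l ak))"
proof -
  let ?c = "map (cell_val (input_cell (graph_code n E)))"
  have 1: "?c (concat (map (\<lambda>v. out n (Suc (Suc 0)) (\<rho>(Suc 0 := v)) (pair_gen l (fst ak) (snd ak))) xs)) =
      concat (map transition_code (concat (map (\<lambda>v. pair_transitions n E l (fst ak) (snd ak) (\<rho> 0) v) xs)))"
    if "\<rho> 0 < n" "set xs \<subseteq> {..<n}" for xs \<rho>
    using that(2)
  proof (induction xs)
    case (Cons v xs)
    have "?c (out n (Suc (Suc 0)) (\<rho>(Suc 0 := v)) (pair_gen l (fst ak) (snd ak))) =
        concat (map transition_code (pair_transitions n E l (fst ak) (snd ak) (\<rho> 0) v))"
      by (rule out_pair_gen) (use that(1) Cons.prems in auto)
    moreover have "set xs \<subseteq> {..<n}" using Cons.prems by simp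
    ultimately show ?case using Cons.IH by (simp only: list.map concat.simps map_append concat_append)
  qed simp
  have 2: "?c (concat (map (\<lambda>u. out n (Suc 0) (\<rho>(0 := u)) (For (pair_gen l (fst ak) (snd ak)))) xs)) =
      concat (map transition_code (concat (map (\<lambda>u. concat (map (\<lambda>v. pair_transitions n E l (fst ak) (snd ak) u v) [0..<n])) xs)))"
    if "set xs \<subseteq> {..<n}" for xs
    using that
  proof (induction xs)
    case (Cons u xs)
    have "?c (out n (Suc 0) (\<rho>(0 := u)) (For (pair_gen l (fst ak) (snd ak)))) =
        concat (map transition_code (concat (map (\<lambda>v. pair_transitions n E l (fst ak) (snd ak) u v) [0..<n])))"
      unfolding out.simps(5) by (rule 1[of "\<rho>(0 := u)" "[0..<n]", unfolded fun_upd_same]) (use Cons.prems in auto)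
    moreover have "set xs \<subseteq> {..<n}" using Cons.prems by simp
    ultimately show ?case using Cons.IH by (simp only: list.map concat.simps map_append concat_append)
  qed simp
  show ?thesis unfolding out.simps(5)[of n 0] layer_transitions_def by (rule 2) auto
qed

lemma distinct_layer_transitions: "distinct (layer_transitions n E l ak)"
  unfolding layer_transitions_def
proof (rule distinct_concat_map)
  show "distinct (concat (map (\<lambda>v. pair_transitions n E l (fst ak) (snd ak) u v) [0..<n]))" for u
  proof (rule distinct_concat_map)
    show "distinct (pair_transitions n E l (fst ak) (snd ak) u v)" for v
      by (auto simp: pair_transitions_def letters_distinct)
    show "set (pair_transitions n E l (fst ak) (snd ak) u v) \<inter> set (pair_transitions n E l (fst ak) (snd ak) u v') = {}"
      if "v \<noteq> v'" for v v'
      using that by (auto simp: pair_transitions_def letters_distinct letters_distinct[symmetric])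
  qed auto
  have F: "fst t = l * n + u"
    if "t \<in> set (concat (map (\<lambda>v. pair_transitions n E l (fst ak) (snd ak) u v) [0..<n]))" for t u
    using that by (auto simp: pair_transitions_def)
  show "set (concat (map (\<lambda>v. pair_transitions n E l (fst ak) (snd ak) u v) [0..<n])) \<inter>
     set (concat (map (\<lambda>v. pair_transitions n E l (fst ak) (snd ak) u' v) [0..<n])) = {}" if "u \<noteq> u'" for u u'
  proof (rule equals0I)
    fix t assume "t \<in> set (concat (map (\<lambda>v. pair_transitions n E l (fst ak) (snd ak) u v) [0..<n])) \<inter>
     set (concat (map (\<lambda>v. pair_transitions n E l (fst ak) (snd ak) u' v) [0..<n]))"
    then have "fst t = l * n + u" "fst t = l * n + u'" using F by blast+
    with that show False by simp
  qed
qed auto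

lemma distinct_tracker_transitions: "distinct (tracker_transitions n E aks)"
  unfolding tracker_transitions_def
proof (rule distinct_concat_map)
  have *: "\<exists>u<n. fst t = l * n + u" if "t \<in> set (layer_transitions n E l ak)" for t l ak
    using that by (auto simp: layer_transitions_def pair_transitions_def)
  show "set (layer_transitions n E l (aks ! l)) \<inter> set (layer_transitions n E l' (aks ! l')) = {}" if "l \<noteq> l'" for l l'
  proof -
    have False if t: "t \<in> set (layer_transitions n E l (aks ! l))" "t \<in> set (layer_transitions n E l' (aks ! l'))" for t
    proof -
      obtain u u' where "u < n" "u' < n" "fst t = l * n + u" "fst t = l' * n + u'"
        using *[OF t(1)] *[OF t(2)] by blast
      with layer_index_inject[of u n u' l l'] \<open>l \<noteq> l'\<close> show False by simp
    qed
    then show ?thesis by blast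
  qed
qed (auto simp: distinct_layer_transitions)

lemma length_tracker_transitions: "length (tracker_transitions n E aks) = 2 * length aks * (n * n)"
proof -
  have "length (concat (map (\<lambda>v. pair_transitions n E l a kd u v) [0..<n])) = n * 2" for l a kd u
    by (subst length_concat_const[where c = 2]) (auto simp: pair_transitions_def)
  then have "length (layer_transitions n E l ak) = n * (n * 2)" for l ak
    unfolding layer_transitions_def by (subst length_concat_const[where c = "n * 2"]) auto
  then show ?thesis
    unfolding tracker_transitions_def by (subst length_concat_const[where c = "n * (n * 2)"]) auto
qed

lemma codes_tracker:
  "codes_machine (map (cell_val (input_cell (graph_code n E))) (out n 0 \<rho> (tracker_gen aks))) (tracker n E aks)"
proof -
  let ?c = "map (cell_val (input_cell (graph_code n E)))"
  let ?L = "length aks"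
  have 1: "?c (out n 0 \<rho> (seqs (map (\<lambda>l. For (For (pair_gen l (fst (aks ! l)) (snd (aks ! l))))) xs))) =
      concat (map transition_code (concat (map (\<lambda>l. layer_transitions n E l (aks ! l)) xs)))" for xs
    by (induction xs) (simp_all only: list.map seqs.simps out.simps(1,4) concat.simps map_append concat_append out_layer)
  have 2: "?c (out n 0 \<rho> (For (Emit (Sum (Prod (Lit ?L) Size) (Idx 0))))) = map (\<lambda>x. ?L * n + x) [0..<n]"
  proof -
    have "?c (concat (map (\<lambda>v. [Val (?L * n + v)]) xs)) = map (\<lambda>x. ?L * n + x) xs" for xs
      by (induction xs) auto
    then show ?thesis by simp
  qed
  have app: "out n 0 \<rho> (seqs (gs @ hs)) = out n 0 \<rho> (seqs gs) @ out n 0 \<rho> (seqs hs)" for gs hs by simp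
  have "?c (out n 0 \<rho> (tracker_gen aks)) =
      [(?L + 1) * n + 1, 0, n] @ map (\<lambda>x. ?L * n + x) [0..<n] @ [2 * ?L * (n * n)] @
      concat (map transition_code (tracker_transitions n E aks))"
    unfolding tracker_gen_def app map_append 1 tracker_transitions_def seqs.simps out.simps(1,2,4) 2 by simp
  then show ?thesis unfolding codes_machine_def
    by (intro exI[of _ "map (\<lambda>x. ?L * n + x) [0..<n]"] exI[of _ "tracker_transitions n E aks"])
      (auto simp: distinct_tracker_transitions length_tracker_transitions tracker_def distinct_map inj_on_def lessThan_atLeast0)
qed

section \<open>The instance and its answer\<close>

definition instance_gen :: "protocol \<Rightarrow> nat \<Rightarrow> gen" where
  "instance_gen ls m = seqs (pda_gen # map (\<lambda>i. tracker_gen (for_tracker ls i)) [0..<m])"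

lemma gen_ok_step_end: "k \<ge> 2 \<Longrightarrow> gen_ok k (step_gen kd)" "k \<ge> 2 \<Longrightarrow> gen_ok k (end_gen kd)"
    "nest (step_gen kd) = 0" "nest (end_gen kd) = 0"
  by (cases kd; simp)+

text \<open>The deepest loops run over pairs of vertices. The numbers of blocks and of automata do
  not depend on the graph and are unrolled.\<close>

lemma gen_ok_instance_gen: "gen_ok 0 (instance_gen ls m)" and nest_instance_gen: "nest (instance_gen ls m) \<le> 2"
proof -
  have d: "eidx (fst (delta_exprs p a \<alpha>)) \<le> k \<and> (\<forall>e\<in>set (snd (delta_exprs p a \<alpha>)). eidx e \<le> k)"
    if "eidx p \<le> k" for p a \<alpha> k
    using that by (auto simp: delta_exprs_def)
  have s: "gen_ok k (state_gen p)" "nest (state_gen p) = 0" if "eidx p \<le> k" for p k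
  proof -
    have "nest (state_gen p) \<le> 0" by (simp only: state_gen_def nest_seqs) (auto simp: move_gen_def)
    then show "nest (state_gen p) = 0" by simp
    show "gen_ok k (state_gen p)"
      using that d[OF that] by (auto simp: state_gen_def move_gen_def simp del: upt_rec_numeral)
  qed
  have p: "gen_ok 0 pda_gen" "nest pda_gen \<le> 2"
    using s(1)[of "Idx 0" "Suc 0"] s(1)[of Size 0] s(2)[of "Idx 0" "Suc 0"] s(2)[of Size 0]
    by (auto simp: pda_gen_def)
  have q: "gen_ok 2 (pair_gen l a kd)" "nest (pair_gen l a kd) = 0" for l a kd
    by (auto simp: pair_gen_def gen_ok_step_end)
  have "gen_ok 0 (tracker_gen aks)" "nest (tracker_gen aks) \<le> 2" for aks
    unfolding tracker_gen_def nest_seqs gen_ok_seqs using q by (auto simp: numeral_2_eq_2)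
  with p show "gen_ok 0 (instance_gen ls m)" "nest (instance_gen ls m) \<le> 2"
    unfolding instance_gen_def nest_seqs gen_ok_seqs by auto
qed

definition answer :: "protocol \<Rightarrow> nat \<Rightarrow> nat \<Rightarrow> (nat \<times> nat) set \<Rightarrow> bool" where
  "answer ls m n E \<longleftrightarrow> (\<exists>w. accepts_from n 0 [0] w \<and> (\<forall>i<m. tracks n E (for_tracker ls i) 0 0 w))"

text \<open>Stated for all protocols and all relations \<open>E\<close>, because the quadratic lower
  bound uses a protocol of its own and relations that are not symmetric.\<close>

lemma instance_in_nonemptiness_problem:
  assumes "b \<ge> 2" "k \<ge> 2"
  shows "(reduced (instance_gen ls (k - 1)) (graph_code n E), (length ls + 1) * n + 1, answer ls (k - 1) n E)
    \<in> nonemptiness_problem dpda b 7 4 k"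
proof -
  let ?c = "map (cell_val (input_cell (graph_code n E)))"
  let ?A = "\<lambda>i. tracker n E (for_tracker ls i)"
  let ?P = "counter_pda n"
  let ?As = "map ?A [0..<k - 1]"
  let ?cA = "\<lambda>i. ?c (out n 0 (\<lambda>_. 0) (tracker_gen (for_tracker ls i)))"
  let ?css = "?c (out n 0 (\<lambda>_. 0) pda_gen) # map ?cA [0..<k - 1]"
  have code: "reduced (instance_gen ls (k - 1)) (graph_code n E) = concat ?css"
    by (simp add: reduced_def hd_graph_code instance_gen_def map_concat o_def)
  have cs: "list_all2 codes_machine ?css (?P # ?As)"
    by (simp add: codes_counter_pda codes_tracker list.rel_map list_all2_same)
  have "(\<lambda>M. card (states M)) ` set (?P # ?As) = {n + 1, (length ls + 1) * n + 1}"
    using assms(2) by (simp add: image_image image_constant_conv)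
  then have size: "Max ((\<lambda>M. card (states M)) ` set (?P # ?As)) = (length ls + 1) * n + 1" by simp
  have "lang ?P \<inter> (\<Inter>A\<in>set ?As. lang A) \<noteq> {} \<longleftrightarrow> answer ls (k - 1) n E"
    by (auto simp: answer_def lang_counter_pda lang_tracker)
  moreover have "numbered 7 4 M" if "M \<in> set (?P # ?As)" for M
    using that by (auto simp: numbered_def)
  moreover have "\<forall>A\<in>set ?As. nfa A" by (simp add: nfa_tracker)
  ultimately show ?thesis unfolding nonemptiness_problem_def code
    using cs size dpda_counter_pda push_bounded_counter_pda[OF assms(1)]
    by (intro CollectI exI[of _ ?P] exI[of _ ?As] exI[of _ ?css]) simp
qed

lemma answer_iff_joint:
  assumes "m > 0" "n > 0"
  shows "answer ls m n E \<longleftrightarrow> (\<exists>x'. joint n m E ls (0, [0], \<lambda>_. 0) (0, [0], x'))"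
  using common_word_iff_joint[OF assms(1), of 0 ls "\<lambda>_. 0" n 0 "[0]" E] assms(2) by (simp add: answer_def)

lemma answer_protocol:
  assumes "m > 0" "simple_graph n E"
  shows "answer (protocol m) m n E \<longleftrightarrow> has_clique (3 * m) n E"
proof (cases "n = 0")
  case True
  \<comment> \<open>Without vertices the finite automata have no final state, in accordance with the
    absence of a clique of positive size.\<close>
  have "\<not> tracks n E aks 0 0 w" for aks w using True by (simp add: tracks_def)
  then show ?thesis using assms(1) True by (auto simp: answer_def has_clique_def)
next
  case False
  then show ?thesis
    using answer_iff_joint joint_protocol has_clique_iff_tuples[OF assms(2)] assms(1) by simp
qed

lemma clique_solvable:
  assumes "combinatorial_class C" "k \<ge> 2" "b \<ge> 2" "e \<ge> 2"
    "solvable_in_power C (nonemptiness_problem dpda b 7 4 k) e"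
  shows "solvable_in_power C (clique_problem (3 * (k - 1))) e"
proof (rule clique_solvable_by_reduction[OF assms(1) gen_ok_instance_gen nest_instance_gen _ assms(4) _ assms(5)])
  show "(reduced (instance_gen (protocol (k - 1)) (k - 1)) (graph_code n E), (length (protocol (k - 1)) + 1) * n + 1,
      has_clique (3 * (k - 1)) n E) \<in> nonemptiness_problem dpda b 7 4 k" if "simple_graph n E" for n E
    using instance_in_nonemptiness_problem[OF assms(3,2), of "protocol (k - 1)" n E]
      answer_protocol[OF _ that, of "k - 1"] assms(2) by simp
qed simp


section \<open>The quadratic lower bound\<close>

lemma exec_deterministic:
  "exec W A \<sigma> t \<sigma>' \<Longrightarrow> exec W A \<sigma> t2 \<sigma>2 \<Longrightarrow> t2 = t \<and> \<sigma>2 = \<sigma>'"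
proof (induction arbitrary: t2 \<sigma>2 rule: exec.induct)
  case (exec_Const v d r m)
  then show ?case by (auto elim: exec.cases)
next
  case (exec_Op f r a b d m)
  from exec_Op.prems show ?case by cases auto
next
  case (exec_Load d a r m)
  then show ?case by cases auto
next
  case (exec_Store a d r m)
  then show ?case by cases auto
next
  case (exec_Seq A \<sigma> t \<sigma>' B t' \<sigma>'')
  from exec_Seq.prems obtain u u' \<tau> where "exec W A \<sigma> u \<tau>" "exec W B \<tau> u' \<sigma>2" "t2 = u + u'"
    by cases auto
  then show ?case using exec_Seq.IH by blast
next
  case (exec_IfTrue r a A m t \<sigma> B)
  from exec_IfTrue.prems exec_IfTrue.hyps obtain u where "exec W A (r, m) u \<sigma>2" "t2 = 1 + u"
    by cases auto
  then show ?case using exec_IfTrue.IH by blast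
next
  case (exec_IfFalse r a B m t \<sigma> A)
  from exec_IfFalse.prems exec_IfFalse.hyps obtain u where "exec W B (r, m) u \<sigma>2" "t2 = 1 + u"
    by cases auto
  then show ?case using exec_IfFalse.IH by blast
next
  case (exec_WhileFalse r a A m)
  from exec_WhileFalse.prems exec_WhileFalse.hyps show ?case by cases auto
next
  case (exec_WhileTrue r a A m t \<sigma> t' \<sigma>')
  from exec_WhileTrue.prems exec_WhileTrue.hyps obtain u u' \<tau>
    where "exec W A (r, m) u \<tau>" "exec W (While a A) \<tau> u' \<sigma>2" "t2 = 1 + u + u'"
    by cases auto
  then show ?case using exec_WhileTrue.IH by blast
qed

text \<open>\<open>J\<close> collects initial cells on which the run may depend, at most one per
  step: every memory that agrees on them leads to the same registers in the same time. The last
  clause passes agreement on cell by cell, so that cells read later can be traced back to the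
  initial memory; this makes the notion compose.\<close>

definition reads_only :: "nat \<Rightarrow> program \<Rightarrow> ram_state \<Rightarrow> nat \<Rightarrow> ram_state \<Rightarrow> nat set \<Rightarrow> bool" where
  "reads_only W A \<sigma> t \<sigma>' J \<longleftrightarrow> finite J \<and> card J \<le> t \<and>
     (\<forall>m2. (\<forall>i\<in>J. m2 i = snd \<sigma> i) \<longrightarrow>
       (\<exists>m2'. exec W A (fst \<sigma>, m2) t (fst \<sigma>', m2') \<and> (\<forall>i. m2 i = snd \<sigma> i \<longrightarrow> m2' i = snd \<sigma>' i)))"

text \<open>Phrased for any \<open>D\<close> that runs like \<open>A\<close> followed by
  \<open>B\<close>, in order to cover both \<open>Seq\<close> and a round of \<open>While\<close>
  with its extra step.\<close>

lemma reads_only_Seq: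
  assumes J: "reads_only W A \<sigma> t \<sigma>' J" and J': "reads_only W B \<sigma>' t' \<sigma>'' J'"
    and step: "\<And>m m' m''. exec W A (fst \<sigma>, m) t (fst \<sigma>', m') \<Longrightarrow> exec W B (fst \<sigma>', m') t' (fst \<sigma>'', m'') \<Longrightarrow>
      exec W D (fst \<sigma>, m) u (fst \<sigma>'', m'')"
    and u: "t + t' \<le> u"
  shows "reads_only W D \<sigma> u \<sigma>'' (J \<union> J')"
  unfolding reads_only_def
proof (intro conjI allI impI)
  show "finite (J \<union> J')" using J J' by (simp add: reads_only_def)
  show "card (J \<union> J') \<le> u" using J J' u card_Un_le[of J J'] by (simp add: reads_only_def)
  fix m2 assume m2: "\<forall>i\<in>J \<union> J'. m2 i = snd \<sigma> i"
  then obtain m2' where m2': "exec W A (fst \<sigma>, m2) t (fst \<sigma>', m2')" "\<forall>i. m2 i = snd \<sigma> i \<longrightarrow> m2' i = snd \<sigma>' i"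
    using J unfolding reads_only_def by blast
  then have "\<forall>i\<in>J'. m2' i = snd \<sigma>' i" using m2 by blast
  then obtain m2'' where "exec W B (fst \<sigma>', m2') t' (fst \<sigma>'', m2'')" "\<forall>i. m2' i = snd \<sigma>' i \<longrightarrow> m2'' i = snd \<sigma>'' i"
    using J' unfolding reads_only_def by blast
  with m2' step show "\<exists>m2''. exec W D (fst \<sigma>, m2) u (fst \<sigma>'', m2'') \<and> (\<forall>i. m2 i = snd \<sigma> i \<longrightarrow> m2'' i = snd \<sigma>'' i)"
    by blast
qed

lemma reads_only_weaken:
  assumes J: "reads_only W A \<sigma> t \<sigma>' J"
    and step: "\<And>m m'. exec W A (fst \<sigma>, m) t (fst \<sigma>', m') \<Longrightarrow> exec W D (fst \<sigma>, m) u (fst \<sigma>', m')"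
    and u: "t \<le> u"
  shows "reads_only W D \<sigma> u \<sigma>' J"
  using assms unfolding reads_only_def by (meson le_trans)

lemma exec_reads_only: "exec W A \<sigma> t \<sigma>' \<Longrightarrow> \<exists>J. reads_only W A \<sigma> t \<sigma>' J"
proof (induction rule: exec.induct)
  case (exec_Const v d r m)
  then have "reads_only W (Const d v) (r, m) 1 (r(d := v), m) {}"
    by (auto simp: reads_only_def intro!: exec.exec_Const simp del: One_nat_def)
  then show ?case ..
next
  case (exec_Op f r a b d m)
  then have "reads_only W (Op f d a b) (r, m) 1 (r(d := binop_val f (r a) (r b)), m) {}"
    by (auto simp: reads_only_def intro!: exec.exec_Op simp del: One_nat_def)
  then show ?case ..
next
  case (exec_Load d a r m)
  have "exec W (Load d a) (r, m2) 1 (r(d := m (r a)), m2)" if "m2 (r a) = m (r a)" for m2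
    using exec.exec_Load[of W d a r m2] that by simp
  then have "reads_only W (Load d a) (r, m) 1 (r(d := m (r a)), m) {r a}"
    unfolding reads_only_def by (auto simp del: One_nat_def)
  then show ?case ..
next
  case (exec_Store a d r m)
  \<comment> \<open>The written value comes from a register, so the cell agrees afterwards in both
    memories, and nothing is read.\<close>
  have "reads_only W (Store a d) (r, m) 1 (r, m(r a := r d)) {}"
    unfolding reads_only_def using exec.exec_Store[of W a d r] by fastforce
  then show ?case ..
next
  case (exec_Seq A \<sigma> t \<sigma>' B t' \<sigma>'')
  then obtain J J' where J: "reads_only W A \<sigma> t \<sigma>' J" "reads_only W B \<sigma>' t' \<sigma>'' J'" by blast
  have "reads_only W (Seq A B) \<sigma> (t + t') \<sigma>'' (J \<union> J')"
    by (rule reads_only_Seq[OF J]) (auto intro: exec.exec_Seq)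
  then show ?case ..
next
  case (exec_IfTrue r a A m t \<sigma> B)
  then obtain J where "reads_only W A (r, m) t \<sigma> J" by blast
  then have "reads_only W (If a A B) (r, m) (1 + t) \<sigma> J"
    by (rule reads_only_weaken) (use exec_IfTrue.hyps exec.exec_IfTrue[of r a W A] in auto)
  then show ?case ..
next
  case (exec_IfFalse r a B m t \<sigma> A)
  then obtain J where "reads_only W B (r, m) t \<sigma> J" by blast
  then have "reads_only W (If a A B) (r, m) (1 + t) \<sigma> J"
    by (rule reads_only_weaken) (use exec_IfFalse.hyps exec.exec_IfFalse[of r a W B] in auto)
  then show ?case ..
next
  case (exec_WhileFalse r a A m)
  then have "reads_only W (While a A) (r, m) 1 (r, m) {}"
    unfolding reads_only_def using exec.exec_WhileFalse[of r a W A] by auto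
  then show ?case ..
next
  case (exec_WhileTrue r a A m t \<sigma> t' \<sigma>')
  then obtain J J' where J: "reads_only W A (r, m) t \<sigma> J" "reads_only W (While a A) \<sigma> t' \<sigma>' J'" by blast
  have "reads_only W (While a A) (r, m) (1 + t + t') \<sigma>' (J \<union> J')"
    by (rule reads_only_Seq[OF J]) (use exec_WhileTrue.hyps exec.exec_WhileTrue[of r a W A] in auto)
  then show ?case ..
qed

text \<open>It merely asks for an edge, so that starting from the empty relation each single matrix
  entry can change the answer.\<close>

definition edge_protocol :: protocol where
  "edge_protocol = [(Acc, \<lambda>_. Guess), (Acc, \<lambda>_. Jump)]"

lemma answer_edge_protocol:
  assumes "m > 0" "n > 0"
  shows "answer edge_protocol m n E \<longleftrightarrow> (\<exists>u<n. \<exists>v<n. (u, v) \<in> E)"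
proof
  assume "answer edge_protocol m n E"
  then show "\<exists>u<n. \<exists>v<n. (u, v) \<in> E"
    unfolding answer_iff_joint[OF assms] edge_protocol_def using assms(1) by fastforce
next
  assume "\<exists>u<n. \<exists>v<n. (u, v) \<in> E"
  then obtain u v where uv: "u < n" "v < n" "(u, v) \<in> E" by blast
  let ?f = "\<lambda>u i. if i < m then u else 0 :: nat"
  have "joint_step n m E (Acc, \<lambda>_. Guess) 0 (0, [0], \<lambda>_. 0) (0, [0], ?f u)"
    "joint_step n m E (Acc, \<lambda>_. Jump) 0 (0, [0], ?f u) (0, [0], ?f v)"
    using uv by auto
  then have "joint n m E edge_protocol (0, [0], \<lambda>_. 0) (0, [0], ?f v)"
    unfolding edge_protocol_def joint.simps by blast
  then show "answer edge_protocol m n E" unfolding answer_iff_joint[OF assms] by blast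
qed

text \<open>Each position of the input depends on at most one pair of vertices, so an algorithm has to
  look at \<open>n\<^sup>2\<close> positions to find out that there is no edge.\<close>

lemma nonemptiness_needs_quadratic_time:
  assumes "k \<ge> 2" "b \<ge> 2" "decides_in_time A (nonemptiness_problem dpda b 7 4 k) T" "n > 0"
  shows "real (n * n) \<le> T (3 * n + 1)"
proof (rule ccontr)
  assume *: "\<not> real (n * n) \<le> T (3 * n + 1)"
  let ?g = "instance_gen edge_protocol (k - 1)"
  define os where "os = out n 0 (\<lambda>_. 0) ?g"
  define xs where "xs E = reduced ?g (graph_code n E)" for E
  have xs: "xs E = map (cell_val (input_cell (graph_code n E))) os" for E
    by (simp add: xs_def os_def reduced_def hd_graph_code)
  obtain c where c: "\<And>ys s ans. (ys, s, ans) \<in> nonemptiness_problem dpda b 7 4 k \<Longrightarrow> \<exists>t r m.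
      exec (word_bound c ys) A (initial_state ys) t (r, m) \<and> r 0 = of_bool ans \<and> real t \<le> T s"
    using assms(3) unfolding decides_in_time_def by blast
  have dec: "\<exists>t r m. exec (word_bound c (xs E)) A (initial_state (xs E)) t (r, m) \<and>
      r 0 = of_bool (\<exists>u<n. \<exists>v<n. (u, v) \<in> E) \<and> real t \<le> T (3 * n + 1)" for E
  proof -
    \<comment> \<open>Two blocks mean three layers of \<open>n\<close> states, plus the additional
      state.\<close>
    have "(length edge_protocol + 1) * n + 1 = 3 * n + 1" by (simp add: edge_protocol_def)
    moreover have "answer edge_protocol (k - 1) n E \<longleftrightarrow> (\<exists>u<n. \<exists>v<n. (u, v) \<in> E)"
      by (rule answer_edge_protocol) (use assms(1,4) in auto)
    ultimately show ?thesis
      using c[OF instance_in_nonemptiness_problem[OF assms(2,1), of edge_protocol n E]]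
      unfolding xs_def by (simp only:)
  qed
  obtain t r m where t: "exec (word_bound c (xs {})) A (initial_state (xs {})) t (r, m)" "r 0 = 0"
    "real t \<le> T (3 * n + 1)"
    using dec[of "{}"] by auto
  have tn: "t < n * n" using t(3) * by (metis not_le of_nat_le_iff order_trans)
  \<comment> \<open>The two inputs may have different word bounds. Under the larger one both runs
    exist, and determinism can compare them.\<close>
  define W where "W E = max (word_bound c (xs {})) (word_bound c (xs E))" for E
  obtain J where J: "finite J" "card J \<le> t" "\<And>W' m2. word_bound c (xs {}) \<le> W' \<Longrightarrow>
      \<forall>i\<in>J. m2 i = snd (initial_state (xs {})) i \<Longrightarrow> \<exists>m2'. exec W' A ((\<lambda>_. 0), m2) t (r, m2')"
  proof -
    obtain J where J: "reads_only (word_bound c (xs {})) A (initial_state (xs {})) t (r, m) J"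
      using exec_reads_only[OF t(1)] by blast
    show ?thesis
    proof (rule that[of J])
      show "finite J" "card J \<le> t" using J by (auto simp: reads_only_def)
      fix W' m2 assume W': "word_bound c (xs {}) \<le> W'" and "\<forall>i\<in>J. m2 i = snd (initial_state (xs {})) i"
      then obtain m2' where "exec (word_bound c (xs {})) A ((\<lambda>_. 0), m2) t (r, m2')"
        using J unfolding reads_only_def initial_state_def fst_conv by blast
      from exec_mono[OF this W'] show "\<exists>m2'. exec W' A ((\<lambda>_. 0), m2) t (r, m2')" by blast
    qed
  qed
  \<comment> \<open>The adjacency positions behind the cells in \<open>J\<close>, at most one for
    each cell.\<close>
  define I where "I = {i. \<exists>j\<in>J. j < length os \<and> os ! j = Neg i}"
  have "I \<subseteq> (\<lambda>j. case os ! j of Neg i \<Rightarrow> i | Val _ \<Rightarrow> 0) ` J"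
    by (force simp: I_def)
  then have "card I \<le> card J" using J(1) by (meson card_image_le card_mono finite_imageI order_trans)
  then have cI: "card I < n * n" using J(2) tn by simp
  have fI: "finite I" using \<open>I \<subseteq> _\<close> J(1) finite_subset by blast
  have "\<exists>u<n. \<exists>v<n. u * n + v + 1 \<notin> I"
  proof (rule ccontr)
    assume "\<not> (\<exists>u<n. \<exists>v<n. u * n + v + 1 \<notin> I)"
    then have "(\<lambda>(u, v). u * n + v + 1) ` ({..<n} \<times> {..<n}) \<subseteq> I" by auto
    moreover have "inj_on (\<lambda>(u, v). u * n + v + 1) ({..<n} \<times> {..<n})"
      by (auto simp: inj_on_def layer_index_inject)
    ultimately have "card ({..<n} \<times> {..<n}) \<le> card I" using fI by (metis card_image card_mono)
    with cI show False by (simp add: card_cartesian_product)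
  qed
  then obtain u v where uv: "u < n" "v < n" "u * n + v + 1 \<notin> I" by blast
  \<comment> \<open>A single directed pair instead of a simple graph: the instance makes sense for
    every relation, so the \<open>n * n\<close> entries can be changed independently.\<close>
  let ?E = "{(u, v)}"
  have agree: "xs ?E ! j = xs {} ! j" if "j \<in> J" "j < length os" for j
  proof (cases "os ! j")
    case (Val x)
    then show ?thesis using that by (simp add: xs)
  next
    case (Neg i)
    have "i \<noteq> u * n + v + 1" using uv(3) that Neg by (auto simp: I_def)
    then have "input_cell (graph_code n ?E) i = input_cell (graph_code n {}) i"
    proof (cases i)
      case (Suc i')
      then have "i' \<noteq> u * n + v" using \<open>i \<noteq> _\<close> by simp
      then have "\<not> (i' div n = u \<and> i' mod n = v)" using div_mult_mod_eq[of i' n] by auto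
      then show ?thesis by (simp add: Suc input_cell_def graph_code_def matrix_entries_def)
    qed (simp add: input_cell_def graph_code_def)
    then show ?thesis using that Neg by (simp add: xs)
  qed
  then have "\<forall>i\<in>J. snd (initial_state (xs ?E)) i = snd (initial_state (xs {})) i"
    by (auto simp: initial_state_def xs)
  then obtain m2' where 1: "exec (W ?E) A ((\<lambda>_. 0), snd (initial_state (xs ?E))) t (r, m2')"
    using J(3)[of "W ?E"] by (auto simp: W_def)
  obtain t2 r2 m2 where 2: "exec (word_bound c (xs ?E)) A (initial_state (xs ?E)) t2 (r2, m2)" "r2 0 = 1"
    using dec[of ?E] uv(1,2) by auto
  have "exec (W ?E) A (initial_state (xs ?E)) t2 (r2, m2)" by (rule exec_mono[OF 2(1)]) (simp add: W_def)
  with 1 have "r2 = r" using exec_deterministic by (fastforce simp: initial_state_def)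
  with t(2) 2(2) show False by simp
qed

lemma not_solvable_below_quadratic:
  assumes "k \<ge> 2" "b \<ge> 2" "e < 2"
  shows "\<not> solvable_in_power C (nonemptiness_problem dpda b 7 4 k) e"
proof
  assume "solvable_in_power C (nonemptiness_problem dpda b 7 4 k) e"
  then obtain A T where T: "T \<in> O(\<lambda>n. real n powr e)" and A: "decides_in_time A (nonemptiness_problem dpda b 7 4 k) T"
    by (auto simp: solvable_in_power_def)
  \<comment> \<open>\<open>bigo_linear_substitution\<close> asks for a nonnegative exponent; raising
    a negative \<open>e\<close> to 0 keeps it below 2.\<close>
  define e' where "e' = max e 0"
  have "(\<lambda>n. real n powr e) \<in> O(\<lambda>n. real n powr e')"
    by (rule bigoI[of _ 1], rule eventually_mono[OF eventually_ge_at_top[of 1]]) (auto simp: e'_def intro!: powr_mono)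
  with T have "T \<in> O(\<lambda>n. real n powr e')" by (rule landau_o.big_trans)
  then have "(\<lambda>n. T (3 * n + 1)) \<in> O(\<lambda>n. real n powr e')"
    by (rule bigo_linear_substitution) (auto simp: e'_def)
  moreover have "(\<lambda>n. real n powr e') \<in> o(\<lambda>n. real n powr 2)"
    by (subst powr_smallo_iff[OF filterlim_real_sequentially]) (use assms(3) in \<open>auto simp: e'_def\<close>)
  ultimately have "(\<lambda>n. T (3 * n + 1)) \<in> o(\<lambda>n. real n powr 2)" by (rule landau_o.big_small_trans)
  then have "eventually (\<lambda>n. norm (T (3 * n + 1)) \<le> 1 / 2 * norm (real n powr 2)) sequentially"
    by (rule landau_o.smallD) simp
  with eventually_gt_at_top[of 0] have "eventually (\<lambda>n :: nat. False) sequentially"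
  proof eventually_elim
    case (elim n)
    have "real (n * n) \<le> T (3 * n + 1)"
      by (rule nonemptiness_needs_quadratic_time[OF assms(1,2) A elim(1)])
    also have "\<dots> \<le> 1 / 2 * real (n * n)" using elim(2) by (simp add: power2_eq_square)
    finally have "real (n * n) \<le> 1 / 2 * real (n * n)" .
    moreover have "real (n * n) > 0" using elim(1) by simp
    ultimately show False by linarith
  qed
  then show False by simp
qed

lemma dpda_solvable_if_pda_solvable:
  assumes "solvable_in_power C (nonemptiness_problem pda b s g k) e"
  shows "solvable_in_power C (nonemptiness_problem dpda b s g k) e"
proof -
  have "nonemptiness_problem dpda b s g k \<subseteq> nonemptiness_problem pda b s g k"
    unfolding nonemptiness_problem_def dpda_def by blast
  then have "decides_in_time A (nonemptiness_problem pda b s g k) T \<Longrightarrow>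
      decides_in_time A (nonemptiness_problem dpda b s g k) T" for A T
    unfolding decides_in_time_def by (meson subsetD)
  then show ?thesis using assms unfolding solvable_in_power_def by blast
qed

text \<open>Both parts of the theorem are instances, the first with \<open>C = UNIV\<close>. Below
  exponent 2, writing the instance could take longer than the assumed algorithm, so the reduction
  says nothing there and the reading bound takes over.\<close>

lemma not_solvable_if_clique_hard:
  assumes "combinatorial_class C" "k \<ge> 2" "b \<ge> 2"
    "\<And>\<epsilon>. \<epsilon> > 0 \<Longrightarrow> \<not> solvable_in_power C (clique_problem (3 * (k - 1))) (x - \<epsilon>)" "\<epsilon> > 0"
  shows "\<not> solvable_in_power C (nonemptiness_problem pda b 7 4 k) (x - \<epsilon>) \<and>
    \<not> solvable_in_power C (nonemptiness_problem dpda b 7 4 k) (x - \<epsilon>)"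
proof -
  have "\<not> solvable_in_power C (nonemptiness_problem dpda b 7 4 k) (x - \<epsilon>)"
  proof (cases "x - \<epsilon> < 2")
    case True
    with not_solvable_below_quadratic[OF assms(2,3)] show ?thesis .
  next
    case False
    with clique_solvable[OF assms(1-3), of "x - \<epsilon>"] assms(4)[OF assms(5)] show ?thesis by auto
  qed
  then show ?thesis using dpda_solvable_if_pda_solvable by blast
qed

theorem theorem15:
  fixes k :: nat
  assumes "k \<ge> 2"
  shows "\<exists>s g :: nat. g > 0 \<and>
    (clique_hypothesis (3 * (k - 1)) \<longrightarrow>
       (\<forall>b \<ge> (2::enat). \<forall>\<epsilon> > 0.
          \<not> solvable_in_power UNIV (nonemptiness_problem pda b s g k) (mm_exponent * real (k - 1) - \<epsilon>) \<and>
          \<not> solvable_in_power UNIV (nonemptiness_problem dpda b s g k) (mm_exponent * real (k - 1) - \<epsilon>))) \<and>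
    (\<forall>C. combinatorial_class C \<and> combinatorial_clique_hypothesis C (3 * (k - 1)) \<longrightarrow>
       (\<forall>b \<ge> (2::enat). \<forall>\<epsilon> > 0.
          \<not> solvable_in_power C (nonemptiness_problem pda b s g k) (3 * real (k - 1) - \<epsilon>) \<and>
          \<not> solvable_in_power C (nonemptiness_problem dpda b s g k) (3 * real (k - 1) - \<epsilon>)))"
proof (rule exI[of _ 7], rule exI[of _ 4], intro conjI impI allI)
  \<comment> \<open>The 7 letters are three step letters and four end letters; the 4 stack symbols
    are the end marker, the unary digit, the separator and the error symbol.\<close>
  show "(0 :: nat) < 4" by simp
next
  fix b :: enat and \<epsilon> :: real
  assume "clique_hypothesis (3 * (k - 1))" and b: "2 \<le> b" and \<epsilon>: "0 < \<epsilon>"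
  then have "\<not> solvable_in_power UNIV (clique_problem (3 * (k - 1))) (mm_exponent * real (k - 1) - \<epsilon>)" if "\<epsilon> > 0" for \<epsilon>
    using that by (simp add: clique_hypothesis_def)
  note * = not_solvable_if_clique_hard[OF _ assms b this \<epsilon>]
  show "\<not> solvable_in_power UNIV (nonemptiness_problem pda b 7 4 k) (mm_exponent * real (k - 1) - \<epsilon>)"
    "\<not> solvable_in_power UNIV (nonemptiness_problem dpda b 7 4 k) (mm_exponent * real (k - 1) - \<epsilon>)"
    using * by (simp_all add: combinatorial_class_def)
next
  fix C :: "program set" and b :: enat and \<epsilon> :: real
  assume C: "combinatorial_class C \<and> combinatorial_clique_hypothesis C (3 * (k - 1))" and b: "2 \<le> b" and \<epsilon>: "0 < \<epsilon>"
  then have "\<not> solvable_in_power C (clique_problem (3 * (k - 1))) (3 * real (k - 1) - \<epsilon>)" if "\<epsilon> > 0" for \<epsilon>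
    using that by (simp add: combinatorial_clique_hypothesis_def)
  note * = not_solvable_if_clique_hard[OF conjunct1[OF C] assms b this \<epsilon>]
  show "\<not> solvable_in_power C (nonemptiness_problem pda b 7 4 k) (3 * real (k - 1) - \<epsilon>)"
    "\<not> solvable_in_power C (nonemptiness_problem dpda b 7 4 k) (3 * real (k - 1) - \<epsilon>)"
    using * by simp_all
qed

end
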